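(* Let $f$ be the germ at the origin of a real-analytic, symplectic, planar map with an elliptic fixed point at the origin, having rational rotation number $\omega_0=\frac{p}{q}\in(0,\tfrac12)$, $\gcd(p,q)=1$, $q\ge3$, and suppose $f$ admits a real-analytic first integral $I_1$, defined in a neighbourhood $U$ of the origin, with a non-degenerate local minimum at $(0,0)$. If $f$ admits a second first integral $I_2$ (real-analytic, or real-meromorphic having no pole at the origin, or $C^\infty$-smooth), functionally independent of $I_1$ on an open and dense subset of $U$, then $f$ is real-analytically, symplectically, conjugate to its linear part.
   Context: A real-analytic planar map germ $f$ with $f(0,0)=(0,0)$ has an elliptic fixed point at the origin with rotation number $\omega_0\in(0,\tfrac12)$ if the eigenvalues of its linear part $L=d_{(0,0)}f$ are $\mu=e^{i2\pi\omega_0}$ and $\bar\mu$. The plane is identified with $\mathbb{C}$ via $z=x+iy$, and it is assumed that in this coordinate $L(z)=\mu z$. Symplectic means preserving $dx\wedge dy$. A first integral of $f$ is a function $I$ defined in a neighbourhood of the origin with $I\circ f=I$ near the origin (wherever both sides are defined, in the meromorphic case). A non-degenerate local minimum at $(0,0)$ means a critical point there with positive definite Hessian. A real-meromorphic function with no pole at the origin is a quotient $P/Q$ of real-analytic functions with $Q(0,0)\neq0$. Functional independence of two functions on an open set means that their differentials are linearly independent at every point of it. Two germs $f,g$ fixing the origin are real-analytically, symplectically, conjugate if there is a germ of real-analytic diffeomorphism $\phi$ fixing the origin and preserving $dx\wedge dy$ with $\phi^{-1}\circ f\circ\phi=g$. *)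

theory Defs
  imports "HOL-Analysis.Analysis"
begin

text \<open>
  The plane is the type \<^typ>\<open>complex\<close>, regarded as a real vector space with coordinates
  \<^term>\<open>Re z\<close> and \<^term>\<open>Im z\<close>; every derivative below is a real Frechet derivative. Germs at the
  origin are represented by total functions, and identities between germs by
  \<^term>\<open>\<lambda>P :: complex \<Rightarrow> bool. eventually P (nhds 0)\<close>; values away from the domain under
  consideration are irrelevant.
\<close>

definition real_analytic_at :: "(complex \<Rightarrow> 'b::real_normed_vector) \<Rightarrow> complex \<Rightarrow> bool" where
  "real_analytic_at f z \<longleftrightarrow>
     (\<exists>(a :: nat \<Rightarrow> nat \<Rightarrow> 'b) r. r > 0 \<and>
        (\<forall>h. norm h < r \<longrightarrow>
           ((\<lambda>(i, j). (Re h ^ i * Im h ^ j) *\<^sub>R a i j) has_sum f (z + h)) UNIV))"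

definition real_analytic_on :: "(complex \<Rightarrow> 'b::real_normed_vector) \<Rightarrow> complex set \<Rightarrow> bool" where
  "real_analytic_on f S \<longleftrightarrow> (\<forall>z\<in>S. real_analytic_at f z)"

text \<open>\<open>Ck_on k g S\<close> is only meant for open \<open>S\<close>; \<open>gx\<close> and \<open>gy\<close> are the partial derivatives.\<close>

primrec Ck_on :: "nat \<Rightarrow> (complex \<Rightarrow> real) \<Rightarrow> complex set \<Rightarrow> bool" where
  "Ck_on 0 g S \<longleftrightarrow> continuous_on S g"
| "Ck_on (Suc k) g S \<longleftrightarrow>
     (\<exists>gx gy. (\<forall>z\<in>S. (g has_derivative (\<lambda>h. gx z * Re h + gy z * Im h)) (at z)) \<and>
              Ck_on k gx S \<and> Ck_on k gy S)"

definition smooth_on :: "(complex \<Rightarrow> real) \<Rightarrow> complex set \<Rightarrow> bool" where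
  "smooth_on g S \<longleftrightarrow> (\<forall>k. Ck_on k g S)"

text \<open>\<open>D\<close> is the domain of definition of the quotient representing \<open>g\<close>; it depends on the
  chosen representation.\<close>

definition real_meromorphic_no_pole_at_origin ::
    "complex set \<Rightarrow> complex set \<Rightarrow> (complex \<Rightarrow> real) \<Rightarrow> bool" where
  "real_meromorphic_no_pole_at_origin S D g \<longleftrightarrow>
     (\<exists>P Q :: complex \<Rightarrow> real.
        real_analytic_on P S \<and> real_analytic_on Q S \<and> Q 0 \<noteq> 0 \<and>
        D = {z \<in> S. Q z \<noteq> 0} \<and> (\<forall>z\<in>D. g z = P z / Q z))"

definition area_form :: "complex \<Rightarrow> complex \<Rightarrow> real" where
  "area_form u v = Re u * Im v - Im u * Re v"

definition symplectic_at :: "(complex \<Rightarrow> complex) \<Rightarrow> complex \<Rightarrow> bool" where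
  "symplectic_at f z \<longleftrightarrow>
     (\<exists>A. (f has_derivative A) (at z) \<and> (\<forall>u v. area_form (A u) (A v) = area_form u v))"

definition symplectic_germ :: "(complex \<Rightarrow> complex) \<Rightarrow> bool" where
  "symplectic_germ f \<longleftrightarrow> (\<forall>\<^sub>F z in nhds 0. symplectic_at f z)"

definition linear_part :: "(complex \<Rightarrow> complex) \<Rightarrow> complex \<Rightarrow> complex" where
  "linear_part f = frechet_derivative f (at 0)"

text \<open>The matrix of a real-linear map in the real basis \<open>1, \<i>\<close> of the plane, with its entries
  viewed as complex numbers so that non-real eigenvalues make sense.\<close>

definition complexified_matrix :: "(complex \<Rightarrow> complex) \<Rightarrow> complex^2^2" where
  "complexified_matrix A =
     vector [vector [of_real (Re (A 1)), of_real (Re (A \<i>))],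
             vector [of_real (Im (A 1)), of_real (Im (A \<i>))]]"

definition eigenvalues :: "(complex \<Rightarrow> complex) \<Rightarrow> complex set" where
  "eigenvalues A =
     {\<nu>. \<exists>v :: complex^2. v \<noteq> 0 \<and> complexified_matrix A *v v = \<nu> *s v}"

definition elliptic_fixed_point_at_origin :: "(complex \<Rightarrow> complex) \<Rightarrow> real \<Rightarrow> bool" where
  "elliptic_fixed_point_at_origin f \<omega> \<longleftrightarrow>
     f 0 = 0 \<and> 0 < \<omega> \<and> \<omega> < 1/2 \<and>
     eigenvalues (linear_part f) = {cis (2 * pi * \<omega>), cnj (cis (2 * pi * \<omega>))}"

text \<open>\<open>D\<close> is the domain of definition of \<open>g\<close>.\<close>

definition first_integral ::
    "(complex \<Rightarrow> complex) \<Rightarrow> complex set \<Rightarrow> (complex \<Rightarrow> real) \<Rightarrow> bool" where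
  "first_integral f D g \<longleftrightarrow>
     0 \<in> interior D \<and> (\<forall>\<^sub>F z in nhds 0. z \<in> D \<longrightarrow> f z \<in> D \<longrightarrow> g (f z) = g z)"

text \<open>\<open>A z\<close> is the differential of \<open>g\<close> at \<open>z\<close>, and \<open>H\<close> is the Hessian form at the origin.\<close>

definition nondegenerate_local_min_at_origin :: "(complex \<Rightarrow> real) \<Rightarrow> bool" where
  "nondegenerate_local_min_at_origin g \<longleftrightarrow>
     (\<exists>A H. (\<forall>\<^sub>F z in nhds 0. (g has_derivative A z) (at z)) \<and>
            (\<forall>v. A 0 v = 0) \<and>
            (\<forall>v. ((\<lambda>z. A z v) has_derivative (\<lambda>u. H u v)) (at 0)) \<and>
            (\<forall>v. v \<noteq> 0 \<longrightarrow> H v v > 0))"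

definition functionally_independent_on ::
    "complex set \<Rightarrow> (complex \<Rightarrow> real) \<Rightarrow> (complex \<Rightarrow> real) \<Rightarrow> bool" where
  "functionally_independent_on S g1 g2 \<longleftrightarrow>
     (\<forall>z\<in>S. \<exists>A1 A2. (g1 has_derivative A1) (at z) \<and> (g2 has_derivative A2) (at z) \<and>
        (\<forall>a b :: real. (\<forall>h. a * A1 h + b * A2 h = 0) \<longrightarrow> a = 0 \<and> b = 0))"

text \<open>\<open>\<psi>\<close> is the inverse germ of \<open>\<phi>\<close>.\<close>

definition analytically_symplectically_conjugate ::
    "(complex \<Rightarrow> complex) \<Rightarrow> (complex \<Rightarrow> complex) \<Rightarrow> bool" where
  "analytically_symplectically_conjugate f g \<longleftrightarrow>
     (\<exists>\<phi> \<psi>. real_analytic_at \<phi> 0 \<and> \<phi> 0 = 0 \<and>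
            real_analytic_at \<psi> 0 \<and> \<psi> 0 = 0 \<and>
            (\<forall>\<^sub>F z in nhds 0. \<psi> (\<phi> z) = z) \<and> (\<forall>\<^sub>F z in nhds 0. \<phi> (\<psi> z) = z) \<and>
            symplectic_germ \<phi> \<and>
            (\<forall>\<^sub>F z in nhds 0. \<psi> (f (\<phi> z)) = g z))"

end

theory Submission
  imports Defs "HOL-Complex_Analysis.Complex_Analysis"
begin


text \<open>
  In one degree of freedom a Hamiltonian with a non-degenerate minimum has convergent symplectic
  normal coordinates: by the Morse lemma its level curves become circles, and a radial rescaling
  followed by a rotation of each circle by a suitable angle turns the density of the area into a
  constant; no small divisors occur. In such coordinates for \<open>I1\<close> the map \<open>f\<close> preserves every
  circle about the origin and the area, so it rotates the circle of radius \<open>r\<close> by an angle that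
  depends analytically on \<open>r\<close>. If that angle is an irrational multiple of \<open>2\<pi>\<close>, then \<open>I2\<close> is constant
  on the circle, so \<open>I1\<close> and \<open>I2\<close> are dependent there. As they are independent on an open set, the
  angle is a rational multiple of \<open>2\<pi>\<close> for an interval of radii, hence constant, and \<open>f\<close> is
  a rotation in these coordinates.

  Throughout, a real-analytic germ is the restriction of a holomorphic function of two variables
  to the totally real plane of points \<open>(z, cnj z)\<close>.
\<close>

section \<open>Holomorphic functions of two variables\<close>

text \<open>The Hessian of \<open>I1\<close> is invariant under multiplication by \<mu>, and \<mu>^2
  is not 1, so it is a multiple of |z|^2. Hence the Morse lemma needs no preliminary linear change,
  the changes \<open>M\<close>, \<Psi> and \<psi> all have a real scalar as derivative at 0, and
  since scalars commute with \<mu> the final rotation factor is read off as \<mu>.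

  Analyticity is handled as complex differentiability near the origin of C^2, so that closure
  properties reduce to the chain rule and the real inverse function theorem. Coefficients appear
  only where something is differentiated termwise, divided by a variable, or inverted along circles;
  bounds M / t^(i+j) replace exact radii of convergence, because a germ lets t shrink.

  The set of independence is only dense and need not contain circles. One of its points on each
  circle suffices, and a short radial segment through such a point supplies the interval of radii.
  There F(r)/r is a root of unity; roots of unity are countable, so the connected image of the
  interval is a single value, and the identity theorem spreads it to all small radii.\<close>

definition geometric_bound :: "(nat \<Rightarrow> nat \<Rightarrow> complex) \<Rightarrow> real \<Rightarrow> real \<Rightarrow> bool" where
  "geometric_bound a M t \<longleftrightarrow> t > 0 \<and> (\<forall>i j. norm (a i j) * t ^ (i + j) \<le> M)"

text \<open>The sum is unordered, and \<open>infsum\<close> returns 0 where it does not exist. A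
  Cauchy estimate \<open>geometric_bound a M t\<close> gives absolute convergence for |z|, |w| <
  t.\<close>

definition double_series :: "(nat \<Rightarrow> nat \<Rightarrow> complex) \<Rightarrow> complex \<times> complex \<Rightarrow> complex" where
  "double_series a p = (\<Sum>\<^sub>\<infinity>(i, j). a i j * fst p ^ i * snd p ^ j)"

lemma geometric_double_summable:
  fixes x y :: real
  assumes "0 \<le> x" "x < 1" "0 \<le> y" "y < 1"
  shows "(\<lambda>(i, j). x ^ i * y ^ j) summable_on (UNIV :: (nat \<times> nat) set)"
proof -
  have geo: "((\<lambda>i. u ^ i) has_sum (1 / (1 - u))) (UNIV :: nat set)" if "0 \<le> u" "u < 1" for u :: real
    using that by (intro sums_nonneg_imp_has_sum geometric_sums) auto
  have "(\<lambda>(i, j). x ^ i * y ^ j) summable_on (SIGMA i:(UNIV::nat set). (UNIV::nat set))"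
  proof (rule summable_on_SigmaI)
    show "((\<lambda>j. case (i, j) of (i, j) \<Rightarrow> x ^ i * y ^ j) has_sum (x ^ i * (1 / (1 - y)))) UNIV" for i
      using has_sum_cmult_right[OF geo[of y], of "x ^ i"] assms by simp
    show "(\<lambda>i. x ^ i * (1 / (1 - y))) summable_on UNIV"
      using has_sum_cmult_left[OF geo[of x]] assms by (blast intro: has_sum_imp_summable)
  qed (use assms in auto)
  then show ?thesis by simp
qed

lemma geometric_bound_nonneg: "geometric_bound a M t \<Longrightarrow> 0 \<le> M"
  by (metis geometric_bound_def norm_ge_zero order_trans mult_nonneg_nonneg
      less_eq_real_def zero_le_power)

lemma geometric_bound_le: "geometric_bound a M t \<Longrightarrow> norm (a i j) \<le> M / t ^ (i + j)"
  by (simp add: geometric_bound_def pos_le_divide_eq)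

lemma double_series_abs_summable:
  assumes "geometric_bound a M t" "norm z < t" "norm w < t"
  shows "(\<lambda>x. norm (case x of (i, j) \<Rightarrow> a i j * z ^ i * w ^ j)) summable_on UNIV"
proof (rule summable_on_comparison_test)
  have t: "t > 0" using assms(1) by (simp add: geometric_bound_def)
  show "(\<lambda>x. M * (case x of (i, j) \<Rightarrow> (norm z / t) ^ i * (norm w / t) ^ j)) summable_on UNIV"
    using assms t by (intro summable_on_cmult_right geometric_double_summable) auto
  show "norm (case x of (i, j) \<Rightarrow> a i j * z ^ i * w ^ j)
      \<le> M * (case x of (i, j) \<Rightarrow> (norm z / t) ^ i * (norm w / t) ^ j)" for x
  proof (cases x)
    case (Pair i j)
    have "norm (a i j) * (norm z ^ i * norm w ^ j) \<le> M / t ^ (i + j) * (norm z ^ i * norm w ^ j)"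
      by (intro mult_right_mono geometric_bound_le[OF assms(1)]) auto
    then show ?thesis using Pair t
      by (simp add: norm_mult norm_power power_divide power_add mult.assoc)
  qed
qed auto

lemma double_series_has_sum:
  assumes "geometric_bound a M t" "norm z < t" "norm w < t"
  shows "((\<lambda>(i, j). a i j * z ^ i * w ^ j) has_sum double_series a (z, w)) UNIV"
  using abs_summable_summable[OF double_series_abs_summable[OF assms]]
  by (simp add: double_series_def)

definition diff_fst :: "(nat \<Rightarrow> nat \<Rightarrow> complex) \<Rightarrow> nat \<Rightarrow> nat \<Rightarrow> complex" where
  "diff_fst a i j = of_nat (Suc i) * a (Suc i) j"

definition diff_snd :: "(nat \<Rightarrow> nat \<Rightarrow> complex) \<Rightarrow> nat \<Rightarrow> nat \<Rightarrow> complex" where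
  "diff_snd a i j = of_nat (Suc j) * a i (Suc j)"

text \<open>The coefficients after exchanging the two variables; facts about the second variable are
  transported from the first one through it.\<close>

definition swap_coeff :: "(nat \<Rightarrow> nat \<Rightarrow> complex) \<Rightarrow> nat \<Rightarrow> nat \<Rightarrow> complex" where
  "swap_coeff a i j = a j i"

text \<open>The new factor i + 1 is at most 2^i, hence at most 4^(i+j), and is absorbed by shrinking
  t to t / 4. The lost power of t turns M into M / t.\<close>

lemma geometric_bound_diff_fst:
  assumes "geometric_bound a M t"
  shows "geometric_bound (diff_fst a) (M / t) (t / 4)"
proof -
  have t: "t > 0" using assms by (simp add: geometric_bound_def)
  have M: "0 \<le> M" by (rule geometric_bound_nonneg[OF assms])
  have "norm (diff_fst a i j) * (t / 4) ^ (i + j) \<le> M / t" for i j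
  proof -
    have *: "norm (a (Suc i) j) * t ^ (i + j) \<le> M / t"
      using geometric_bound_le[OF assms, of "Suc i" j] t by (simp add: field_simps)
    have "Suc i \<le> 2 ^ i" by (rule Suc_leI) (rule less_exp)
    then have "real (Suc i) \<le> 2 ^ i" by (metis of_nat_le_iff of_nat_numeral of_nat_power)
    also have "\<dots> \<le> (4 ^ (i + j) :: real)"
      by (rule order_trans[of _ "4 ^ i"]) (auto intro: power_mono power_increasing)
    finally have "real (Suc i) / 4 ^ (i + j) \<le> 1" by simp
    then have "real (Suc i) / 4 ^ (i + j) * (norm (a (Suc i) j) * t ^ (i + j)) \<le> 1 * (M / t)"
      using * t M by (intro mult_mono) auto
    then show ?thesis
      by (simp add: diff_fst_def norm_mult power_divide field_simps del: of_nat_Suc)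
  qed
  then show ?thesis using t by (simp add: geometric_bound_def)
qed

lemma geometric_bound_swap: "geometric_bound (swap_coeff a) M t \<longleftrightarrow> geometric_bound a M t"
  unfolding geometric_bound_def swap_coeff_def by (metis add.commute)

lemma diff_snd_eq_swap: "diff_snd a = swap_coeff (diff_fst (swap_coeff a))"
  by (intro ext) (simp add: diff_snd_def diff_fst_def swap_coeff_def)

lemma geometric_bound_diff_snd:
  "geometric_bound a M t \<Longrightarrow> geometric_bound (diff_snd a) (M / t) (t / 4)"
  by (simp add: diff_snd_eq_swap geometric_bound_swap geometric_bound_diff_fst)

lemma double_series_swap: "double_series (swap_coeff a) (z, w) = double_series a (w, z)"
proof -
  have "double_series a (w, z) = (\<Sum>\<^sub>\<infinity>x. (\<lambda>(i, j). a i j * w ^ i * z ^ j) (prod.swap x))"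
    unfolding double_series_def
    by (subst infsum_reindex[of prod.swap UNIV, symmetric, unfolded o_def]) auto
  also have "\<dots> = double_series (swap_coeff a) (z, w)"
    unfolding double_series_def swap_coeff_def by (intro infsum_cong) (auto simp: mult_ac)
  finally show ?thesis by simp
qed

text \<open>The shift of the first index is injective and misses only the indices with first
  component 0, where the terms vanish. It matches a differentiated or divided series, whose
  coefficients are shifted, with the original indexing.\<close>

lemma has_sum_Suc_fst:
  fixes f :: "nat \<times> nat \<Rightarrow> complex"
  assumes "((\<lambda>(i, j). f (Suc i, j)) has_sum s) UNIV" "\<And>j. f (0, j) = 0"
  shows "(f has_sum s) UNIV"
proof -
  let ?h = "\<lambda>(i :: nat, j :: nat). (Suc i, j)"
  have inj: "inj ?h" by (auto intro: injI)
  have "(\<lambda>(i, j). f (Suc i, j)) = f \<circ> ?h" by auto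
  with assms(1) have "(f has_sum s) (?h ` UNIV)"
    by (subst has_sum_reindex[OF inj]) simp
  moreover have "f x = 0" if "x \<notin> ?h ` UNIV" for x
  proof -
    have "fst x = 0"
    proof (rule ccontr)
      assume "fst x \<noteq> 0"
      then have "x = ?h (fst x - 1, snd x)" by (cases x) auto
      with that show False by blast
    qed
    then show ?thesis using assms(2) by (cases x) auto
  qed
  ultimately show ?thesis
    using has_sum_cong_neutral[of "?h ` UNIV" UNIV f f] by blast
qed

text \<open>Here \<open>i - 1\<close> is truncated subtraction; at i = 0 the factor
  \<open>of_nat i\<close> makes the term vanish, so the convention is harmless.\<close>

lemma has_sum_diff_fst:
  assumes "geometric_bound a M t" "norm z < t / 4" "norm w < t / 4"
  shows "((\<lambda>(i, j). of_nat i * a i j * z ^ (i - 1) * w ^ j) has_sum double_series (diff_fst a) (z, w)) UNIV"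
proof (rule has_sum_Suc_fst)
  show "((\<lambda>(i, j). case (Suc i, j) of (i, j) \<Rightarrow> of_nat i * a i j * z ^ (i - 1) * w ^ j)
      has_sum double_series (diff_fst a) (z, w)) UNIV"
    using double_series_has_sum[OF geometric_bound_diff_fst[OF assms(1)] assms(2,3)]
    by (simp add: diff_fst_def)
qed auto

lemma has_sum_diff_snd:
  assumes "geometric_bound a M t" "norm z < t / 4" "norm w < t / 4"
  shows "((\<lambda>(i, j). of_nat j * a i j * z ^ i * w ^ (j - 1)) has_sum double_series (diff_snd a) (z, w)) UNIV"
proof -
  have "((\<lambda>(i, j). of_nat i * swap_coeff a i j * w ^ (i - 1) * z ^ j) has_sum double_series (diff_fst (swap_coeff a)) (w, z)) UNIV"
    using assms by (intro has_sum_diff_fst) (auto simp: geometric_bound_swap)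
  then have "((\<lambda>(i, j). of_nat i * swap_coeff a i j * w ^ (i - 1) * z ^ j) has_sum double_series (diff_fst (swap_coeff a)) (w, z)) (prod.swap ` UNIV)"
    by simp
  then have "((\<lambda>(i, j). of_nat i * swap_coeff a i j * w ^ (i - 1) * z ^ j) \<circ> prod.swap has_sum double_series (diff_fst (swap_coeff a)) (w, z)) UNIV"
    by (subst (asm) has_sum_reindex) auto
  then show ?thesis
    by (simp add: diff_snd_eq_swap double_series_swap o_def case_prod_unfold swap_coeff_def mult_ac)
qed

text \<open>The Weierstrass test and termwise differentiation work with sequences of partial sums,
  so the double series is enumerated by the pairing function.\<close>

lemma has_sum_prod_decode:
  fixes f :: "nat \<times> nat \<Rightarrow> 'a::banach"
  assumes "(f has_sum s) UNIV"
  shows "(\<lambda>n. f (prod_decode n)) sums s"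
proof -
  have "(f has_sum s) (prod_decode ` UNIV)" using assms by (simp add: surj_prod_decode)
  then have "(f \<circ> prod_decode has_sum s) UNIV"
    by (subst (asm) has_sum_reindex) (auto simp: inj_prod_decode)
  then show ?thesis using has_sum_imp_sums by (auto simp: o_def)
qed

lemma double_series_uniform:
  fixes g :: "nat \<times> nat \<Rightarrow> 'a \<Rightarrow> complex"
  assumes bound: "\<And>i j p. p \<in> S \<Longrightarrow> norm (g (i, j) p) \<le> C * ((1/2) ^ i * (1/2) ^ j)"
    and sum: "\<And>p. p \<in> S \<Longrightarrow> ((\<lambda>x. g x p) has_sum G p) UNIV"
  shows "uniform_limit S (\<lambda>n p. \<Sum>k<n. g (prod_decode k) p) G sequentially"
proof -
  let ?b = "\<lambda>x :: nat \<times> nat. C * (case x of (i, j) \<Rightarrow> (1/2) ^ i * (1/2) ^ j)"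
  have "?b summable_on UNIV"
    by (intro summable_on_cmult_right geometric_double_summable) auto
  then have summ: "summable (\<lambda>n. ?b (prod_decode n))"
    using has_sum_prod_decode[of ?b] by (auto simp: summable_on_def sums_iff)
  have "uniform_limit S (\<lambda>n p. \<Sum>k<n. g (prod_decode k) p)
      (\<lambda>p. \<Sum>k. g (prod_decode k) p) sequentially"
    by (rule Weierstrass_m_test[OF _ summ]) (metis (no_types, lifting) bound case_prod_beta prod.collapse)
  then show ?thesis
  proof (rule uniform_limit_cong'[THEN iffD1, rotated -1])
    show "(\<Sum>k. g (prod_decode k) p) = G p" if "p \<in> S" for p
      using has_sum_prod_decode[OF sum[OF that]] by (simp add: sums_iff)
  qed auto
qed

text \<open>For |z|, |w| < t / 4 the term is below i * M / t^(i+j) * (t/4)^(i-1+j). Estimating i by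
  2^i leaves (1/2)^i, and the missing power of z costs the factor 4 / t.\<close>

lemma diff_term_bound:
  assumes "geometric_bound a M t" "norm z < t / 4" "norm w < t / 4"
  shows "norm (of_nat i * a i j * z ^ (i - 1) * w ^ j) \<le> 4 * M / t * ((1/2) ^ i * (1/2) ^ j)"
proof (cases i)
  case 0
  then show ?thesis
    using assms(1) geometric_bound_nonneg[OF assms(1)] by (simp add: geometric_bound_def)
next
  case (Suc k)
  have t: "t > 0" using assms(1) by (simp add: geometric_bound_def)
  have M: "0 \<le> M" by (rule geometric_bound_nonneg[OF assms(1)])
  have "norm (of_nat i * a i j * z ^ (i - 1) * w ^ j)
      = real i * norm (a i j) * (norm z ^ k * norm w ^ j)"
    by (simp add: norm_mult norm_power Suc del: of_nat_Suc)
  also have "\<dots> \<le> 2 ^ i * (M / t ^ (i + j)) * ((t / 4) ^ k * (t / 4) ^ j)"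
    using assms t M of_nat_less_two_power[of i, where 'a = real]
    by (intro mult_mono power_mono geometric_bound_le[OF assms(1)]) auto
  also have "\<dots> = 4 * M / t * (2 ^ i * (1/4) ^ i * (1/4) ^ j)"
    using t by (simp add: Suc power_add field_simps)
  also have "\<dots> = 4 * M / t * ((1/2) ^ i * (1/4) ^ j)"
    by (simp add: power_mult_distrib[symmetric])
  also have "\<dots> \<le> 4 * M / t * ((1/2) ^ i * (1/2) ^ j)"
    using t M by (intro mult_left_mono power_mono) auto
  finally show ?thesis .
qed

text \<open>Termwise differentiation: both series of partial derivatives converge uniformly on the
  convex bidisc of radius t / 4, which bounds the operator norm of the error of the differentiated
  partial sums.\<close>

proposition double_series_has_derivative:
  assumes a: "geometric_bound a M t" and "norm (fst p) < t / 4" "norm (snd p) < t / 4"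
  shows "(double_series a has_derivative
    (\<lambda>h. double_series (diff_fst a) p * fst h + double_series (diff_snd a) p * snd h)) (at p)"
proof -
  have t: "t > 0" using a by (simp add: geometric_bound_def)
  have M: "0 \<le> M" by (rule geometric_bound_nonneg[OF a])
  define S where "S = ball (0::complex) (t / 4) \<times> ball (0::complex) (t / 4)"
  have S: "open S" "convex S" "p \<in> S"
    using assms by (auto simp: S_def open_Times convex_Times mem_Times_iff)
  have Sd: "norm (fst q) < t / 4" "norm (snd q) < t / 4" if "q \<in> S" for q
    using that by (auto simp: S_def)
  define f where "f = (\<lambda>x (q :: complex \<times> complex). case x of (i, j) \<Rightarrow> a i j * fst q ^ i * snd q ^ j)"
  define g1 where "g1 = (\<lambda>x (q :: complex \<times> complex). case x of (i, j) \<Rightarrow> of_nat i * a i j * fst q ^ (i - 1) * snd q ^ j)"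
  define g2 where "g2 = (\<lambda>x (q :: complex \<times> complex). case x of (i, j) \<Rightarrow> of_nat j * a i j * fst q ^ i * snd q ^ (j - 1))"
  have f_sum: "((\<lambda>x. f x q) has_sum double_series a q) UNIV" if "q \<in> S" for q
    using double_series_has_sum[OF a, of "fst q" "snd q"] Sd[OF that] t by (simp add: f_def)
  have u1: "uniform_limit S (\<lambda>n q. \<Sum>k<n. g1 (prod_decode k) q) (double_series (diff_fst a)) sequentially"
  proof (rule double_series_uniform)
    show "norm (g1 (i, j) q) \<le> 4 * M / t * ((1/2) ^ i * (1/2) ^ j)" if "q \<in> S" for i j q
      using diff_term_bound[OF a Sd[OF that]] by (simp add: g1_def)
    show "((\<lambda>x. g1 x q) has_sum double_series (diff_fst a) q) UNIV" if "q \<in> S" for q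
      using has_sum_diff_fst[OF a Sd[OF that]] by (simp add: g1_def)
  qed
  have u2: "uniform_limit S (\<lambda>n q. \<Sum>k<n. g2 (prod_decode k) q) (double_series (diff_snd a)) sequentially"
  proof (rule double_series_uniform)
    show "norm (g2 (i, j) q) \<le> 4 * M / t * ((1/2) ^ i * (1/2) ^ j)" if "q \<in> S" for i j q
      using diff_term_bound[of "swap_coeff a" M t, OF _ Sd(2,1)[OF that], of j i] a
      by (simp add: g2_def geometric_bound_swap swap_coeff_def mult_ac)
    show "((\<lambda>x. g2 x q) has_sum double_series (diff_snd a) q) UNIV" if "q \<in> S" for q
      using has_sum_diff_snd[OF a Sd[OF that]] by (simp add: g2_def)
  qed
  have "\<exists>g. \<forall>q\<in>S. (\<lambda>n. f (prod_decode n) q) sums (g q) \<and>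
      (g has_derivative (\<lambda>h. double_series (diff_fst a) q * fst h + double_series (diff_snd a) q * snd h)) (at q within S)"
  proof (rule has_derivative_series[OF S(2)])
    show "(f (prod_decode n) has_derivative
        (\<lambda>h. g1 (prod_decode n) q * fst h + g2 (prod_decode n) q * snd h)) (at q within S)" for n q
    proof (cases "prod_decode n")
      case (Pair i j)
      show ?thesis unfolding Pair f_def g1_def g2_def
        by (auto intro!: derivative_eq_intros simp: algebra_simps)
    qed
    show "\<forall>\<^sub>F n in sequentially. \<forall>q\<in>S. \<forall>h. norm ((\<Sum>i<n. g1 (prod_decode i) q * fst h + g2 (prod_decode i) q * snd h)
       - (double_series (diff_fst a) q * fst h + double_series (diff_snd a) q * snd h)) \<le> e * norm h"
      if "e > 0" for e
    proof -
      have e: "e / 2 > 0" using that by simp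
      show ?thesis using uniform_limitD[OF u1 e] uniform_limitD[OF u2 e]
      proof eventually_elim
        case (elim n)
        show ?case
        proof (intro ballI allI)
          fix q h assume q: "q \<in> S"
          let ?d1 = "(\<Sum>k<n. g1 (prod_decode k) q) - double_series (diff_fst a) q"
          let ?d2 = "(\<Sum>k<n. g2 (prod_decode k) q) - double_series (diff_snd a) q"
          have d1: "norm ?d1 \<le> e / 2" and d2: "norm ?d2 \<le> e / 2"
            using elim(1)[rule_format, OF q] elim(2)[rule_format, OF q] by (simp_all add: dist_norm)
          have "norm (?d1 * fst h + ?d2 * snd h) \<le> norm ?d1 * norm (fst h) + norm ?d2 * norm (snd h)"
            unfolding norm_mult[symmetric] by (rule norm_triangle_ineq)
          also have "\<dots> \<le> e / 2 * norm h + e / 2 * norm h"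
            using d1 d2 \<open>e / 2 > 0\<close> norm_fst_le[of "fst h" "snd h"] norm_snd_le[of "snd h" "fst h"]
            unfolding prod.collapse by (intro add_mono mult_mono) (simp_all only: norm_ge_zero less_imp_le)
          finally show "norm ((\<Sum>i<n. g1 (prod_decode i) q * fst h + g2 (prod_decode i) q * snd h)
             - (double_series (diff_fst a) q * fst h + double_series (diff_snd a) q * snd h)) \<le> e * norm h"
            unfolding sum.distrib sum_distrib_right[symmetric] by (simp add: algebra_simps)
        qed
      qed
    qed
    show "p \<in> S" by (rule S)
    show "(\<lambda>n. f (prod_decode n) p) sums double_series a p"
      by (rule has_sum_prod_decode[OF f_sum[OF S(3)]])
  qed
  then obtain g where g: "\<And>q. q \<in> S \<Longrightarrow> (\<lambda>n. f (prod_decode n) q) sums (g q)"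
    "(g has_derivative (\<lambda>h. double_series (diff_fst a) p * fst h + double_series (diff_snd a) p * snd h)) (at p within S)"
    using S(3) by blast
  \<comment> \<open>The differentiation theorem only provides some limit function \<open>g\<close>,
    differentiable within \<open>S\<close>; uniqueness of sums identifies it, and openness of
    \<open>S\<close> removes the restriction.\<close>
  have "g q = double_series a q" if "q \<in> S" for q
    using g(1)[OF that] has_sum_prod_decode[OF f_sum[OF that]] by (rule sums_unique2)
  then show ?thesis
    using has_derivative_transform_within_open[OF g(2)[unfolded at_within_open[OF S(3,1)]] S(1,3)] by blast
qed


text \<open>The derivative is a real Frechet derivative that happens to be complex linear, required
  on a whole neighbourhood. Nothing is demanded of \<open>u\<close> and \<open>v\<close> as
  functions of the point; their regularity comes out of the power series.\<close>

definition holomorphic2 :: "(complex \<times> complex \<Rightarrow> complex) \<Rightarrow> bool" where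
  "holomorphic2 F \<longleftrightarrow>
     (\<forall>\<^sub>F p in nhds 0. \<exists>u v. (F has_derivative (\<lambda>h. u * fst h + v * snd h)) (at p))"

text \<open>Subtracting the first i terms and dividing by h^i leaves \<open>b i w\<close> plus a
  tail, which is at most M / r^i * x / (1 - x) with x = h / r. The step h = r / (n + 2) keeps x at
  most 1/2, so the tail is at most 2 x M / r^i, uniformly in w.\<close>

lemma uniform_coefficient_limit:
  fixes b :: "nat \<Rightarrow> 'a \<Rightarrow> complex"
  assumes r: "r > 0" and M: "M \<ge> 0"
    and sums: "\<And>n w. w \<in> S \<Longrightarrow> (\<lambda>k. b k w * of_real (r / (real n + 2)) ^ k) sums F n w"
    and bound: "\<And>k w. w \<in> S \<Longrightarrow> norm (b k w) \<le> M / r ^ k"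
  shows "uniform_limit S (\<lambda>n w. (F n w - (\<Sum>k<i. b k w * of_real (r / (real n + 2)) ^ k))
      / of_real (r / (real n + 2)) ^ i) (b i) sequentially"
proof -
  have main: "norm ((F n w - (\<Sum>k<i. b k w * of_real (r / (real n + 2)) ^ k))
      / of_real (r / (real n + 2)) ^ i - b i w) \<le> M / r ^ i * (2 / (real n + 2))" if w: "w \<in> S" for n w
  proof -
    define x where "x = 1 / (real n + 2)"
    define h where "h = r / (real n + 2)"
    have x: "0 < x" "x \<le> 1/2" and h: "h > 0" "h = r * x" using r by (auto simp: x_def h_def field_simps)
    define G where "G = (F n w - (\<Sum>k<i. b k w * of_real h ^ k)) / of_real h ^ i"
    have "(\<lambda>k. b (k + i) w * of_real h ^ (k + i)) sums (F n w - (\<Sum>k<i. b k w * of_real h ^ k))"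
      using sums_split_initial_segment[OF sums[OF w, of n]] by (simp add: h_def)
    then have "(\<lambda>k. b (k + i) w * of_real h ^ (k + i) / of_real h ^ i) sums G"
      unfolding G_def by (rule sums_divide)
    then have "(\<lambda>k. b (k + i) w * of_real h ^ k) sums G"
      using h(1) by (simp add: power_add)
    then have tail: "(\<lambda>k. b (Suc k + i) w * of_real h ^ Suc k) sums (G - b i w)"
      using sums_split_initial_segment[of _ G 1] by force
    have geo: "(\<lambda>k. M / r ^ i * x * x ^ k) sums (M / r ^ i * x * (1 / (1 - x)))"
      using x by (intro sums_mult geometric_sums) auto
    have term_le: "norm (b (Suc k + i) w * of_real h ^ Suc k) \<le> M / r ^ i * x * x ^ k" for k
    proof -
      have "norm (b (Suc k + i) w * of_real h ^ Suc k) \<le> M / r ^ (Suc k + i) * h ^ Suc k"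
        using h(1) r M bound[OF w, of "Suc k + i"] unfolding norm_mult norm_power norm_of_real
        by (intro mult_mono) auto
      also have "\<dots> = M / r ^ i * x * x ^ k"
        using r by (simp add: h(2) power_add power_mult_distrib)
      finally show ?thesis .
    qed
    have "norm (G - b i w) \<le> M / r ^ i * x * (1 / (1 - x))"
      using norm_suminf_le[OF term_le] sums_unique[OF tail] sums_unique[OF geo] geo
      by (simp add: sums_iff)
    also have "\<dots> \<le> M / r ^ i * x * 2"
      using x r M by (intro mult_left_mono) (auto simp: field_simps)
    finally show ?thesis by (simp add: G_def h_def x_def)
  qed
  have lim: "(\<lambda>n. M / r ^ i * (2 / (real n + 2))) \<longlonglongrightarrow> 0"
    by (intro tendsto_mult_right_zero tendsto_divide_0[OF tendsto_const]
        filterlim_at_top_imp_at_infinity filterlim_tendsto_add_at_top[OF tendsto_const, of _ _ 2, simplified add.commute] filterlim_real_sequentially)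
  show ?thesis
  proof (rule uniform_limitI)
    fix e :: real assume "e > 0"
    then have "\<forall>\<^sub>F n in sequentially. M / r ^ i * (2 / (real n + 2)) < e"
      using order_tendstoD(2)[OF lim] by blast
    then show "\<forall>\<^sub>F n in sequentially. \<forall>w\<in>S. dist ((F n w - (\<Sum>k<i. b k w * of_real (r / (real n + 2)) ^ k))
      / of_real (r / (real n + 2)) ^ i) (b i w) < e"
      by eventually_elim (unfold dist_norm, blast intro: le_less_trans[OF main])
  qed
qed

text \<open>Osgood's lemma. The coefficients of \<open>z ^ i\<close> in the expansion in the first variable are uniform
  limits of functions that are holomorphic in the second variable.\<close>

lemma holomorphic2_imp_series:
  assumes "holomorphic2 F"
  obtains a M t where "geometric_bound a M t"
    "\<And>z w. norm z < t \<Longrightarrow> norm w < t \<Longrightarrow> F (z, w) = double_series a (z, w)"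
proof -
  obtain e where e: "e > 0" and diff: "\<And>p. dist p 0 < e \<Longrightarrow>
      \<exists>u v. (F has_derivative (\<lambda>h. u * fst h + v * snd h)) (at p)"
    using assms unfolding holomorphic2_def eventually_nhds_metric by blast
  \<comment> \<open>The norm of a pair is at most the sum of the norms, so a bidisc of radius e / 2
    lies in the ball of radius e.\<close>
  define R where "R = e / 2"
  define r where "r = R / 2"
  have R: "R > 0" "r > 0" "r < R" using e by (auto simp: R_def r_def)
  have D: "\<exists>u v. (F has_derivative (\<lambda>h. u * fst h + v * snd h)) (at (z, w))"
    if "norm z < R" "norm w < R" for z w
  proof (rule diff)
    show "dist (z, w) 0 < e" using norm_Pair_le[of z w] that by (simp add: R_def)
  qed
  have hol_fst: "(\<lambda>z. F (z, w)) holomorphic_on ball 0 R" if w: "norm w < R" for w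
  proof -
    have "\<exists>d. ((\<lambda>z. F (z, w)) has_field_derivative d) (at z)" if z: "z \<in> ball 0 R" for z
    proof -
      obtain u v where uv: "(F has_derivative (\<lambda>h. u * fst h + v * snd h)) (at (z, w))"
        using D[of z w] z w by auto
      have "((\<lambda>z. (z, w)) has_derivative (\<lambda>h. (h, 0))) (at z)"
        by (auto intro!: derivative_eq_intros)
      from has_derivative_compose[OF this uv] show ?thesis
        by (auto simp: has_field_derivative_def)
    qed
    then show ?thesis by (simp add: holomorphic_on_open)
  qed
  have hol_snd: "(\<lambda>w. F (z, w)) holomorphic_on ball 0 R" if z: "norm z < R" for z
  proof -
    have "\<exists>d. ((\<lambda>w. F (z, w)) has_field_derivative d) (at w)" if w: "w \<in> ball 0 R" for w
    proof -
      obtain u v where uv: "(F has_derivative (\<lambda>h. u * fst h + v * snd h)) (at (z, w))"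
        using D[of z w] z w by auto
      have "((\<lambda>w. (z, w)) has_derivative (\<lambda>h. (0, h))) (at w)"
        by (auto intro!: derivative_eq_intros)
      from has_derivative_compose[OF this uv] show ?thesis
        by (auto simp: has_field_derivative_def)
    qed
    then show ?thesis by (simp add: holomorphic_on_open)
  qed
  have "continuous_on (cball 0 r \<times> cball 0 r) F"
  proof (rule continuous_at_imp_continuous_on, rule ballI)
    fix p :: "complex \<times> complex" assume "p \<in> cball 0 r \<times> cball 0 r"
    then have "norm (fst p) < R" "norm (snd p) < R" using R by auto
    from D[OF this] show "isCont F p" using has_derivative_continuous by auto
  qed
  moreover have "compact (cball (0::complex) r \<times> cball (0::complex) r)"
    by (intro compact_Times compact_cball)
  ultimately have "bounded (F ` (cball 0 r \<times> cball 0 r))"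
    by (intro compact_imp_bounded compact_continuous_image)
  then obtain M where M: "\<And>p. p \<in> cball 0 r \<times> cball 0 r \<Longrightarrow> norm (F p) \<le> M"
    unfolding bounded_iff by auto
  have M0: "M \<ge> 0" using order_trans[OF norm_ge_zero M[of "(0, 0)"]] R by simp
  define b where "b i w = (deriv ^^ i) (\<lambda>z. F (z, w)) 0 / fact i" for i w
  have b_sums: "(\<lambda>i. b i w * z ^ i) sums F (z, w)" if "norm z < R" "norm w < R" for z w
    using holomorphic_power_series[OF hol_fst[OF that(2)], of z] that by (simp add: b_def)
  have b_bound: "norm (b i w) \<le> M / r ^ i" if w: "norm w \<le> r" for i w
  proof -
    have "norm ((deriv ^^ i) (\<lambda>z. F (z, w)) 0) \<le> fact i * M / r ^ i"
    proof (rule Cauchy_inequality)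
      have *: "(\<lambda>z. F (z, w)) holomorphic_on ball 0 R" using w R by (intro hol_fst) auto
      show "(\<lambda>z. F (z, w)) holomorphic_on ball 0 r"
        by (rule holomorphic_on_subset[OF *]) (use R in auto)
      show "continuous_on (cball 0 r) (\<lambda>z. F (z, w))"
        by (rule continuous_on_subset[OF holomorphic_on_imp_continuous_on[OF *]]) (use R in auto)
      show "norm (F (x, w)) \<le> M" if "norm (0 - x) = r" for x
        using that w by (intro M) auto
    qed (use R in auto)
    then have "norm ((deriv ^^ i) (\<lambda>z. F (z, w)) 0) / fact i \<le> fact i * M / r ^ i / fact i"
      by (rule divide_right_mono) auto
    then show ?thesis by (simp add: b_def norm_divide)
  qed
  \<comment> \<open>Strong induction: the quotient that tends to \<open>b i\<close> contains the
    earlier coefficients, which are already holomorphic in w.\<close>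
  have b_hol: "b i holomorphic_on ball 0 r" for i
  proof (induction i rule: less_induct)
    case (less i)
    let ?h = "\<lambda>n. r / (real n + 2)"
    let ?G = "\<lambda>n w. (F (of_real (?h n), w) - (\<Sum>k<i. b k w * of_real (?h n) ^ k)) / of_real (?h n) ^ i"
    have h: "0 < ?h n" "?h n < R" for n
      using R by (auto simp: field_simps) (smt (verit) mult_pos_pos of_nat_0_le_iff mult_nonneg_nonneg)
    have h': "norm (of_real (?h n) :: complex) < R" for n
      unfolding norm_of_real using h[of n] by simp
    have "uniform_limit (ball 0 r) ?G (b i) sequentially"
    proof (rule uniform_coefficient_limit[OF R(2) M0])
      show "(\<lambda>k. b k w * of_real (?h n) ^ k) sums F (of_real (?h n), w)" if "w \<in> ball 0 r" for n w
        using h' that R by (intro b_sums) auto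
      show "norm (b k w) \<le> M / r ^ k" if "w \<in> ball 0 r" for k w
        using that by (intro b_bound) auto
    qed
    moreover have "?G n holomorphic_on ball 0 r" for n
    proof -
      have "(\<lambda>w. F (of_real (?h n), w)) holomorphic_on ball 0 r"
        using h'[of n] R by (intro holomorphic_on_subset[OF hol_snd]) auto
      then show ?thesis using less R by (intro holomorphic_intros) auto
    qed
    ultimately show ?case
      using holomorphic_uniform_sequence[OF open_ball, of "?G" 0 r "b i"] uniform_limit_on_subset
      by (meson open_contains_cball open_ball)
  qed
  \<comment> \<open>A second shrinking: \<open>b i\<close> is known to be holomorphic on the open
    disc of radius r, and Cauchy's inequality needs continuity on a closed disc inside it.\<close>
  define t where "t = r / 2"
  have t: "t > 0" "t < r" using R by (auto simp: t_def)
  define a where "a i j = (deriv ^^ j) (b i) 0 / fact j" for i j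
  have a_sums: "(\<lambda>j. a i j * w ^ j) sums b i w" if "norm w < r" for i w
    using holomorphic_power_series[OF b_hol, of w] that by (simp add: a_def)
  have "norm (a i j) \<le> M / r ^ i / t ^ j" for i j
  proof -
    have "norm ((deriv ^^ j) (b i) 0) \<le> fact j * (M / r ^ i) / t ^ j"
    proof (rule Cauchy_inequality)
      show "b i holomorphic_on ball 0 t"
        by (rule holomorphic_on_subset[OF b_hol]) (use t in auto)
      show "continuous_on (cball 0 t) (b i)"
        by (rule continuous_on_subset[OF holomorphic_on_imp_continuous_on[OF b_hol]]) (use t in auto)
      show "norm (b i x) \<le> M / r ^ i" if "norm (0 - x) = t" for x
        using that t by (intro b_bound) auto
    qed (use t in auto)
    then have "norm ((deriv ^^ j) (b i) 0) / fact j \<le> fact j * (M / r ^ i) / t ^ j / fact j"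
      by (rule divide_right_mono) auto
    then show ?thesis by (simp add: a_def norm_divide)
  qed
  moreover have "M / r ^ i / t ^ j \<le> M / t ^ (i + j)" for i j
  proof -
    have "M / r ^ i \<le> M / t ^ i" using t R M0 by (intro divide_left_mono power_mono) auto
    then have "M / r ^ i / t ^ j \<le> M / t ^ i / t ^ j" using t by (intro divide_right_mono) auto
    then show ?thesis by (simp add: power_add)
  qed
  ultimately have "norm (a i j) \<le> M / t ^ (i + j)" for i j using order_trans by blast
  then have gb: "geometric_bound a M t"
    using t by (simp add: geometric_bound_def field_simps)
  \<comment> \<open>The absolutely convergent double sum is evaluated as an iterated one: the inner
    sums give \<open>b i w * z ^ i\<close>, the outer sum gives \<open>F\<close>.\<close>
  have "F (z, w) = double_series a (z, w)" if zw: "norm z < t" "norm w < t" for z w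
  proof -
    let ?f = "\<lambda>(i, j). a i j * z ^ i * w ^ j"
    have 1: "(?f has_sum double_series a (z, w)) (SIGMA i:UNIV. UNIV)"
      using double_series_has_sum[OF gb zw] by simp
    have 2: "((\<lambda>j. ?f (i, j)) has_sum b i w * z ^ i) UNIV" for i
    proof -
      have "(\<lambda>j. ?f (i, j)) summable_on UNIV"
        using summable_on_SigmaD1[of "\<lambda>i j. a i j * z ^ i * w ^ j" UNIV "\<lambda>_. UNIV" i] 1 has_sum_imp_summable by auto
      then have hs: "((\<lambda>j. ?f (i, j)) has_sum infsum (\<lambda>j. ?f (i, j)) UNIV) UNIV" by simp
      have "(\<lambda>j. a i j * w ^ j * z ^ i) sums (b i w * z ^ i)"
        using zw t by (intro sums_mult2 a_sums) auto
      then have "(\<lambda>j. ?f (i, j)) sums (b i w * z ^ i)" by (simp add: mult_ac)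
      then show ?thesis using hs sums_unique2[OF has_sum_imp_sums[OF hs]] by simp
    qed
    have "((\<lambda>i. b i w * z ^ i) has_sum double_series a (z, w)) UNIV"
      by (rule has_sum_SigmaD[OF 1 2])
    then have "(\<lambda>i. b i w * z ^ i) sums double_series a (z, w)" by (rule has_sum_imp_sums)
    moreover have "(\<lambda>i. b i w * z ^ i) sums F (z, w)" using zw t R by (intro b_sums) auto
    ultimately show ?thesis using sums_unique2 by metis
  qed
  with gb show thesis by (rule that)
qed


section \<open>Closure properties of holomorphic germs in two variables\<close>

lemma eventually_nhds_continuous:
  assumes "isCont g x" "\<forall>\<^sub>F y in nhds (g x). P y"
  shows "\<forall>\<^sub>F z in nhds x. P (g z)"
proof -
  have "(g \<longlongrightarrow> g x) (nhds x)" using assms(1) by (simp add: isCont_def tendsto_at_iff_tendsto_nhds)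
  then show ?thesis using assms(2) by (simp add: filterlim_iff)
qed

lemma has_derivative_eventually_eq:
  assumes "\<forall>\<^sub>F z in nhds x. f z = g z" "(f has_derivative D) (at x)"
  shows "(g has_derivative D) (at x)"
proof (rule has_derivative_transform_eventually[OF assms(2)])
  show "\<forall>\<^sub>F z in at x. f z = g z" using assms(1) by (simp add: eventually_nhds_conv_at)
  show "f x = g x" using assms(1) by (rule eventually_nhds_x_imp_x)
qed auto

lemma holomorphic2_isCont: "holomorphic2 F \<Longrightarrow> isCont F 0"
  unfolding holomorphic2_def
  by (drule eventually_nhds_x_imp_x) (auto dest: has_derivative_continuous)

lemma eventually_double_series:
  assumes "geometric_bound a M t"
  shows "\<forall>\<^sub>F p :: complex \<times> complex in nhds 0. norm (fst p) < t / 4 \<and> norm (snd p) < t / 4"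
proof -
  have "0 < t / 4" using assms by (simp add: geometric_bound_def)
  moreover have "norm (fst p) < t / 4 \<and> norm (snd p) < t / 4" if "dist p 0 < t / 4" for p :: "complex \<times> complex"
    using that norm_fst_le[of "fst p" "snd p"] norm_snd_le[of "snd p" "fst p"]
    unfolding prod.collapse by auto
  ultimately show ?thesis unfolding eventually_nhds_metric by blast
qed

lemma holomorphic2_double_series:
  assumes "geometric_bound a M t"
  shows "holomorphic2 (double_series a)"
  unfolding holomorphic2_def using eventually_double_series[OF assms]
  by eventually_elim (use double_series_has_derivative[OF assms] in blast)

text \<open>This is the payoff of Osgood's lemma: the partial derivatives are again sums of power
  series, hence holomorphic, which mere differentiability near 0 does not show.\<close>

lemma holomorphic2_derivative:
  assumes "holomorphic2 F"
  obtains u v where "holomorphic2 u" "holomorphic2 v"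
    "\<forall>\<^sub>F p in nhds 0. (F has_derivative (\<lambda>h. u p * fst h + v p * snd h)) (at p)"
proof -
  obtain a M t where a: "geometric_bound a M t"
    and eq: "\<And>z w. norm z < t \<Longrightarrow> norm w < t \<Longrightarrow> F (z, w) = double_series a (z, w)"
    using holomorphic2_imp_series[OF assms] by blast
  have t: "t > 0" using a by (simp add: geometric_bound_def)
  have ev: "\<forall>\<^sub>F p in nhds 0. double_series a p = F p"
    using eventually_double_series[OF a]
    by eventually_elim (use eq t in \<open>auto simp flip: prod.collapse\<close>)
  show thesis
  proof
    show "holomorphic2 (double_series (diff_fst a))" "holomorphic2 (double_series (diff_snd a))"
      using a geometric_bound_diff_fst geometric_bound_diff_snd holomorphic2_double_series by blast+
    show "\<forall>\<^sub>F p in nhds 0. (F has_derivative (\<lambda>h. double_series (diff_fst a) p * fst h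
        + double_series (diff_snd a) p * snd h)) (at p)"
      using eventually_eventually[THEN iffD2, OF ev] eventually_double_series[OF a]
      by eventually_elim (use double_series_has_derivative[OF a] has_derivative_eventually_eq in blast)
  qed
qed

lemma holomorphic2_const: "holomorphic2 (\<lambda>p. c)"
  unfolding holomorphic2_def
  by (intro always_eventually allI exI[of _ 0]) (auto intro!: derivative_eq_intros)

lemma holomorphic2_fst: "holomorphic2 fst"
  unfolding holomorphic2_def
  by (intro always_eventually allI exI[of _ 1] exI[of _ 0]) (auto intro!: derivative_eq_intros)

lemma holomorphic2_snd: "holomorphic2 snd"
  unfolding holomorphic2_def
  by (intro always_eventually allI exI[of _ 0] exI[of _ 1]) (auto intro!: derivative_eq_intros)

lemma holomorphic2_compose:
  assumes "holomorphic2 F" "holomorphic2 G" "holomorphic2 K" "G 0 = 0" "K 0 = 0"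
  shows "holomorphic2 (\<lambda>p. F (G p, K p))"
proof -
  have "isCont (\<lambda>p. (G p, K p)) 0"
    by (intro isCont_Pair holomorphic2_isCont assms)
  moreover have "\<forall>\<^sub>F p in nhds (G 0, K 0). \<exists>u v. (F has_derivative (\<lambda>h. u * fst h + v * snd h)) (at p)"
    using assms unfolding holomorphic2_def zero_prod_def by simp
  ultimately have "\<forall>\<^sub>F p in nhds 0. \<exists>u v. (F has_derivative (\<lambda>h. u * fst h + v * snd h)) (at (G p, K p))"
    by (rule eventually_nhds_continuous)
  then show ?thesis using assms(2,3) unfolding holomorphic2_def
  proof eventually_elim
    case (elim p)
    then obtain u v u1 v1 u2 v2 where
      F: "(F has_derivative (\<lambda>h. u * fst h + v * snd h)) (at (G p, K p))" and
      G: "(G has_derivative (\<lambda>h. u1 * fst h + v1 * snd h)) (at p)" and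
      K: "(K has_derivative (\<lambda>h. u2 * fst h + v2 * snd h)) (at p)" by blast
    have "((\<lambda>p. F (G p, K p)) has_derivative
        (\<lambda>h. (u * u1 + v * u2) * fst h + (u * v1 + v * v2) * snd h)) (at p)"
      using has_derivative_compose[OF has_derivative_Pair[OF G K] F] by (simp add: algebra_simps)
    then show ?case by blast
  qed
qed

lemma holomorphic2_add:
  assumes "holomorphic2 F" "holomorphic2 G" shows "holomorphic2 (\<lambda>p. F p + G p)"
  using assms unfolding holomorphic2_def
proof eventually_elim
  case (elim p)
  then obtain u v u1 v1 where
    F: "(F has_derivative (\<lambda>h. u * fst h + v * snd h)) (at p)" and
    G: "(G has_derivative (\<lambda>h. u1 * fst h + v1 * snd h)) (at p)" by blast
  have "((\<lambda>p. F p + G p) has_derivative (\<lambda>h. (u + u1) * fst h + (v + v1) * snd h)) (at p)"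
    using has_derivative_add[OF F G] by (simp add: algebra_simps)
  then show ?case by blast
qed

lemma holomorphic2_mult:
  assumes "holomorphic2 F" "holomorphic2 G" shows "holomorphic2 (\<lambda>p. F p * G p)"
  using assms unfolding holomorphic2_def
proof eventually_elim
  case (elim p)
  then obtain u v u1 v1 where
    F: "(F has_derivative (\<lambda>h. u * fst h + v * snd h)) (at p)" and
    G: "(G has_derivative (\<lambda>h. u1 * fst h + v1 * snd h)) (at p)" by blast
  have "((\<lambda>p. F p * G p) has_derivative
      (\<lambda>h. (F p * u1 + u * G p) * fst h + (F p * v1 + v * G p) * snd h)) (at p)"
    using has_derivative_mult[OF F G] by (simp add: algebra_simps)
  then show ?case by blast
qed

lemma holomorphic2_compose_analytic:
  assumes "holomorphic2 F" "h analytic_on {F 0}" shows "holomorphic2 (\<lambda>p. h (F p))"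
proof -
  obtain e where "e > 0" "h holomorphic_on ball (F 0) e"
    using assms(2) by (auto simp: analytic_at_ball)
  then have "\<forall>\<^sub>F y in nhds (F 0). \<exists>d. (h has_field_derivative d) (at y)"
    by (auto simp: holomorphic_on_open eventually_nhds_metric dist_commute)
  then have "\<forall>\<^sub>F p in nhds 0. \<exists>d. (h has_field_derivative d) (at (F p))"
    by (rule eventually_nhds_continuous[OF holomorphic2_isCont[OF assms(1)]])
  then show ?thesis using assms(1) unfolding holomorphic2_def
  proof eventually_elim
    case (elim p)
    then obtain u v d where
      F: "(F has_derivative (\<lambda>h. u * fst h + v * snd h)) (at p)" and
      h: "(h has_derivative (*) d) (at (F p))" by (auto simp: has_field_derivative_def)
    have "((\<lambda>p. h (F p)) has_derivative (\<lambda>h. (d * u) * fst h + (d * v) * snd h)) (at p)"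
      using has_derivative_compose[OF F h] by (simp add: algebra_simps)
    then show ?case by blast
  qed
qed

text \<open>The antiholomorphic involution of C^2 whose fixed points are exactly the points
  \<open>(z, cnj z)\<close>. If \<open>F\<close> extends \<open>f\<close>, then
  \<open>cnj (F (conj_swap p))\<close> is the holomorphic extension of
  \<open>cnj (f z)\<close>.\<close>

definition conj_swap :: "complex \<times> complex \<Rightarrow> complex \<times> complex" where
  "conj_swap p = (cnj (snd p), cnj (fst p))"

lemma has_derivative_conj_swap: "(conj_swap has_derivative conj_swap) (at p)"
  unfolding conj_swap_def
  by (auto intro!: derivative_eq_intros bounded_linear.has_derivative[OF bounded_linear_cnj])

lemma isCont_conj_swap: "isCont conj_swap p"
  using has_derivative_continuous[OF has_derivative_conj_swap] .

lemma conj_swap_0 [simp]: "conj_swap 0 = 0"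
  by (simp add: conj_swap_def zero_prod_def)

lemma conj_swap_conj_swap [simp]: "conj_swap (conj_swap p) = p"
  by (simp add: conj_swap_def)

lemma holomorphic2_conj_swap:
  assumes "holomorphic2 F" shows "holomorphic2 (\<lambda>p. cnj (F (conj_swap p)))"
proof -
  have "\<forall>\<^sub>F p in nhds 0. \<exists>u v. (F has_derivative (\<lambda>h. u * fst h + v * snd h)) (at (conj_swap p))"
    using assms unfolding holomorphic2_def
    by (intro eventually_nhds_continuous[OF isCont_conj_swap]) simp
  then show ?thesis unfolding holomorphic2_def
  proof eventually_elim
    case (elim p)
    then obtain u v where F: "(F has_derivative (\<lambda>h. u * fst h + v * snd h)) (at (conj_swap p))" by blast
    have "((\<lambda>p. cnj (F (conj_swap p))) has_derivative (\<lambda>h. cnj v * fst h + cnj u * snd h)) (at p)"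
      using bounded_linear.has_derivative[OF bounded_linear_cnj has_derivative_compose[OF has_derivative_conj_swap F]]
      by (simp add: conj_swap_def algebra_simps)
    then show ?case by blast
  qed
qed

section \<open>Real-analytic germs\<close>

definition ranalytic :: "(complex \<Rightarrow> complex) \<Rightarrow> bool" where
  "ranalytic f \<longleftrightarrow> (\<exists>F. holomorphic2 F \<and> (\<forall>\<^sub>F z in nhds 0. f z = F (z, cnj z)))"

lemma ranalyticI: "holomorphic2 F \<Longrightarrow> \<forall>\<^sub>F z in nhds 0. f z = F (z, cnj z) \<Longrightarrow> ranalytic f"
  by (auto simp: ranalytic_def)

lemma ranalyticE:
  assumes "ranalytic f"
  obtains F where "holomorphic2 F" "\<forall>\<^sub>F z in nhds 0. f z = F (z, cnj z)" "f 0 = F 0"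
  using assms eventually_nhds_x_imp_x[of _ "0::complex"] unfolding ranalytic_def zero_prod_def by fastforce

lemma ranalytic_cong:
  assumes "\<forall>\<^sub>F z in nhds 0. f z = g z" "ranalytic f" shows "ranalytic g"
proof -
  obtain F where F: "holomorphic2 F" "\<forall>\<^sub>F z in nhds 0. f z = F (z, cnj z)" "f 0 = F 0"
    by (rule ranalyticE[OF assms(2)])
  have "\<forall>\<^sub>F z in nhds 0. g z = F (z, cnj z)" using assms(1) F(2) by eventually_elim simp
  with F(1) show ?thesis by (rule ranalyticI)
qed

lemma has_derivative_real_plane: "((\<lambda>z. (z, cnj z)) has_derivative (\<lambda>h. (h, cnj h))) (at z)"
  by (auto intro!: derivative_eq_intros bounded_linear.has_derivative[OF bounded_linear_cnj])

lemma eventually_real_plane: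
  assumes "\<forall>\<^sub>F p in nhds 0. P p" shows "\<forall>\<^sub>F z in nhds 0. P (z, cnj z)"
  by (rule eventually_nhds_continuous[OF has_derivative_continuous[OF has_derivative_real_plane]])
    (use assms in \<open>simp add: zero_prod_def\<close>)

text \<open>\<open>u\<close> and \<open>v\<close> are the Wirtinger derivatives of \<open>f\<close>,
  obtained by restricting the two partial derivatives of the holomorphic extension.\<close>

lemma ranalytic_derivative:
  assumes "ranalytic f"
  obtains u v where "ranalytic u" "ranalytic v"
    "\<forall>\<^sub>F z in nhds 0. (f has_derivative (\<lambda>h. u z * h + v z * cnj h)) (at z)"
proof -
  obtain F where F: "holomorphic2 F" "\<forall>\<^sub>F z in nhds 0. f z = F (z, cnj z)"
    by (rule ranalyticE[OF assms])
  obtain u v where uv: "holomorphic2 u" "holomorphic2 v"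
    "\<forall>\<^sub>F p in nhds 0. (F has_derivative (\<lambda>h. u p * fst h + v p * snd h)) (at p)"
    by (rule holomorphic2_derivative[OF F(1)])
  have F2: "\<forall>\<^sub>F z in nhds 0. F (z, cnj z) = f z" using F(2) by eventually_elim simp
  show thesis
  proof
    show "ranalytic (\<lambda>z. u (z, cnj z))" "ranalytic (\<lambda>z. v (z, cnj z))"
      using uv by (auto intro: ranalyticI)
    show "\<forall>\<^sub>F z in nhds 0. (f has_derivative (\<lambda>h. u (z, cnj z) * h + v (z, cnj z) * cnj h)) (at z)"
      using eventually_eventually[THEN iffD2, OF F2] eventually_real_plane[OF uv(3)]
    proof eventually_elim
      case (elim z)
      show ?case
        by (rule has_derivative_eventually_eq[OF elim(1)])
          (use has_derivative_compose[OF has_derivative_real_plane elim(2)] in simp)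
    qed
  qed
qed

lemma ranalytic_eventually_isCont: "ranalytic f \<Longrightarrow> \<forall>\<^sub>F z in nhds 0. isCont f z"
  by (erule ranalytic_derivative) (auto elim!: eventually_mono dest: has_derivative_continuous)

lemma ranalytic_isCont: "ranalytic f \<Longrightarrow> isCont f 0"
  using ranalytic_eventually_isCont eventually_nhds_x_imp_x by blast

lemma ranalytic_const [intro]: "ranalytic (\<lambda>z. c)"
  by (rule ranalyticI[OF holomorphic2_const[of c]]) simp

lemma ranalytic_ident [intro]: "ranalytic (\<lambda>z. z)"
  using holomorphic2_fst by (auto intro: ranalyticI)

lemma ranalytic_add [intro]: "ranalytic f \<Longrightarrow> ranalytic g \<Longrightarrow> ranalytic (\<lambda>z. f z + g z)"
  by (elim ranalyticE, rule ranalyticI[OF holomorphic2_add], assumption+) (auto elim: eventually_elim2)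

lemma ranalytic_mult [intro]: "ranalytic f \<Longrightarrow> ranalytic g \<Longrightarrow> ranalytic (\<lambda>z. f z * g z)"
  by (elim ranalyticE, rule ranalyticI[OF holomorphic2_mult], assumption+) (auto elim: eventually_elim2)

lemma ranalytic_compose_analytic:
  "ranalytic f \<Longrightarrow> h analytic_on {f 0} \<Longrightarrow> ranalytic (\<lambda>z. h (f z))"
  by (elim ranalyticE, rule ranalyticI[OF holomorphic2_compose_analytic]) (auto elim: eventually_mono)

lemma ranalytic_cnj [intro]: "ranalytic f \<Longrightarrow> ranalytic (\<lambda>z. cnj (f z))"
  by (elim ranalyticE, rule ranalyticI[OF holomorphic2_conj_swap])
    (auto elim: eventually_mono simp: conj_swap_def)

lemma ranalytic_uminus [intro]: "ranalytic f \<Longrightarrow> ranalytic (\<lambda>z. - f z)"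
  using ranalytic_mult[OF ranalytic_const[of "-1"], of f] by simp

lemma ranalytic_diff [intro]: "ranalytic f \<Longrightarrow> ranalytic g \<Longrightarrow> ranalytic (\<lambda>z. f z - g z)"
  using ranalytic_add[OF _ ranalytic_uminus, of f g] by simp

lemma ranalytic_divide [intro]:
  assumes "ranalytic f" "ranalytic g" "g 0 \<noteq> 0" shows "ranalytic (\<lambda>z. f z / g z)"
  unfolding divide_inverse
  by (intro ranalytic_mult assms(1) ranalytic_compose_analytic[OF assms(2)])
    (use assms(3) in \<open>auto intro!: analytic_intros\<close>)

lemma ranalytic_Re [intro]: "ranalytic f \<Longrightarrow> ranalytic (\<lambda>z. of_real (Re (f z)))"
  using ranalytic_divide[OF ranalytic_add[OF _ ranalytic_cnj] ranalytic_const[of 2], of f f]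
  by (simp add: complex_add_cnj)

text \<open>The conjugate of \<open>g\<close> must be extended too, so the extension of the
  composite is \<open>F (G p, cnj (G (conj_swap p)))\<close>.\<close>

lemma ranalytic_compose:
  assumes "ranalytic f" "ranalytic g" "g 0 = 0"
  shows "ranalytic (\<lambda>z. f (g z))"
proof -
  obtain F where F: "holomorphic2 F" "\<forall>\<^sub>F z in nhds 0. f z = F (z, cnj z)"
    by (rule ranalyticE[OF assms(1)])
  obtain G where G: "holomorphic2 G" "\<forall>\<^sub>F z in nhds 0. g z = G (z, cnj z)" "g 0 = G 0"
    by (rule ranalyticE[OF assms(2)])
  have "\<forall>\<^sub>F z in nhds 0. f (g z) = F (g z, cnj (g z))"
    by (rule eventually_nhds_continuous[OF ranalytic_isCont[OF assms(2)]]) (use assms(3) F in simp)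
  then have "\<forall>\<^sub>F z in nhds 0. f (g z) = F (G (z, cnj z), cnj (G (conj_swap (z, cnj z))))"
    using G(2) by eventually_elim (simp add: conj_swap_def)
  moreover have "holomorphic2 (\<lambda>p. F (G p, cnj (G (conj_swap p))))"
    using F G assms(3) by (intro holomorphic2_compose holomorphic2_conj_swap) auto
  ultimately show ?thesis by (intro ranalyticI) auto
qed


section \<open>The analytic inverse function theorem\<close>

lemma holomorphic2_eventually_isCont: "holomorphic2 F \<Longrightarrow> \<forall>\<^sub>F p in nhds 0. isCont F p"
  unfolding holomorphic2_def by (auto elim!: eventually_mono dest: has_derivative_continuous)

text \<open>The extension \<open>T\<close> of \<open>f\<close> to C^2 is inverted by the real
  inverse function theorem. The derivative of the inverse is complex linear, because it inverts a
  complex linear map, so the inverse is holomorphic; it preserves the real plane because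
  \<open>T\<close> commutes with \<open>conj_swap\<close> and is injective. The scalar derivative at
  0 makes the inverse of \<open>D 0\<close> explicit.\<close>

lemma ranalytic_inverse:
  fixes c :: real
  assumes f: "ranalytic f" and f0: "f 0 = 0" and df: "(f has_derivative (\<lambda>h. of_real c * h)) (at 0)" and c: "c \<noteq> 0"
  obtains g where "ranalytic g" "g 0 = 0" "\<forall>\<^sub>F z in nhds 0. f (g z) = z" "\<forall>\<^sub>F z in nhds 0. g (f z) = z"
proof -
  obtain F where F: "holomorphic2 F" "\<forall>\<^sub>F z in nhds 0. f z = F (z, cnj z)" "f 0 = F 0"
    by (rule ranalyticE[OF f])
  obtain u v where u: "holomorphic2 u" and v: "holomorphic2 v"
    and dF: "\<forall>\<^sub>F p in nhds 0. (F has_derivative (\<lambda>h. u p * fst h + v p * snd h)) (at p)"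
    by (rule holomorphic2_derivative[OF F(1)])
  have uv0: "u 0 = of_real c" "v 0 = 0"
  proof -
    have F': "\<forall>\<^sub>F z in nhds 0. F (z, cnj z) = f z" using F(2) by eventually_elim simp
    have "(F has_derivative (\<lambda>h. u 0 * fst h + v 0 * snd h)) (at (0, cnj 0))"
      using eventually_nhds_x_imp_x[OF dF] by (simp add: zero_prod_def)
    from has_derivative_compose[OF has_derivative_real_plane this]
    have "((\<lambda>z. F (z, cnj z)) has_derivative (\<lambda>h. u 0 * h + v 0 * cnj h)) (at 0)" by simp
    from has_derivative_unique[OF has_derivative_eventually_eq[OF F' this] df]
    have "u 0 * h + v 0 * cnj h = of_real c * h" for h by metis
    from this[of 1] this[of "\<i>"] show "u 0 = of_real c" "v 0 = 0"
      by (simp_all add: complex_eq_iff)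
  qed
  define T where "T p = (F p, cnj (F (conj_swap p)))" for p
  define D where "D p h = (u p * fst h + v p * snd h,
    cnj (v (conj_swap p)) * fst h + cnj (u (conj_swap p)) * snd h)" for p and h :: "complex \<times> complex"
  \<comment> \<open>The complex Jacobian determinant of \<open>T\<close>; at 0 it equals
    c^2.\<close>
  define \<Delta> where "\<Delta> p = u p * cnj (u (conj_swap p)) - v p * cnj (v (conj_swap p))" for p
  have swap_ev: "\<forall>\<^sub>F p in nhds 0. P (conj_swap p)" if "\<forall>\<^sub>F p in nhds 0. P p" for P
    by (rule eventually_nhds_continuous[OF isCont_conj_swap]) (use that in simp)
  have bl: "bounded_linear (D p)" for p unfolding D_def
    by (intro bounded_linear_Pair bounded_linear_add bounded_linear_mult_right[THEN bounded_linear_compose]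
        bounded_linear_fst bounded_linear_snd)
  have "\<forall>\<^sub>F p in nhds 0. (T has_derivative D p) (at p)"
    using dF swap_ev[OF dF]
  proof eventually_elim
    case (elim p)
    have "((\<lambda>p. cnj (F (conj_swap p))) has_derivative
      (\<lambda>h. cnj (v (conj_swap p)) * fst h + cnj (u (conj_swap p)) * snd h)) (at p)"
      using bounded_linear.has_derivative[OF bounded_linear_cnj has_derivative_compose[OF has_derivative_conj_swap elim(2)]]
      by (simp add: conj_swap_def algebra_simps)
    from has_derivative_Pair[OF elim(1) this] show ?case by (simp add: T_def[abs_def] D_def[abs_def])
  qed
  moreover have "isCont \<Delta> 0"
    unfolding \<Delta>_def using holomorphic2_isCont[OF u] holomorphic2_isCont[OF v] isCont_conj_swap
    by (intro continuous_intros isCont_o2[OF isCont_conj_swap]) auto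
  then have "\<forall>\<^sub>F p in nhds 0. \<Delta> p \<noteq> 0"
    by (rule eventually_nhds_continuous, intro t1_space_nhds) (use c in \<open>simp add: \<Delta>_def uv0\<close>)
  moreover note holomorphic2_eventually_isCont[OF u] holomorphic2_eventually_isCont[OF v]
    swap_ev[OF holomorphic2_eventually_isCont[OF u]] swap_ev[OF holomorphic2_eventually_isCont[OF v]]
  ultimately have "\<forall>\<^sub>F p in nhds 0. (T has_derivative D p) (at p) \<and> \<Delta> p \<noteq> 0 \<and> isCont u p \<and> isCont v p
     \<and> isCont u (conj_swap p) \<and> isCont v (conj_swap p)"
    by eventually_elim simp
  then obtain U where U: "open U" "0 \<in> U" and TU: "\<And>p. p \<in> U \<Longrightarrow> (T has_derivative D p) (at p)"
    "\<And>p. p \<in> U \<Longrightarrow> \<Delta> p \<noteq> 0" and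
    contU: "\<And>p. p \<in> U \<Longrightarrow> isCont u p \<and> isCont v p \<and> isCont u (conj_swap p) \<and> isCont v (conj_swap p)"
    unfolding eventually_nhds by blast
  have T0: "T 0 = 0" using f0 F(3) by (simp add: T_def zero_prod_def[symmetric])
  obtain U' V g g' where g: "open U'" "U' \<subseteq> U" "0 \<in> U'" "open V" "T 0 \<in> V" "homeomorphism U' V T g"
    "\<And>y. y \<in> V \<Longrightarrow> (g has_derivative (g' y)) (at y)"
    "\<And>y. y \<in> V \<Longrightarrow> g' y = inv (D (g y))" "\<And>y. y \<in> V \<Longrightarrow> bij (D (g y))"
  proof (rule inverse_function_theorem[OF U(1), where f = T and f' = "\<lambda>p. Blinfun (D p)"
      and ?x0.0 = 0 and invf = "Blinfun (\<lambda>h. (1 / c) *\<^sub>R h)"])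
    show "(T has_derivative blinfun_apply (Blinfun (D p))) (at p)" if "p \<in> U" for p
      using TU(1)[OF that] by (simp add: bounded_linear_Blinfun_apply[OF bl])
    show "continuous_on U (\<lambda>p. Blinfun (D p))"
    proof (rule continuous_on_blinfun_componentwise)
      fix h :: "complex \<times> complex"
      show "continuous_on U (\<lambda>p. blinfun_apply (Blinfun (D p)) h)"
        unfolding bounded_linear_Blinfun_apply[OF bl] D_def
        using contU by (intro continuous_at_imp_continuous_on ballI)
          (intro continuous_intros isCont_o2[OF isCont_conj_swap]; blast)
    qed
    show "0 \<in> U" by (rule U)
    show "Blinfun (\<lambda>h. (1 / c) *\<^sub>R h) o\<^sub>L Blinfun (D 0) = id_blinfun"
    proof (rule blinfun_eqI)
      fix h :: "complex \<times> complex"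
      have "(1 / c) *\<^sub>R D 0 h = h"
        using c by (simp add: D_def uv0 prod_eq_iff scaleR_conv_of_real)
      then show "blinfun_apply (Blinfun (\<lambda>h. (1 / c) *\<^sub>R h) o\<^sub>L Blinfun (D 0)) h = blinfun_apply id_blinfun h"
        by (simp add: bounded_linear_Blinfun_apply[OF bl] bounded_linear_Blinfun_apply[OF bounded_linear_scaleR_right])
    qed
  qed (auto simp: bounded_linear_Blinfun_apply[OF bl])
  have V0: "0 \<in> V" using g(5) T0 by simp
  have gT: "g (T p) = p" if "p \<in> U'" for p using g(6) that by (simp add: homeomorphism_def)
  have Tg: "T (g q) = q" "g q \<in> U'" if "q \<in> V" for q using g(6) that by (auto simp: homeomorphism_def)
  have g0: "g 0 = 0" using gT[OF g(3)] T0 by simp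
  have evV: "\<forall>\<^sub>F q in nhds 0. q \<in> V" and evU: "\<forall>\<^sub>F p in nhds 0. p \<in> U'"
    using g V0 by (auto intro: eventually_nhds_in_open)
  have hol: "holomorphic2 (\<lambda>q. fst (g q))"
    unfolding holomorphic2_def using evV
  proof eventually_elim
    case (elim q)
    let ?p = "g q"
    \<comment> \<open>Cramer's rule for the 2x2 system \<open>D (g q) (g' q h) = h\<close>; it
      exhibits the derivative of the inverse in complex linear form.\<close>
    have eq: "fst (g' q h) = cnj (u (conj_swap ?p)) / \<Delta> ?p * fst h + (- v ?p / \<Delta> ?p) * snd h" for h
    proof -
      have "D ?p (g' q h) = h" using g(8,9)[OF elim] by (simp add: bij_is_surj surj_f_inv_f)
      then have e: "u ?p * fst (g' q h) + v ?p * snd (g' q h) = fst h"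
        "cnj (v (conj_swap ?p)) * fst (g' q h) + cnj (u (conj_swap ?p)) * snd (g' q h) = snd h"
        by (auto simp: D_def prod_eq_iff)
      then have "\<Delta> ?p * fst (g' q h) = cnj (u (conj_swap ?p)) * fst h - v ?p * snd h"
        unfolding \<Delta>_def e[symmetric] by (simp add: algebra_simps)
      moreover have "\<Delta> ?p \<noteq> 0" using TU(2) Tg(2)[OF elim] g(2) by blast
      ultimately show ?thesis by (simp add: field_simps)
    qed
    have "((\<lambda>q. fst (g q)) has_derivative (\<lambda>h. fst (g' q h))) (at q)"
      by (rule has_derivative_fst[OF g(7)[OF elim]])
    then show ?case unfolding eq by blast
  qed
  define G where "G z = fst (g (z, cnj z))" for z
  have G: "ranalytic G" unfolding G_def using hol by (auto intro: ranalyticI)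
  have G0: "G 0 = 0" using g0 by (simp add: G_def zero_prod_def)
  have contg: "isCont g 0" using g(7)[OF V0] by (rule has_derivative_continuous)
  have "\<forall>\<^sub>F q in nhds 0. conj_swap (g q) \<in> U'"
    by (rule eventually_nhds_continuous[OF contg]) (use swap_ev[OF evU] g0 in simp)
  from eventually_real_plane[OF this] eventually_real_plane[OF evV]
  have GT: "\<forall>\<^sub>F z in nhds 0. g (z, cnj z) = (G z, cnj (G z)) \<and> F (G z, cnj (G z)) = z"
  proof eventually_elim
    case (elim z)
    let ?q = "(z, cnj z)"
    have Tq: "F (g ?q) = z" "cnj (F (conj_swap (g ?q))) = cnj z"
      using Tg(1)[OF elim(2)] by (auto simp: T_def)
    \<comment> \<open>Both \<open>g ?q\<close> and its image under \<open>conj_swap\<close> are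
      mapped to \<open>?q\<close>. They lie in \<open>U'\<close>, where \<open>T\<close> is
      injective, so they agree and \<open>g ?q\<close> is a point of the real plane.\<close>
    have "T (conj_swap (g ?q)) = ?q" using Tq by (simp add: T_def)
    then have "g ?q = conj_swap (g ?q)" using gT[OF elim(1)] by simp
    then have "snd (g ?q) = cnj (fst (g ?q))"
      by (metis conj_swap_def snd_conv)
    then have "g ?q = (G z, cnj (G z))" by (simp add: G_def prod_eq_iff)
    then show ?case using Tq by simp
  qed
  show thesis
  proof
    show "ranalytic G" "G 0 = 0" by fact+
    have "\<forall>\<^sub>F z in nhds 0. f (G z) = F (G z, cnj (G z))"
      by (rule eventually_nhds_continuous[OF ranalytic_isCont[OF G]]) (use F(2) G0 in simp)
    then show "\<forall>\<^sub>F z in nhds 0. f (G z) = z" using GT by eventually_elim simp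
    show "\<forall>\<^sub>F z in nhds 0. G (f z) = z"
      using F(2) eventually_real_plane[OF evU]
    proof eventually_elim
      case (elim z)
      have "T (z, cnj z) = (f z, cnj (f z))" using elim by (simp add: T_def conj_swap_def)
      then show ?case using gT[OF elim(2)] by (simp add: G_def)
    qed
  qed
qed


section \<open>Taylor expansion, radial and angular derivatives\<close>

lemma has_sum_Suc_snd:
  fixes f :: "nat \<times> nat \<Rightarrow> complex"
  assumes "((\<lambda>(i, j). f (i, Suc j)) has_sum s) UNIV" "\<And>i. f (i, 0) = 0"
  shows "(f has_sum s) UNIV"
proof -
  have swap: "((\<lambda>x. k (prod.swap x)) has_sum s) UNIV \<longleftrightarrow> (k has_sum s) UNIV" for k :: "nat \<times> nat \<Rightarrow> complex"
    using has_sum_reindex[of prod.swap UNIV k s] by (simp add: o_def)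
  have "((\<lambda>x. f (prod.swap x)) has_sum s) UNIV"
  proof (rule has_sum_Suc_fst)
    show "((\<lambda>(i, j). f (prod.swap (Suc i, j))) has_sum s) UNIV"
      using swap[of "\<lambda>(i, j). f (i, Suc j)"] assms(1) by (simp add: case_prod_unfold)
  qed (use assms(2) in auto)
  then show ?thesis using swap by blast
qed

lemma geometric_bound_mono:
  assumes "geometric_bound a M t" "\<And>i j. norm (b i j) \<le> norm (a i j)"
  shows "geometric_bound b M t"
proof -
  have "norm (b i j) * t ^ (i + j) \<le> norm (a i j) * t ^ (i + j)" for i j
    using assms by (intro mult_right_mono) (auto simp: geometric_bound_def)
  then show ?thesis using assms(1) unfolding geometric_bound_def by (meson order_trans)
qed

lemma geometric_bound_shift:
  assumes "geometric_bound a M t"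
  shows "geometric_bound (\<lambda>i j. a (Suc i) j) (M / t) t" "geometric_bound (\<lambda>i j. a i (Suc j)) (M / t) t"
proof -
  have t: "t > 0" using assms by (simp add: geometric_bound_def)
  show "geometric_bound (\<lambda>i j. a (Suc i) j) (M / t) t" "geometric_bound (\<lambda>i j. a i (Suc j)) (M / t) t"
    unfolding geometric_bound_def
    using t geometric_bound_le[OF assms, of "Suc _" _] geometric_bound_le[OF assms, of _ "Suc _"]
    by (simp_all add: field_simps)
qed

text \<open>Monomials divisible by the first variable are collected in \<open>g\<close>, the
  remaining non-constant ones, pure powers of the second variable, in \<open>k\<close>. Dividing out
  the variable shifts coefficients and keeps the radius t.\<close>

lemma holomorphic2_Hadamard:
  assumes "holomorphic2 F"
  obtains G K where "holomorphic2 G" "holomorphic2 K"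
    "\<forall>\<^sub>F p in nhds 0. F p = F 0 + fst p * G p + snd p * K p"
proof -
  obtain a M t where a: "geometric_bound a M t"
    and eq: "\<And>z w. norm z < t \<Longrightarrow> norm w < t \<Longrightarrow> F (z, w) = double_series a (z, w)"
    using holomorphic2_imp_series[OF assms] by blast
  have t: "t > 0" using a by (simp add: geometric_bound_def)
  define g where "g i j = a (Suc i) j" for i j
  define k where "k i j = (if i = 0 then a i (Suc j) else 0)" for i j
  have g: "geometric_bound g (M / t) t" unfolding g_def[abs_def] by (rule geometric_bound_shift[OF a])
  have k: "geometric_bound k (M / t) t"
    by (rule geometric_bound_mono[OF geometric_bound_shift(2)[OF a]]) (auto simp: k_def)
  have eqn: "F (z, w) = a 0 0 + z * double_series g (z, w) + w * double_series k (z, w)"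
    if zw: "norm z < t" "norm w < t" for z w
  proof -
    have 1: "((\<lambda>(i, j). if i = 0 then 0 else a i j * z ^ i * w ^ j) has_sum z * double_series g (z, w)) UNIV"
    proof (rule has_sum_Suc_fst)
      show "((\<lambda>(i, j). case (Suc i, j) of (i, j) \<Rightarrow> if i = 0 then 0 else a i j * z ^ i * w ^ j)
          has_sum z * double_series g (z, w)) UNIV"
        using has_sum_cmult_right[OF double_series_has_sum[OF g zw], of z]
        by (simp add: g_def case_prod_unfold mult_ac)
    qed auto
    have 2: "((\<lambda>(i, j). if i = 0 \<and> j \<noteq> 0 then a i j * z ^ i * w ^ j else 0) has_sum w * double_series k (z, w)) UNIV"
    proof (rule has_sum_Suc_snd)
      have "(\<lambda>x. w * (case x of (i, j) \<Rightarrow> k i j * z ^ i * w ^ j)) =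
          (\<lambda>(i, j). case (i, Suc j) of (i, j) \<Rightarrow> if i = 0 \<and> j \<noteq> 0 then a i j * z ^ i * w ^ j else 0)"
        by (auto simp: k_def)
      then show "((\<lambda>(i, j). case (i, Suc j) of (i, j) \<Rightarrow> if i = 0 \<and> j \<noteq> 0 then a i j * z ^ i * w ^ j else 0)
          has_sum w * double_series k (z, w)) UNIV"
        using has_sum_cmult_right[OF double_series_has_sum[OF k zw], of w] by simp
    qed auto
    have 3: "((\<lambda>x :: nat \<times> nat. if x = (0, 0) then a 0 0 else 0) has_sum a 0 0) UNIV"
      using has_sum_cong_neutral[of UNIV "{(0::nat, 0::nat)}" "\<lambda>x. if x = (0, 0) then a 0 0 else 0" "\<lambda>x. if x = (0, 0) then a 0 0 else 0"]
        has_sum_finite[of "{(0::nat, 0::nat)}" "\<lambda>x. if x = (0, 0) then a 0 0 else 0"] by auto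
    have "((\<lambda>(i, j). a i j * z ^ i * w ^ j) has_sum (a 0 0 + z * double_series g (z, w) + w * double_series k (z, w))) UNIV"
      by (rule has_sum_cong[THEN iffD1, OF _ has_sum_add[OF has_sum_add[OF 3 1] 2]]) (auto split: if_splits)
    then show ?thesis
      using has_sum_unique[OF double_series_has_sum[OF a zw]] eq[OF zw] by simp
  qed
  show thesis
  proof
    show "holomorphic2 (double_series g)" "holomorphic2 (double_series k)"
      using g k holomorphic2_double_series by blast+
    have F0: "F 0 = a 0 0" using eqn[of 0 0] t by (simp add: zero_prod_def)
    show "\<forall>\<^sub>F p in nhds 0. F p = F 0 + fst p * double_series g p + snd p * double_series k p"
      using eventually_double_series[OF a]
    proof eventually_elim
      case (elim p)
      then show ?case using eqn[of "fst p" "snd p"] t F0 by simp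
    qed
  qed
qed

lemma ranalytic_Hadamard:
  assumes "ranalytic f"
  obtains g k where "ranalytic g" "ranalytic k" "\<forall>\<^sub>F z in nhds 0. f z = f 0 + z * g z + cnj z * k z"
proof -
  obtain F where F: "holomorphic2 F" "\<forall>\<^sub>F z in nhds 0. f z = F (z, cnj z)" "f 0 = F 0"
    by (rule ranalyticE[OF assms])
  obtain G K where G: "holomorphic2 G" "holomorphic2 K"
    "\<forall>\<^sub>F p in nhds 0. F p = F 0 + fst p * G p + snd p * K p"
    by (rule holomorphic2_Hadamard[OF F(1)])
  show thesis
  proof
    show "ranalytic (\<lambda>z. G (z, cnj z))" "ranalytic (\<lambda>z. K (z, cnj z))"
      using G by (auto intro: ranalyticI)
    show "\<forall>\<^sub>F z in nhds 0. f z = f 0 + z * G (z, cnj z) + cnj z * K (z, cnj z)"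
      using F(2) eventually_real_plane[OF G(3)] by eventually_elim (simp add: F(3))
  qed
qed

lemma ranalytic_expand2:
  assumes "ranalytic f"
  obtains a b A B C where "ranalytic A" "ranalytic B" "ranalytic C"
    "\<forall>\<^sub>F z in nhds 0. f z = f 0 + a * z + b * cnj z + z\<^sup>2 * A z + z * cnj z * B z + (cnj z)\<^sup>2 * C z"
proof -
  obtain g k where g: "ranalytic g" and k: "ranalytic k"
    and f: "\<forall>\<^sub>F z in nhds 0. f z = f 0 + z * g z + cnj z * k z"
    by (rule ranalytic_Hadamard[OF assms])
  obtain g1 g2 where g12: "ranalytic g1" "ranalytic g2" "\<forall>\<^sub>F z in nhds 0. g z = g 0 + z * g1 z + cnj z * g2 z"
    by (rule ranalytic_Hadamard[OF g])
  obtain k1 k2 where k12: "ranalytic k1" "ranalytic k2" "\<forall>\<^sub>F z in nhds 0. k z = k 0 + z * k1 z + cnj z * k2 z"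
    by (rule ranalytic_Hadamard[OF k])
  show thesis
  proof
    show "ranalytic g1" "ranalytic (\<lambda>z. g2 z + k1 z)" "ranalytic k2" using g12 k12 by auto
    show "\<forall>\<^sub>F z in nhds 0. f z = f 0 + g 0 * z + k 0 * cnj z + z\<^sup>2 * g1 z + z * cnj z * (g2 z + k1 z) + (cnj z)\<^sup>2 * k2 z"
      using f g12(3) k12(3)
    proof eventually_elim
      case (elim z)
      then show ?case by (simp add: algebra_simps power2_eq_square)
    qed
  qed
qed

text \<open>The directions \<open>z\<close> and \<open>\<i> * z\<close> are the radial and the
  angular one. The monomials \<open>z ^ i * cnj z ^ j\<close> are common eigenfunctions of the
  corresponding derivatives, with eigenvalues i + j and \<i> (i - j).\<close>

lemma double_series_Euler:
  assumes "geometric_bound a M t" "norm z < t / 4"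
  obtains D where "((\<lambda>z. double_series a (z, cnj z)) has_derivative D) (at z)"
    "((\<lambda>(i, j). of_nat (i + j) * a i j * z ^ i * cnj z ^ j) has_sum D z) UNIV"
    "((\<lambda>(i, j). \<i> * (of_nat i - of_nat j) * a i j * z ^ i * cnj z ^ j) has_sum D (\<i> * z)) UNIV"
proof -
  let ?u = "double_series (diff_fst a) (z, cnj z)" and ?v = "double_series (diff_snd a) (z, cnj z)"
  have z: "norm z < t / 4" "norm (cnj z) < t / 4" using assms by auto
  have D: "((\<lambda>z. double_series a (z, cnj z)) has_derivative (\<lambda>h. ?u * h + ?v * cnj h)) (at z)"
    using has_derivative_compose[OF has_derivative_real_plane double_series_has_derivative[OF assms(1)], of z] z by simp
  have pw: "x ^ (i - 1) * x = x ^ i" if "i \<noteq> 0" for x :: complex and i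
    using that by (cases i) auto
  have "((\<lambda>x. z * (case x of (i, j) \<Rightarrow> of_nat i * a i j * z ^ (i - 1) * cnj z ^ j)) has_sum z * ?u) UNIV"
    by (intro has_sum_cmult_right has_sum_diff_fst[OF assms(1) z])
  also have "(\<lambda>x. z * (case x of (i, j) \<Rightarrow> of_nat i * a i j * z ^ (i - 1) * cnj z ^ j)) =
      (\<lambda>(i, j). of_nat i * a i j * z ^ i * cnj z ^ j)"
  proof (intro ext, clarify)
    fix i j show "z * (of_nat i * a i j * z ^ (i - 1) * cnj z ^ j) = of_nat i * a i j * z ^ i * cnj z ^ j"
      using pw[of i z] by (cases "i = 0") (auto simp: mult_ac)
  qed
  finally have u: "((\<lambda>(i, j). of_nat i * a i j * z ^ i * cnj z ^ j) has_sum z * ?u) UNIV" .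
  have "((\<lambda>x. cnj z * (case x of (i, j) \<Rightarrow> of_nat j * a i j * z ^ i * cnj z ^ (j - 1))) has_sum cnj z * ?v) UNIV"
    by (intro has_sum_cmult_right has_sum_diff_snd[OF assms(1) z])
  also have "(\<lambda>x. cnj z * (case x of (i, j) \<Rightarrow> of_nat j * a i j * z ^ i * cnj z ^ (j - 1))) =
      (\<lambda>(i, j). of_nat j * a i j * z ^ i * cnj z ^ j)"
  proof (intro ext, clarify)
    fix i j show "cnj z * (of_nat j * a i j * z ^ i * cnj z ^ (j - 1)) = of_nat j * a i j * z ^ i * cnj z ^ j"
      using pw[of j "cnj z"] by (cases "j = 0") (auto simp: mult_ac)
  qed
  finally have v: "((\<lambda>(i, j). of_nat j * a i j * z ^ i * cnj z ^ j) has_sum cnj z * ?v) UNIV" .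
  show thesis
  proof (rule that[OF D])
    show "((\<lambda>(i, j). of_nat (i + j) * a i j * z ^ i * cnj z ^ j) has_sum ?u * z + ?v * cnj z) UNIV"
      using has_sum_add[OF u v] by (simp add: case_prod_unfold algebra_simps)
    show "((\<lambda>(i, j). \<i> * (of_nat i - of_nat j) * a i j * z ^ i * cnj z ^ j) has_sum ?u * (\<i> * z) + ?v * cnj (\<i> * z)) UNIV"
      using has_sum_cmult_right[OF has_sum_add[OF u has_sum_cmult_right[OF v, of "-1"]], of \<i>] by (simp add: case_prod_unfold algebra_simps)
  qed
qed


section \<open>Symplectic coordinates adapted to a first integral\<close>

text \<open>The angular derivative multiplies the coefficient of \<open>z ^ j * cnj z ^ k\<close> by \<open>\<i> * (j - k)\<close>, so that
  it can be inverted on series without diagonal terms, without any loss in the radius of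
  convergence.\<close>

lemma ranalytic_circle_average:
  assumes "ranalytic \<rho>"
  obtains \<sigma> \<tau> \<beta> where "ranalytic \<sigma>" "ranalytic \<tau>" "ranalytic \<beta>"
    "\<And>z z'. norm z = norm z' \<Longrightarrow> \<sigma> z = \<sigma> z'"
    "\<forall>\<^sub>F z in nhds 0. \<exists>D\<sigma> D\<tau> D\<beta>. (\<sigma> has_derivative D\<sigma>) (at z) \<and> (\<tau> has_derivative D\<tau>) (at z) \<and>
       (\<beta> has_derivative D\<beta>) (at z) \<and> D\<sigma> (\<i> * z) = 0 \<and> D\<tau> (\<i> * z) = 0 \<and>
       \<tau> z = \<sigma> z + D\<sigma> z / 2 \<and> \<rho> z = \<tau> z + D\<beta> (\<i> * z)"
proof -
  obtain F where F: "holomorphic2 F" "\<forall>\<^sub>F z in nhds 0. \<rho> z = F (z, cnj z)"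
    by (rule ranalyticE[OF assms])
  obtain c M t where c: "geometric_bound c M t"
    and eq: "\<And>z w. norm z < t \<Longrightarrow> norm w < t \<Longrightarrow> F (z, w) = double_series c (z, w)"
    using holomorphic2_imp_series[OF F(1)] by blast
  have t: "t > 0" using c by (simp add: geometric_bound_def)
  \<comment> \<open>Half the radial derivative multiplies |z|^(2 i) by i, so dividing by i + 1
    solves \<tau> = \<sigma> + (radial derivative of \<sigma>) / 2. In other words \<open>d\<close>
    is the mean of \<rho> over the circle through z and \<open>s\<close> the mean over its disc,
    while \<open>b\<close> is an angular primitive of the rest.\<close>
  define s where "s i j = (if i = j then c i j / (of_nat i + 1) else 0)" for i j
  define d where "d i j = (if i = j then c i j else 0)" for i j
  define b where "b i j = (if i = j then 0 else c i j / (\<i> * (of_nat i - of_nat j)))" for i j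
  have s_bound: "geometric_bound s M t"
  proof (rule geometric_bound_mono[OF c])
    have "norm (of_nat i + 1 :: complex) \<ge> 1" for i
      by (metis norm_of_nat of_nat_1 of_nat_add of_nat_le_iff le_add2)
    then show "norm (s i j) \<le> norm (c i j)" for i j
      by (simp add: s_def norm_divide divide_le_eq mult_left_le order_less_le_trans[OF zero_less_one])
         (metis mult_left_le norm_ge_zero mult_left_mono mult.right_neutral order_trans)
  qed
  have d_bound: "geometric_bound d M t"
    by (rule geometric_bound_mono[OF c]) (simp add: d_def)
  have b_bound: "geometric_bound b M t"
  proof (rule geometric_bound_mono[OF c])
    show "norm (b i j) \<le> norm (c i j)" for i j
    proof (cases "i = j")
      case False
      have "norm (of_nat i - of_nat j :: complex) = real_of_int \<bar>int i - int j\<bar>"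
        by (metis norm_of_int of_int_diff of_int_of_nat_eq of_int_abs)
      moreover have "\<bar>int i - int j\<bar> \<ge> 1" using False by linarith
      ultimately have 1: "norm (of_nat i - of_nat j :: complex) \<ge> 1" by simp
      have "norm (c i j) / norm (of_nat i - of_nat j :: complex) \<le> norm (c i j) / 1"
        using 1 by (intro divide_left_mono) auto
      then show ?thesis using False by (simp add: b_def norm_divide norm_mult)
    qed (simp add: b_def)
  qed
  let ?ds = "\<lambda>a z. double_series a (z, cnj z)"
  have ds_an: "ranalytic (?ds a)" if "geometric_bound a M t" for a
    by (rule ranalyticI[OF holomorphic2_double_series[OF that]]) simp
  show thesis
  proof
    show "ranalytic (?ds s)" "ranalytic (?ds d)" "ranalytic (?ds b)"
      by (rule ds_an, fact)+
    show "?ds s z = ?ds s z'" if "norm z = norm z'" for z z'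
    proof -
      have pw: "z ^ i * cnj z ^ i = of_real (norm z) ^ (2 * i)" for i and z :: complex
        by (simp add: power_mult_distrib[symmetric] complex_norm_square[symmetric] power_mult)
      have "s i j * z ^ i * cnj z ^ j = s i j * z' ^ i * cnj z' ^ j" for i j
        using pw[of z i] pw[of z' i] that by (cases "i = j") (simp_all add: s_def mult.assoc)
      then show ?thesis unfolding double_series_def by (intro infsum_cong) auto
    qed
    have "\<forall>\<^sub>F z in nhds 0. norm z < t / 4"
      unfolding eventually_nhds_metric using t by (intro exI[of _ "t / 4"]) auto
    with F(2) show "\<forall>\<^sub>F z in nhds 0. \<exists>D\<sigma> D\<tau> D\<beta>. (?ds s has_derivative D\<sigma>) (at z) \<and> (?ds d has_derivative D\<tau>) (at z) \<and>
       (?ds b has_derivative D\<beta>) (at z) \<and> D\<sigma> (\<i> * z) = 0 \<and> D\<tau> (\<i> * z) = 0 \<and>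
       ?ds d z = ?ds s z + D\<sigma> z / 2 \<and> \<rho> z = ?ds d z + D\<beta> (\<i> * z)"
    proof eventually_elim
      case (elim z)
      have zt: "norm z < t" "norm (cnj z) < t" using elim t by auto
      obtain D\<sigma> where D\<sigma>: "(?ds s has_derivative D\<sigma>) (at z)"
        "((\<lambda>(i, j). of_nat (i + j) * s i j * z ^ i * cnj z ^ j) has_sum D\<sigma> z) UNIV"
        "((\<lambda>(i, j). \<i> * (of_nat i - of_nat j) * s i j * z ^ i * cnj z ^ j) has_sum D\<sigma> (\<i> * z)) UNIV"
        by (rule double_series_Euler[OF s_bound elim(2)])
      obtain D\<tau> where D\<tau>: "(?ds d has_derivative D\<tau>) (at z)"
        "((\<lambda>(i, j). of_nat (i + j) * d i j * z ^ i * cnj z ^ j) has_sum D\<tau> z) UNIV"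
        "((\<lambda>(i, j). \<i> * (of_nat i - of_nat j) * d i j * z ^ i * cnj z ^ j) has_sum D\<tau> (\<i> * z)) UNIV"
        by (rule double_series_Euler[OF d_bound elim(2)])
      obtain D\<beta> where D\<beta>: "(?ds b has_derivative D\<beta>) (at z)"
        "((\<lambda>(i, j). of_nat (i + j) * b i j * z ^ i * cnj z ^ j) has_sum D\<beta> z) UNIV"
        "((\<lambda>(i, j). \<i> * (of_nat i - of_nat j) * b i j * z ^ i * cnj z ^ j) has_sum D\<beta> (\<i> * z)) UNIV"
        by (rule double_series_Euler[OF b_bound elim(2)])
      have zero: "x = 0" if "(f has_sum x) UNIV" "\<And>i j. f (i, j) = 0" for f :: "nat \<times> nat \<Rightarrow> complex" and x
      proof -
        have "f = (\<lambda>_. 0)" using that(2) by auto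
        with that(1) has_sum_unique[OF _ has_sum_0, of "\<lambda>_. 0"] show ?thesis by simp
      qed
      have 1: "D\<sigma> (\<i> * z) = 0" by (rule zero[OF D\<sigma>(3)]) (simp add: s_def)
      have 2: "D\<tau> (\<i> * z) = 0" by (rule zero[OF D\<tau>(3)]) (simp add: d_def)
      have 3: "?ds d z = ?ds s z + D\<sigma> z / 2"
      proof -
        have "((\<lambda>(i, j). d i j * z ^ i * cnj z ^ j) has_sum (?ds s z + D\<sigma> z * (1 / 2))) UNIV"
        proof (rule has_sum_cong[THEN iffD1, OF _ has_sum_add[OF double_series_has_sum[OF s_bound zt]
              has_sum_cmult_left[OF D\<sigma>(2), of "1 / 2"]]])
          fix x :: "nat \<times> nat"
          obtain i j where x: "x = (i, j)" by (cases x)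
          have "of_nat i + 1 \<noteq> (0 :: complex)" by (metis of_nat_Suc of_nat_eq_0_iff nat.distinct(1) add.commute)
          then have "s i i * (of_nat i + 1) = c i i" by (simp add: s_def)
          then have "s i j + of_nat (i + j) * s i j * (1 / 2) = d i j"
            by (cases "i = j") (simp_all add: d_def s_def[of i j] algebra_simps)
          then have "(s i j + of_nat (i + j) * s i j * (1 / 2)) * (z ^ i * cnj z ^ j) = d i j * (z ^ i * cnj z ^ j)"
            by simp
          then show "(case x of (i, j) \<Rightarrow> s i j * z ^ i * cnj z ^ j)
              + (case x of (i, j) \<Rightarrow> of_nat (i + j) * s i j * z ^ i * cnj z ^ j) * (1 / 2)
              = (case x of (i, j) \<Rightarrow> d i j * z ^ i * cnj z ^ j)"
            by (simp add: x algebra_simps)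
        qed
        with has_sum_unique[OF double_series_has_sum[OF d_bound zt]] show ?thesis by simp
      qed
      have 4: "\<rho> z = ?ds d z + D\<beta> (\<i> * z)"
      proof -
        have "((\<lambda>(i, j). c i j * z ^ i * cnj z ^ j) has_sum (?ds d z + D\<beta> (\<i> * z))) UNIV"
        proof (rule has_sum_cong[THEN iffD1, OF _ has_sum_add[OF double_series_has_sum[OF d_bound zt] D\<beta>(3)]])
          fix x :: "nat \<times> nat"
          obtain i j where x: "x = (i, j)" by (cases x)
          have "d i j + \<i> * (of_nat i - of_nat j) * b i j = c i j"
            by (simp add: b_def d_def)
          then have "(d i j + \<i> * (of_nat i - of_nat j) * b i j) * (z ^ i * cnj z ^ j) = c i j * (z ^ i * cnj z ^ j)"
            by simp
          then show "(case x of (i, j) \<Rightarrow> d i j * z ^ i * cnj z ^ j)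
              + (case x of (i, j) \<Rightarrow> \<i> * (of_nat i - of_nat j) * b i j * z ^ i * cnj z ^ j)
              = (case x of (i, j) \<Rightarrow> c i j * z ^ i * cnj z ^ j)"
            by (simp add: x algebra_simps)
        qed
        with has_sum_unique[OF double_series_has_sum[OF c zt]] eq[OF zt] elim(1) show ?thesis by simp
      qed
      show ?case using D\<sigma>(1) D\<tau>(1) D\<beta>(1) 1 2 3 4 by blast
    qed
  qed
qed

section \<open>Normal form of an analytic area density\<close>

lemma area_form_mult: "area_form (w * u) (w * v) = (norm w)\<^sup>2 * area_form u v"
  unfolding area_form_def cmod_power2 by (simp add: algebra_simps power2_eq_square)

text \<open>The factor is the determinant of \<open>A\<close>. It may therefore be computed on any
  convenient pair of vectors, such as a radial and an angular one.\<close>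

lemma area_form_linear:
  assumes "linear A"
  shows "area_form (A u) (A v) = area_form (A 1) (A \<i>) * area_form u v"
proof -
  have "A w = Re w *\<^sub>R A 1 + Im w *\<^sub>R A \<i>" for w
  proof -
    have "w = Re w *\<^sub>R 1 + Im w *\<^sub>R \<i>" by (simp add: complex_eq_iff)
    then have "A w = A (Re w *\<^sub>R 1 + Im w *\<^sub>R \<i>)" by simp
    also have "\<dots> = Re w *\<^sub>R A 1 + Im w *\<^sub>R A \<i>"
      by (simp only: linear_add[OF assms] linear_scale[OF assms])
    finally show ?thesis .
  qed
  from this[of u] this[of v] show ?thesis
    by (simp add: area_form_def algebra_simps)
qed

lemma has_derivative_ident_mult:
  assumes "ranalytic g"
  shows "((\<lambda>z. z * g z) has_derivative (\<lambda>h. g 0 * h)) (at 0)"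
proof -
  obtain u v where "\<forall>\<^sub>F z in nhds 0. (g has_derivative (\<lambda>h. u z * h + v z * cnj h)) (at z)"
    by (rule ranalytic_derivative[OF assms])
  from has_derivative_mult[OF has_derivative_ident eventually_nhds_x_imp_x[OF this]]
  show ?thesis by (simp add: mult.commute)
qed

text \<open>In polar coordinates the map below is \<open>(r\<^sup>2, \<theta>) \<mapsto> (r\<^sup>2 * \<sigma>, \<theta> + b)\<close>: the radial factor makes the
  areas of discs agree and the angle is then corrected along each circle.\<close>

lemma ranalytic_density_normal_form:
  fixes \<rho> :: "complex \<Rightarrow> real"
  assumes "ranalytic (\<lambda>z. of_real (\<rho> z))" and pos: "\<rho> 0 > 0"
  obtains \<Psi> and c :: real where "c > 0" "ranalytic \<Psi>" "\<Psi> 0 = 0"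
    "(\<Psi> has_derivative (\<lambda>h. of_real c * h)) (at 0)"
    "\<forall>z z'. norm z = norm z' \<longrightarrow> norm (\<Psi> z) = norm (\<Psi> z')"
    "\<forall>\<^sub>F z in nhds 0. \<exists>A. (\<Psi> has_derivative A) (at z) \<and>
       (\<forall>u v. area_form (A u) (A v) = \<rho> z * area_form u v)"
proof -
  obtain \<sigma>' \<tau>' \<beta>' where an: "ranalytic \<sigma>'" "ranalytic \<tau>'" "ranalytic \<beta>'"
    and radial: "\<And>z z'. norm z = norm z' \<Longrightarrow> \<sigma>' z = \<sigma>' z'"
    and ev: "\<forall>\<^sub>F z in nhds 0. \<exists>D\<sigma> D\<tau> D\<beta>. (\<sigma>' has_derivative D\<sigma>) (at z) \<and> (\<tau>' has_derivative D\<tau>) (at z) \<and>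
       (\<beta>' has_derivative D\<beta>) (at z) \<and> D\<sigma> (\<i> * z) = 0 \<and> D\<tau> (\<i> * z) = 0 \<and>
       \<tau>' z = \<sigma>' z + D\<sigma> z / 2 \<and> of_real (\<rho> z) = \<tau>' z + D\<beta> (\<i> * z)"
    using ranalytic_circle_average[OF assms(1)] by blast
  \<comment> \<open>Subtracting the constant from \<beta> leaves its angular derivative alone and
    makes \<open>L 0\<close> real, so that \<Psi> has a real scalar as derivative at 0.\<close>
  define \<sigma> \<tau> \<beta> where "\<sigma> z = Re (\<sigma>' z)" and "\<tau> z = Re (\<tau>' z)" and "\<beta> z = Re (\<beta>' z) - Re (\<beta>' 0)" for z
  have ev_real: "\<forall>\<^sub>F z in nhds 0. \<exists>D\<sigma> D\<tau> D\<beta>. (\<sigma> has_derivative D\<sigma>) (at z) \<and> (\<tau> has_derivative D\<tau>) (at z) \<and>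
       (\<beta> has_derivative D\<beta>) (at z) \<and> D\<sigma> (\<i> * z) = 0 \<and> D\<tau> (\<i> * z) = 0 \<and>
       \<tau> z = \<sigma> z + D\<sigma> z / 2 \<and> \<rho> z = \<tau> z + D\<beta> (\<i> * z)"
    using ev
  proof eventually_elim
    case (elim z)
    then obtain D\<sigma> D\<tau> D\<beta> where D: "(\<sigma>' has_derivative D\<sigma>) (at z)" "(\<tau>' has_derivative D\<tau>) (at z)"
       "(\<beta>' has_derivative D\<beta>) (at z)" and eqs: "D\<sigma> (\<i> * z) = 0" "D\<tau> (\<i> * z) = 0"
       "\<tau>' z = \<sigma>' z + D\<sigma> z / 2" "of_real (\<rho> z) = \<tau>' z + D\<beta> (\<i> * z)" by blast
    have 1: "(\<sigma> has_derivative (\<lambda>h. Re (D\<sigma> h))) (at z)" "(\<tau> has_derivative (\<lambda>h. Re (D\<tau> h))) (at z)"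
      "(\<beta> has_derivative (\<lambda>h. Re (D\<beta> h))) (at z)"
      using D[THEN bounded_linear.has_derivative[OF bounded_linear_Re]]
        has_derivative_diff[OF bounded_linear.has_derivative[OF bounded_linear_Re D(3)] has_derivative_const[of "Re (\<beta>' 0)"]]
      unfolding \<sigma>_def \<tau>_def \<beta>_def by simp_all
    have 2: "\<rho> z = \<tau> z + Re (D\<beta> (\<i> * z))"
      unfolding \<tau>_def using arg_cong[OF eqs(4), of Re] by simp
    show ?case
      by (rule exI[of _ "\<lambda>h. Re (D\<sigma> h)"], rule exI[of _ "\<lambda>h. Re (D\<tau> h)"], rule exI[of _ "\<lambda>h. Re (D\<beta> h)"])
        (use 1 2 eqs(1-3) in \<open>auto simp: \<sigma>_def \<tau>_def\<close>)
  qed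
  have at0: "\<tau> 0 = \<rho> 0" "\<sigma> 0 = \<rho> 0"
    using eventually_nhds_x_imp_x[OF ev_real] linear_0[OF has_derivative_linear] by fastforce+
  have cont: "isCont \<sigma> 0" "isCont \<tau> 0"
    using an(1,2)[THEN ranalytic_isCont] unfolding \<sigma>_def \<tau>_def by (auto intro!: continuous_intros)
  have ev_pos: "\<forall>\<^sub>F z in nhds 0. \<sigma> z > 0 \<and> \<tau> z > 0"
    by (intro eventually_conj eventually_nhds_continuous[OF cont(1)] eventually_nhds_continuous[OF cont(2)]
        eventually_nhds_in_open[of "{0<..}", simplified]) (use at0 pos in auto)
  \<comment> \<open>Since \<tau> is constant on circles, the angular derivative of \<open>b\<close>
    is that of \<beta> divided by \<tau>. The radial factor alone produces the density \<tau>;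
    turning by \<open>b\<close> multiplies it by 1 + (angular derivative of \<beta>) / \<tau>, which
    gives \<rho>.\<close>
  define b where "b z = \<beta> z / \<tau> z" for z
  define L where "L z = of_real (ln (\<sigma> z) / 2) + \<i> * of_real (b z)" for z
  define \<Psi> where "\<Psi> z = z * exp (L z)" for z
  have "ranalytic (\<lambda>z. of_real (\<beta> z) / of_real (\<tau> z))"
    unfolding \<beta>_def \<tau>_def of_real_diff using an at0 pos
    by (intro ranalytic_divide ranalytic_diff ranalytic_Re ranalytic_const) (auto simp: \<tau>_def)
  moreover have "ranalytic (\<lambda>z. Ln (of_real (\<sigma> z)))"
    unfolding \<sigma>_def by (rule ranalytic_compose_analytic[OF ranalytic_Re[OF an(1)]])
      (use at0 pos in \<open>auto intro!: analytic_intros simp: \<sigma>_def\<close>)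
  ultimately have "ranalytic (\<lambda>z. Ln (of_real (\<sigma> z)) * (1 / 2) + \<i> * (of_real (\<beta> z) / of_real (\<tau> z)))"
    by (intro ranalytic_add ranalytic_mult ranalytic_const)
  then have L_an: "ranalytic L"
    by (rule ranalytic_cong[rotated]) (use ev_pos in eventually_elim, simp add: L_def b_def Ln_of_real)
  have E_an: "ranalytic (\<lambda>z. exp (L z))"
    by (rule ranalytic_compose_analytic[OF L_an]) (auto intro!: analytic_intros)
  have \<Psi>_an: "ranalytic \<Psi>" unfolding \<Psi>_def by (intro ranalytic_mult ranalytic_ident E_an)
  have normE: "norm (exp (L z)) = exp (ln (\<sigma> z) / 2)" for z by (simp add: L_def)
  have normE2: "(norm (exp (L z)))\<^sup>2 = \<sigma> z" if "\<sigma> z > 0" for z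
    unfolding normE using that by (simp add: exp_double[symmetric])
  have L0: "exp (L 0) = of_real (exp (ln (\<sigma> 0) / 2))"
  proof -
    have "L 0 = of_real (ln (\<sigma> 0) / 2)" by (simp add: L_def b_def \<beta>_def)
    then show ?thesis by (simp only: exp_of_real)
  qed
  have der0: "(\<Psi> has_derivative (\<lambda>h. of_real (exp (ln (\<sigma> 0) / 2)) * h)) (at 0)"
    using has_derivative_ident_mult[OF E_an] unfolding \<Psi>_def[abs_def] L0 .
  show thesis
  proof (rule that[OF _ \<Psi>_an _ der0])
    show "exp (ln (\<sigma> 0) / 2) > 0" "\<Psi> 0 = 0" by (auto simp: \<Psi>_def)
    have "norm (\<Psi> z) = norm (\<Psi> z')" if "norm z = norm z'" for z z'
      using that radial[OF that] by (simp add: \<Psi>_def norm_mult normE \<sigma>_def del: norm_exp_eq_Re)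
    then show "\<forall>z z'. norm z = norm z' \<longrightarrow> norm (\<Psi> z) = norm (\<Psi> z')" by blast
    show "\<forall>\<^sub>F z in nhds 0. \<exists>A. (\<Psi> has_derivative A) (at z) \<and>
       (\<forall>u v. area_form (A u) (A v) = \<rho> z * area_form u v)"
      using ev_pos ev_real
    proof eventually_elim
      case (elim z)
      show ?case
      \<comment> \<open>Away from 0 the determinant is computed on the frame \<open>z\<close>,
        \<open>\<i> * z\<close>; at 0 that frame degenerates and the scalar derivative is used
        directly.\<close>
      proof (cases "z = 0")
        case True
        have "(norm (of_real (exp (ln (\<sigma> 0) / 2)) :: complex))\<^sup>2 = \<rho> 0"
          using normE2[of 0] at0 pos unfolding L0 by simp
        then show ?thesis using der0 True by (auto simp: area_form_mult)
      next
        case False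
        define s t where "s = \<sigma> z" and "t = \<tau> z"
        have st: "s > 0" "t > 0" using elim by (auto simp: s_def t_def)
        obtain D\<sigma> D\<tau> D\<beta> where D: "(\<sigma> has_derivative D\<sigma>) (at z)" "(\<tau> has_derivative D\<tau>) (at z)"
          "(\<beta> has_derivative D\<beta>) (at z)" and eqs: "D\<sigma> (\<i> * z) = 0" "D\<tau> (\<i> * z) = 0"
          "t = s + D\<sigma> z / 2" "\<rho> z = t + D\<beta> (\<i> * z)"
          using elim(2) unfolding s_def t_def by blast
        define Db where "Db h = (D\<beta> h * t - \<beta> z * D\<tau> h) / (t * t)" for h
        have Db: "(b has_derivative Db) (at z)"
          unfolding b_def Db_def t_def
          using st by (auto intro!: derivative_eq_intros D simp: t_def field_simps)
        have "((\<lambda>z. ln (\<sigma> z) / 2) has_derivative (\<lambda>h. D\<sigma> h / s / 2)) (at z)"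
          unfolding s_def using st by (auto intro!: derivative_eq_intros D simp: s_def field_simps)
        then have DL: "(L has_derivative (\<lambda>h. of_real (D\<sigma> h / s / 2) + \<i> * of_real (Db h))) (at z)"
          unfolding L_def
          by (intro has_derivative_add has_derivative_of_real has_derivative_mult_right Db)
        define E where "E = exp (L z)"
        define A where "A h = z * (E * (of_real (D\<sigma> h / s / 2) + \<i> * of_real (Db h))) + h * E" for h
        have "(exp has_derivative (\<lambda>h. E * h)) (at (L z))"
          using DERIV_exp[of "L z"] by (simp add: has_field_derivative_def E_def)
        from has_derivative_mult[OF has_derivative_ident has_derivative_compose[OF DL this]]
        have A: "(\<Psi> has_derivative A) (at z)"
          unfolding \<Psi>_def[abs_def] A_def[abs_def] E_def .
        have Dbi: "Db (\<i> * z) = D\<beta> (\<i> * z) / t" using st eqs(2) by (simp add: Db_def)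
        \<comment> \<open>After removing the common factor \<open>z * E\<close>, the image of the
          angular vector is purely imaginary, because \<sigma> has no angular derivative. The matrix
          is triangular, and its determinant is the product of the diagonal entries.\<close>
        have 1: "A z = (z * E) * Complex (1 + D\<sigma> z / s / 2) (Db z)"
          by (simp add: A_def algebra_simps Complex_eq)
        have 2: "A (\<i> * z) = (z * E) * Complex 0 (1 + Db (\<i> * z))"
          by (simp add: A_def algebra_simps Complex_eq eqs(1))
        have "area_form (A z) (A (\<i> * z)) = (norm (z * E))\<^sup>2 * ((1 + D\<sigma> z / s / 2) * (1 + Db (\<i> * z)))"
          unfolding 1 2 area_form_mult by (simp add: area_form_def)
        also have "(norm (z * E))\<^sup>2 = (norm z)\<^sup>2 * s"
          using normE2[of z] st unfolding E_def s_def norm_mult power_mult_distrib by simp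
        also have "1 + D\<sigma> z / s / 2 = t / s" using st eqs(3) by (simp add: field_simps)
        also have "(norm z)\<^sup>2 * s * (t / s * (1 + Db (\<i> * z))) = (norm z)\<^sup>2 * \<rho> z"
          unfolding Dbi using st eqs(4) by (simp add: field_simps)
        finally have "area_form (A 1) (A \<i>) * area_form z (\<i> * z) = (norm z)\<^sup>2 * \<rho> z"
          by (subst (asm) area_form_linear[OF has_derivative_linear[OF A]])
        moreover have "area_form z (\<i> * z) = (norm z)\<^sup>2"
          unfolding area_form_def cmod_power2 by (simp add: power2_eq_square)
        ultimately have \<rho>: "area_form (A 1) (A \<i>) = \<rho> z" using False by simp
        have "area_form (A u) (A v) = \<rho> z * area_form u v" for u v
          using area_form_linear[OF has_derivative_linear[OF A], of u v] unfolding \<rho> .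
        then show ?thesis using A by blast
      qed
    qed
  qed
qed


section \<open>Quadratic part of an invariant function and the Morse lemma\<close>

lemma directional_limit:
  fixes f :: "complex \<Rightarrow> 'b::real_normed_vector"
  assumes "(f has_derivative D) (at 0)"
  shows "((\<lambda>t. (f (of_real t * z) - f 0) /\<^sub>R t) \<longlongrightarrow> D z) (at_right (0::real))"
proof -
  have lin: "linear D" using assms by (rule has_derivative_linear)
  have Dt: "D (of_real t * z) = t *\<^sub>R D z" for t
    using linear_scale[OF lin, of t z] by (simp add: scaleR_conv_of_real)
  have "((\<lambda>t. of_real t * z) has_derivative (\<lambda>t. of_real t * z)) (at (0::real))"
    by (auto intro!: derivative_eq_intros)
  moreover have "(f has_derivative D) (at (of_real 0 * z))" using assms by simp
  ultimately have "((\<lambda>t. f (of_real t * z)) has_derivative (\<lambda>t. t *\<^sub>R D z)) (at (0::real))"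
    unfolding Dt[symmetric] by (rule has_derivative_compose)
  then have "(\<lambda>t. norm (f (of_real t * z) - f 0 - t *\<^sub>R D z) / norm t) \<midarrow>0\<rightarrow> 0"
    by (simp add: has_derivative_at)
  then have "((\<lambda>t. norm (f (of_real t * z) - f 0 - t *\<^sub>R D z) / norm t) \<longlongrightarrow> 0) (at_right (0::real))"
    by (rule tendsto_mono[rotated]) (simp add: at_le)
  then have "((\<lambda>t. norm ((f (of_real t * z) - f 0) /\<^sub>R t - D z)) \<longlongrightarrow> 0) (at_right (0::real))"
  proof (rule Lim_transform_eventually)
    show "\<forall>\<^sub>F t in at_right (0::real). norm (f (of_real t * z) - f 0 - t *\<^sub>R D z) / norm t
        = norm ((f (of_real t * z) - f 0) /\<^sub>R t - D z)"
      using eventually_at_right_less[of 0]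
    proof eventually_elim
      case (elim t)
      have "(f (of_real t * z) - f 0) /\<^sub>R t - D z = (f (of_real t * z) - f 0 - t *\<^sub>R D z) /\<^sub>R t"
        using elim by (simp add: scaleR_diff_right)
      then show ?case using elim by (simp add: divide_inverse_commute)
    qed
  qed
  then show ?thesis by (metis Lim_null tendsto_norm_zero_iff)
qed

lemma filterlim_ray: "((\<lambda>t. of_real t * z) \<longlongrightarrow> (0 :: complex)) (at_right (0::real))"
  by (auto intro!: tendsto_eq_intros)

lemma eventually_ray:
  "\<forall>\<^sub>F z in nhds 0. P z \<Longrightarrow> \<forall>\<^sub>F t in at_right (0::real). P (of_real t * z :: complex)"
  using filterlim_ray[of z] by (simp add: filterlim_iff)

lemma tendsto_ray: "isCont f (0::complex) \<Longrightarrow> ((\<lambda>t. f (of_real t * z)) \<longlongrightarrow> f 0) (at_right (0::real))"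
  by (rule isCont_tendsto_compose[OF _ filterlim_ray])

lemma Re_of_real_mult: "Re (of_real r * z) = r * Re z"
  by simp

text \<open>\<open>H\<close> is real, so taking real parts folds each term in \<open>cnj z\<close>
  onto its conjugate in \<open>z\<close>; what is left is one linear coefficient, one mixed term and
  one holomorphic-looking quadratic term.\<close>

lemma ranalytic_real_expand2:
  fixes H :: "complex \<Rightarrow> real"
  assumes "ranalytic (\<lambda>z. of_real (H z))"
  obtains a A and B :: "complex \<Rightarrow> real" where "ranalytic A" "ranalytic (\<lambda>z. of_real (B z))"
    "\<forall>\<^sub>F z in nhds 0. H z = H 0 + Re (a * z) + (norm z)\<^sup>2 * B z + Re (z\<^sup>2 * A z)"
proof -
  obtain a b A B C where an: "ranalytic A" "ranalytic B" "ranalytic C" and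
    ev: "\<forall>\<^sub>F z in nhds 0. of_real (H z) = of_real (H 0) + a * z + b * cnj z + z\<^sup>2 * A z + z * cnj z * B z + (cnj z)\<^sup>2 * C z"
    by (rule ranalytic_expand2[OF assms])
  show thesis
  proof
    show "ranalytic (\<lambda>z. A z + cnj (C z))" "ranalytic (\<lambda>z. of_real (Re (B z)))"
      using an by (auto intro!: ranalytic_add ranalytic_cnj ranalytic_Re)
    show "\<forall>\<^sub>F z in nhds 0. H z = H 0 + Re ((a + cnj b) * z) + (norm z)\<^sup>2 * Re (B z) + Re (z\<^sup>2 * (A z + cnj (C z)))"
      using ev
    proof eventually_elim
      case (elim z)
      have "z * cnj z * B z = of_real ((norm z)\<^sup>2) * B z" by (simp only: complex_norm_square)
      then have 1: "Re (z * cnj z * B z) = (norm z)\<^sup>2 * Re (B z)" by (simp only: Re_of_real_mult)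
      have "(cnj z)\<^sup>2 * C z = cnj (z\<^sup>2 * cnj (C z))" by simp
      then have 2: "Re ((cnj z)\<^sup>2 * C z) = Re (z\<^sup>2 * cnj (C z))" by (simp only: cnj.simps)
      have 3: "Re (b * cnj z) = Re (cnj b * z)" by simp
      show ?case
        using arg_cong[OF elim, of Re] unfolding plus_complex.simps 1 2 3 distrib_left distrib_right by simp
    qed
  qed
qed

text \<open>With \<open>w = \<alpha> z + \<beta> cnj z\<close> one has \<open>\<bar>w\<bar>\<^sup>2 = (\<alpha>\<^sup>2 + \<bar>\<beta>\<bar>\<^sup>2) \<bar>z\<bar>\<^sup>2 + 2 Re (\<alpha> cnj \<beta> z\<^sup>2)\<close> for real \<open>\<alpha>\<close>, and
  matching coefficients gives a quadratic equation for \<open>\<alpha>\<^sup>2\<close>.\<close>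

lemma ranalytic_Morse:
  fixes H B :: "complex \<Rightarrow> real"
  assumes A: "ranalytic A" "A 0 = 0" and B: "ranalytic (\<lambda>z. of_real (B z))" "B 0 > 0"
    and H: "\<forall>\<^sub>F z in nhds 0. H z = H 0 + (norm z)\<^sup>2 * B z + Re (z\<^sup>2 * A z)"
  obtains M and c :: real where "c > 0" "ranalytic M" "M 0 = 0" "(M has_derivative (\<lambda>h. of_real c * h)) (at 0)"
    "\<forall>\<^sub>F z in nhds 0. H z = H 0 + (norm (M z))\<^sup>2"
proof -
  define s where "s z = (B z)\<^sup>2 - (norm (A z))\<^sup>2" for z
  \<comment> \<open>\<open>k\<close> is the larger root of k^2 - B k + |A|^2 / 4 = 0, the equation
    for \<alpha>^2. At 0 it equals \<open>B 0 > 0\<close>, and the discriminant is positive there,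
    so both square roots are analytic near 0.\<close>
  define k where "k z = (B z + sqrt (s z)) / 2" for z
  define \<alpha> where "\<alpha> z = sqrt (k z)" for z
  define \<beta> where "\<beta> z = cnj (A z) / 2 / of_real (\<alpha> z)" for z
  have s_an: "ranalytic (\<lambda>z. of_real (s z))"
  proof -
    have "ranalytic (\<lambda>z. of_real (B z) * of_real (B z) - A z * cnj (A z))"
      using A B by (intro ranalytic_diff ranalytic_mult ranalytic_cnj)
    moreover have "of_real (B z) * of_real (B z) - A z * cnj (A z) = of_real (s z)" for z
      unfolding s_def of_real_diff complex_norm_square by (simp add: power2_eq_square)
    ultimately show ?thesis by simp
  qed
  have isCont_real: "isCont g 0" if "ranalytic (\<lambda>z. of_real (g z))" for g :: "complex \<Rightarrow> real"
    using continuous_Re[OF ranalytic_isCont[OF that]] by simp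
  have pos: "\<forall>\<^sub>F z in nhds 0. g z > 0" if "isCont g 0" "g 0 > 0" for g :: "complex \<Rightarrow> real"
    using eventually_nhds_continuous[OF that(1) eventually_nhds_in_open[of "{0<..}"]] that(2) by simp
  have s0: "s 0 = (B 0)\<^sup>2" "k 0 = B 0" "\<alpha> 0 = sqrt (B 0)" "\<beta> 0 = 0"
    using A B by (auto simp: s_def k_def \<alpha>_def \<beta>_def)
  have s_pos: "\<forall>\<^sub>F z in nhds 0. s z > 0"
    using B s0 by (intro pos isCont_real s_an) auto
  have sqrt_an: "ranalytic (\<lambda>z. of_real (sqrt (g z)))"
    if g: "ranalytic (\<lambda>z. of_real (g z))" "g 0 > 0" for g :: "complex \<Rightarrow> real"
  proof -
    have "ranalytic (\<lambda>z. csqrt (of_real (g z)))"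
      by (rule ranalytic_compose_analytic[OF g(1)]) (use g(2) in \<open>auto intro!: analytic_intros\<close>)
    then show ?thesis
      by (rule ranalytic_cong[rotated])
        (use pos[OF isCont_real[OF g(1)] g(2)] in eventually_elim, simp add: csqrt_of_real_nonneg less_imp_le)
  qed
  have k_an: "ranalytic (\<lambda>z. of_real (k z))"
    unfolding k_def of_real_divide of_real_add using B s_an s0
    by (intro ranalytic_divide ranalytic_add sqrt_an ranalytic_const) auto
  have \<alpha>_an: "ranalytic (\<lambda>z. of_real (\<alpha> z))"
    unfolding \<alpha>_def using B s0 by (intro sqrt_an k_an) auto
  have \<beta>_an: "ranalytic \<beta>"
    unfolding \<beta>_def using A B s0 \<alpha>_an by (intro ranalytic_divide ranalytic_cnj ranalytic_const) auto
  define M where "M z = z * of_real (\<alpha> z) + cnj z * \<beta> z" for z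
  have M_an: "ranalytic M" unfolding M_def
    using \<alpha>_an \<beta>_an by (intro ranalytic_add ranalytic_mult ranalytic_ident ranalytic_cnj)
  \<comment> \<open>As \<open>A 0 = 0\<close> forces \<open>\<beta> 0 = 0\<close>, this term is of
    second order, and the derivative of \<open>M\<close> at 0 is a real scalar.\<close>
  have "((\<lambda>z. cnj z * \<beta> z) has_derivative (\<lambda>h. 0)) (at 0)"
  proof -
    have "((\<lambda>z. z * cnj (\<beta> z)) has_derivative (\<lambda>h. 0)) (at 0)"
      using has_derivative_ident_mult[OF ranalytic_cnj[OF \<beta>_an]] s0 by simp
    from bounded_linear.has_derivative[OF bounded_linear_cnj this] show ?thesis by simp
  qed
  from has_derivative_add[OF has_derivative_ident_mult[OF \<alpha>_an] this]
  have dM: "(M has_derivative (\<lambda>h. of_real (sqrt (B 0)) * h)) (at 0)"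
    by (simp add: M_def[abs_def] s0)
  show thesis
  proof (rule that[OF _ M_an _ dM])
    show "sqrt (B 0) > 0" "M 0 = 0" using B by (auto simp: M_def)
    show "\<forall>\<^sub>F z in nhds 0. H z = H 0 + (norm (M z))\<^sup>2"
      using H s_pos pos[OF isCont_real[OF B(1)] B(2)]
    proof eventually_elim
      case (elim z)
      let ?a = "\<alpha> z" and ?b = "\<beta> z"
      have k: "k z > 0" using elim by (simp add: k_def add_pos_pos)
      have \<alpha>2: "?a\<^sup>2 = k z" "?a > 0" using k by (auto simp: \<alpha>_def)
      have "k z * (B z - k z) = (norm (A z))\<^sup>2 / 4"
        using elim(2) by (simp add: k_def field_simps power2_eq_square[symmetric]) (simp add: s_def)
      then have "(norm ?b)\<^sup>2 = B z - k z"
        using k \<alpha>2 by (simp add: \<beta>_def norm_divide power_divide field_simps)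
      then have 1: "?a\<^sup>2 + (norm ?b)\<^sup>2 = B z" using \<alpha>2 by simp
      have ab: "of_real ?a * cnj ?b = A z / 2" using \<alpha>2 by (simp add: \<beta>_def)
      have "(norm (M z))\<^sup>2 = (?a\<^sup>2 + (norm ?b)\<^sup>2) * (norm z)\<^sup>2 + 2 * Re (z\<^sup>2 * (of_real ?a * cnj ?b))"
        unfolding M_def cmod_power2 by (simp add: power2_eq_square algebra_simps)
      then show ?case
        using elim(1) mult.commute[of "B z" "(norm z)\<^sup>2"]
        unfolding 1 ab times_divide_eq_right Re_divide_numeral by linarith
    qed
  qed
qed

text \<open>The second-order limit of \<open>H\<close> along a ray is computed at \<open>z\<close>
  and, through \<open>f\<close>, at \<open>\<mu> * z\<close>. Invariance makes both equal, so Re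
  ((\<mu>^2 - 1) z^2 A 0) = 0 for every z, and \<mu>^2 being different from 1 kills
  \<open>A 0\<close>.\<close>

lemma invariant_expansion:
  fixes H B :: "complex \<Rightarrow> real"
  assumes an: "ranalytic A" "ranalytic (\<lambda>z. of_real (B z))"
    and H: "\<forall>\<^sub>F z in nhds 0. H z = H 0 + Re (a * z) + (norm z)\<^sup>2 * B z + Re (z\<^sup>2 * A z)"
    and dH: "(H has_derivative (\<lambda>h. 0)) (at 0)"
    and f: "f 0 = 0" "(f has_derivative (\<lambda>h. \<mu> * h)) (at 0)" "isCont f 0"
    and inv: "\<forall>\<^sub>F z in nhds 0. H (f z) = H z"
    and \<mu>: "norm \<mu> = 1" "\<mu>\<^sup>2 \<noteq> 1"
  shows "a = 0" "A 0 = 0"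
    "((\<lambda>t. (H (of_real t * z) - H 0) / t\<^sup>2) \<longlongrightarrow> (norm z)\<^sup>2 * B 0) (at_right 0)"
proof -
  have Bc: "isCont B 0" using continuous_Re[OF ranalytic_isCont[OF an(2)]] by simp
  have Ac: "isCont A 0" using ranalytic_isCont[OF an(1)] .
  have "((\<lambda>z. z * (cnj z * of_real (B z) + z * A z)) has_derivative (\<lambda>h. 0)) (at 0)"
    using has_derivative_ident_mult[of "\<lambda>z. cnj z * of_real (B z) + z * A z"] an
    by (force intro!: ranalytic_add ranalytic_mult ranalytic_cnj)
  from bounded_linear.has_derivative[OF bounded_linear_Re has_derivative_add[OF this has_derivative_mult_right[OF has_derivative_ident, of a]]]
  have "((\<lambda>z. H 0 + Re (z * (cnj z * of_real (B z) + z * A z) + a * z)) has_derivative (\<lambda>h. Re (a * h))) (at 0)"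
    using has_derivative_add[OF has_derivative_const[of "H 0"]] by force
  moreover have "\<forall>\<^sub>F z in nhds 0. H 0 + Re (z * (cnj z * of_real (B z) + z * A z) + a * z) = H z"
    using H
  proof eventually_elim
    case (elim z)
    have "z * (cnj z * of_real (B z) + z * A z) = of_real ((norm z)\<^sup>2) * of_real (B z) + z\<^sup>2 * A z"
      unfolding complex_norm_square by (simp add: algebra_simps power2_eq_square)
    then have "Re (z * (cnj z * of_real (B z) + z * A z)) = (norm z)\<^sup>2 * B z + Re (z\<^sup>2 * A z)"
      by (simp only: plus_complex.simps of_real_mult[symmetric] Re_complex_of_real)
    then show ?case using elim by simp
  qed
  ultimately have "(H has_derivative (\<lambda>h. Re (a * h))) (at 0)"
    by (rule has_derivative_eventually_eq[rotated])
  \<comment> \<open>Evaluating at \<open>cnj a\<close> turns the vanishing of the linear form into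
    |a|^2 = 0.\<close>
  from has_derivative_unique[OF this dH] have "Re (a * cnj a) = 0" by metis
  then show a: "a = 0" by (simp add: complex_eq_iff flip: power2_eq_square) 
  have lim: "((\<lambda>t. (H (of_real t * z) - H 0) / t\<^sup>2) \<longlongrightarrow> (norm z)\<^sup>2 * B 0 + Re (z\<^sup>2 * A 0)) (at_right 0)" for z
  proof -
    have "((\<lambda>t. (norm z)\<^sup>2 * B (of_real t * z) + Re (z\<^sup>2 * A (of_real t * z))) \<longlongrightarrow> (norm z)\<^sup>2 * B 0 + Re (z\<^sup>2 * A 0)) (at_right 0)"
      by (intro tendsto_intros tendsto_ray Ac Bc)
    then show ?thesis
    proof (rule Lim_transform_eventually)
      show "\<forall>\<^sub>F t in at_right 0. (norm z)\<^sup>2 * B (of_real t * z) + Re (z\<^sup>2 * A (of_real t * z)) = (H (of_real t * z) - H 0) / t\<^sup>2"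
        using eventually_ray[OF H, of z] eventually_at_right_less[of "0::real"]
      proof eventually_elim
        case (elim t)
        have "(of_real t * z)\<^sup>2 * A (of_real t * z) = of_real (t\<^sup>2) * (z\<^sup>2 * A (of_real t * z))"
          by (simp add: power_mult_distrib)
        then have "Re ((of_real t * z)\<^sup>2 * A (of_real t * z)) = t\<^sup>2 * Re (z\<^sup>2 * A (of_real t * z))"
          by (simp only: Re_of_real_mult)
        then show ?case using elim a by (simp add: norm_mult power_mult_distrib field_simps)
      qed
    qed
  qed
  have lim_f: "((\<lambda>t. (H (f (of_real t * z)) - H 0) / t\<^sup>2) \<longlongrightarrow> (norm (\<mu> * z))\<^sup>2 * B 0 + Re ((\<mu> * z)\<^sup>2 * A 0)) (at_right 0)" for z
  proof -
    \<comment> \<open>The rescaled image of the ray; it converges to \<open>\<mu> * z\<close>, so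
      that the expansion of \<open>H\<close> can be taken at \<open>f (of_real t * z)\<close> after
      division by t^2.\<close>
    define w where "w t = f (of_real t * z) /\<^sub>R t" for t
    have w: "(w \<longlongrightarrow> \<mu> * z) (at_right 0)"
      using directional_limit[OF f(2), of z] unfolding w_def[abs_def] by (simp add: f(1))
    have ff: "((\<lambda>t. f (of_real t * z)) \<longlongrightarrow> 0) (at_right 0)" using tendsto_ray[OF f(3)] f(1) by simp
    have "((\<lambda>t. (norm (w t))\<^sup>2 * B (f (of_real t * z)) + Re ((w t)\<^sup>2 * A (f (of_real t * z)))) \<longlongrightarrow>
        (norm (\<mu> * z))\<^sup>2 * B 0 + Re ((\<mu> * z)\<^sup>2 * A 0)) (at_right 0)"
      by (intro tendsto_intros w isCont_tendsto_compose[OF Ac ff] isCont_tendsto_compose[OF Bc ff])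
    then show ?thesis
    proof (rule Lim_transform_eventually)
      have "\<forall>\<^sub>F t in at_right 0. H (f (of_real t * z)) = H 0 + Re (a * f (of_real t * z)) +
          (norm (f (of_real t * z)))\<^sup>2 * B (f (of_real t * z)) + Re ((f (of_real t * z))\<^sup>2 * A (f (of_real t * z)))"
        by (rule eventually_compose_filterlim[OF H ff])
      then show "\<forall>\<^sub>F t in at_right 0. (norm (w t))\<^sup>2 * B (f (of_real t * z)) + Re ((w t)\<^sup>2 * A (f (of_real t * z)))
          = (H (f (of_real t * z)) - H 0) / t\<^sup>2"
        using eventually_at_right_less[of "0::real"]
      proof eventually_elim
        case (elim t)
        let ?f = "f (of_real t * z)"
        have fw: "?f = of_real t * w t" using elim(2) by (simp add: w_def scaleR_conv_of_real)
        have "?f\<^sup>2 * A ?f = of_real (t\<^sup>2) * ((w t)\<^sup>2 * A ?f)"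
          unfolding fw by (simp add: power_mult_distrib)
        then have 1: "Re (?f\<^sup>2 * A ?f) = t\<^sup>2 * Re ((w t)\<^sup>2 * A ?f)"
          by (simp only: Re_of_real_mult)
        have 2: "(norm ?f)\<^sup>2 = t\<^sup>2 * (norm (w t))\<^sup>2"
          unfolding fw by (simp add: norm_mult power_mult_distrib)
        show ?case using elim a unfolding 1 2 by (simp add: field_simps)
      qed
    qed
  qed
  have "Re ((\<mu> * z)\<^sup>2 * A 0) = Re (z\<^sup>2 * A 0)" for z
  proof -
    have "((\<lambda>t. (H (f (of_real t * z)) - H 0) / t\<^sup>2) \<longlongrightarrow> (norm z)\<^sup>2 * B 0 + Re (z\<^sup>2 * A 0)) (at_right 0)"
      using lim[of z] by (rule Lim_transform_eventually) (use eventually_ray[OF inv, of z] in eventually_elim, simp)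
    from tendsto_unique[OF _ this lim_f] show ?thesis using \<mu> by (simp add: norm_mult)
  qed
  then have *: "Re (z\<^sup>2 * ((\<mu>\<^sup>2 - 1) * A 0)) = 0" for z
  proof -
    have "z\<^sup>2 * ((\<mu>\<^sup>2 - 1) * A 0) = (\<mu> * z)\<^sup>2 * A 0 - z\<^sup>2 * A 0"
      by (simp add: algebra_simps power_mult_distrib)
    with \<open>Re ((\<mu> * z)\<^sup>2 * A 0) = Re (z\<^sup>2 * A 0)\<close> show ?thesis by (simp only: minus_complex.simps diff_self)
  qed
  \<comment> \<open>Choosing z as a square root of the conjugate coefficient turns the real part
    into a squared modulus.\<close>
  have "Re (cnj ((\<mu>\<^sup>2 - 1) * A 0) * ((\<mu>\<^sup>2 - 1) * A 0)) = 0"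
    using *[of "csqrt (cnj ((\<mu>\<^sup>2 - 1) * A 0))"] by (simp only: power2_csqrt)
  then have "(\<mu>\<^sup>2 - 1) * A 0 = 0"
    by (simp only: mult.commute[of "cnj _"] complex_norm_square[symmetric] Re_complex_of_real) simp
  then show A0: "A 0 = 0" using \<mu> by simp
  show "((\<lambda>t. (H (of_real t * z) - H 0) / t\<^sup>2) \<longlongrightarrow> (norm z)\<^sup>2 * B 0) (at_right 0)"
    using lim[of z] A0 by simp
qed


section \<open>Passage between power series in x, y and in z, cnj z; adapted symplectic
  coordinates\<close>

lemma real_analytic_at_imp_ranalytic:
  fixes g :: "complex \<Rightarrow> 'b::real_normed_vector"
  assumes "real_analytic_at g 0" and T: "bounded_linear T"
  shows "ranalytic (\<lambda>z. T (g z))"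
proof -
  obtain a r where r: "r > 0" and sum: "\<And>h. norm h < r \<Longrightarrow>
      ((\<lambda>(i, j). (Re h ^ i * Im h ^ j) *\<^sub>R a i j) has_sum g (0 + h)) UNIV"
    using assms(1) unfolding real_analytic_at_def by blast
  define c where "c i j = T (a i j)" for i j
  have sumT: "((\<lambda>(i, j). c i j * of_real (Re h) ^ i * of_real (Im h) ^ j) has_sum T (g h)) UNIV"
    if "norm h < r" for h
  proof -
    have "((\<lambda>x. T (case x of (i, j) \<Rightarrow> (Re h ^ i * Im h ^ j) *\<^sub>R a i j)) has_sum T (g h)) UNIV"
      using has_sum_bounded_linear[OF T sum[OF that]] by simp
    also have "(\<lambda>x. T (case x of (i, j) \<Rightarrow> (Re h ^ i * Im h ^ j) *\<^sub>R a i j)) =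
        (\<lambda>(i, j). c i j * of_real (Re h) ^ i * of_real (Im h) ^ j)"
      by (auto simp: c_def linear_scale[OF bounded_linear.linear[OF T]] scaleR_conv_of_real mult_ac)
    finally show ?thesis .
  qed
  define t where "t = r / 4"
  have t: "t > 0" using r by (simp add: t_def)
  \<comment> \<open>Convergence at the single real point x = y = t, whose norm is at most 2 t = r /
    2, bounds every coefficient by the sum of absolute values there.\<close>
  have "norm (Complex t t) < r"
    using cmod_le[of "Complex t t"] t r by (simp add: t_def)
  from has_sum_imp_summable[OF sumT[OF this]]
  have summ: "(\<lambda>x. norm (case x of (i, j) \<Rightarrow> c i j * of_real t ^ i * of_real t ^ j)) summable_on UNIV"
    unfolding summable_on_iff_abs_summable_on_complex by simp
  define M where "M = (\<Sum>\<^sub>\<infinity>x. norm (case x of (i, j) \<Rightarrow> c i j * of_real t ^ i * of_real t ^ j))"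
  have "norm (c i j) * t ^ (i + j) \<le> M" for i j
    using finite_sum_le_infsum[OF summ, of "{(i, j)}"] t
    by (simp add: M_def norm_mult norm_power power_add mult.assoc)
  then have gb: "geometric_bound c M t" using t by (simp add: geometric_bound_def)
  have eq: "T (g h) = double_series c (of_real (Re h), of_real (Im h))" if "norm h < t" for h
  proof (rule has_sum_unique[OF sumT double_series_has_sum[OF gb]])
    show "norm h < r" using that r by (simp add: t_def)
    show "norm (of_real (Re h) :: complex) < t" "norm (of_real (Im h) :: complex) < t"
      using that abs_Re_le_cmod[of h] abs_Im_le_cmod[of h] by auto
  qed
  \<comment> \<open>The substitution x = (z + w) / 2, y = (z - w) / (2 \<i>), which gives the real
    and imaginary parts when w = cnj z.\<close>
  have "holomorphic2 (\<lambda>p. double_series c ((fst p + snd p) * (1/2), (fst p + (-1) * snd p) * (1 / (2 * \<i>))))"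
    by (rule holomorphic2_compose[OF holomorphic2_double_series[OF gb]])
      (intro holomorphic2_mult holomorphic2_add holomorphic2_fst holomorphic2_snd holomorphic2_const | simp)+
  then show ?thesis
  proof (rule ranalyticI)
    have "\<forall>\<^sub>F h :: complex in nhds 0. norm h < t"
      unfolding eventually_nhds_metric using t by (intro exI[of _ t]) auto
    then show "\<forall>\<^sub>F z in nhds 0. T (g z) = double_series c ((fst (z, cnj z) + snd (z, cnj z)) * (1/2),
        (fst (z, cnj z) + (-1) * snd (z, cnj z)) * (1 / (2 * \<i>)))"
    proof eventually_elim
      case (elim z)
      have "(z + cnj z) * (1/2) = of_real (Re z)" "(z + (-1) * cnj z) * (1 / (2 * \<i>)) = of_real (Im z)"
        by (auto simp: complex_eq_iff)
      with eq[OF elim] show ?case by simp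
    qed
  qed
qed

lemma ranalytic_imp_real_analytic_at:
  assumes "ranalytic f" shows "real_analytic_at f 0"
proof -
  obtain F where F: "holomorphic2 F" "\<forall>\<^sub>F z in nhds 0. f z = F (z, cnj z)"
    by (rule ranalyticE[OF assms])
  define G where "G p = F (fst p + \<i> * snd p, fst p + (- \<i>) * snd p)" for p
  have "holomorphic2 G" unfolding G_def
    by (rule holomorphic2_compose[OF F(1)])
      (intro holomorphic2_mult holomorphic2_add holomorphic2_fst holomorphic2_snd holomorphic2_const | simp)+
  then obtain a M t where a: "geometric_bound a M t"
    and eq: "\<And>z w. norm z < t \<Longrightarrow> norm w < t \<Longrightarrow> G (z, w) = double_series a (z, w)"
    using holomorphic2_imp_series by blast
  obtain e where e: "e > 0" "\<And>z. dist z 0 < e \<Longrightarrow> f z = F (z, cnj z)"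
    using F(2) unfolding eventually_nhds_metric by blast
  show ?thesis
    unfolding real_analytic_at_def
  proof (intro exI conjI allI impI)
    show "min e t > 0" using e a by (simp add: geometric_bound_def)
    fix h :: complex assume h: "norm h < min e t"
    have ht: "norm (of_real (Re h) :: complex) < t" "norm (of_real (Im h) :: complex) < t"
      using h abs_Re_le_cmod[of h] abs_Im_le_cmod[of h] by auto
    have "of_real (Re h) + \<i> * of_real (Im h) = h" "of_real (Re h) + (- \<i>) * of_real (Im h) = cnj h"
      by (auto simp: complex_eq_iff)
    then have "f h = double_series a (of_real (Re h), of_real (Im h))"
      using e(2)[of h] h eq[OF ht] by (simp add: G_def)
    moreover have "(\<lambda>(i, j). (Re h ^ i * Im h ^ j) *\<^sub>R a i j) = (\<lambda>(i, j). a i j * of_real (Re h) ^ i * of_real (Im h) ^ j)"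
      by (auto simp: scaleR_conv_of_real mult_ac)
    ultimately show "((\<lambda>(i, j). (Re h ^ i * Im h ^ j) *\<^sub>R a i j) has_sum f (0 + h)) UNIV"
      using double_series_has_sum[OF a ht] by simp
  qed
qed

text \<open>For the second claim, the Hessian controls the first derivative along the real axis: it
  is at least \<delta> t for small t > 0, with \<delta> half of \<open>H 1 1\<close>. Monotonicity
  of g - \<delta> t^2 / 2 turns this into a lower bound \<delta> / 2 for the quotient, hence for its
  limit.\<close>

lemma nondegenerate_local_min_quadratic:
  assumes "nondegenerate_local_min_at_origin g"
  shows "(g has_derivative (\<lambda>h. 0)) (at 0)"
    and "((\<lambda>t. (g (of_real t * 1) - g 0) / t\<^sup>2) \<longlongrightarrow> b) (at_right 0) \<Longrightarrow> b > 0"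
proof -
  obtain A H where ev: "\<forall>\<^sub>F z in nhds 0. (g has_derivative A z) (at z)" and A0: "\<And>v. A 0 v = 0"
    and H: "\<And>v. ((\<lambda>z. A z v) has_derivative (\<lambda>u. H u v)) (at 0)" and pos: "\<And>v. v \<noteq> 0 \<Longrightarrow> H v v > 0"
    using assms unfolding nondegenerate_local_min_at_origin_def by blast
  show "(g has_derivative (\<lambda>h. 0)) (at 0)"
    using eventually_nhds_x_imp_x[OF ev] A0 by (metis (no_types, lifting) ext)
  assume lim: "((\<lambda>t. (g (of_real t * 1) - g 0) / t\<^sup>2) \<longlongrightarrow> b) (at_right 0)"
  define \<delta> where "\<delta> = H 1 1 / 2"
  have \<delta>: "\<delta> > 0" "\<delta> < H 1 1" using pos[of 1] by (auto simp: \<delta>_def)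
  have "((\<lambda>t. A (of_real t * 1) 1 /\<^sub>R t) \<longlongrightarrow> H 1 1) (at_right (0::real))"
    using directional_limit[OF H[of 1], of 1] A0 by simp
  then have "\<forall>\<^sub>F t in at_right (0::real). \<delta> < A (of_real t * 1) 1 /\<^sub>R t"
    using order_tendstoD(1) \<delta> by blast
  moreover note eventually_ray[OF ev, of 1]
  ultimately have "\<forall>\<^sub>F t in at_right (0::real). \<delta> < A (of_real t) 1 /\<^sub>R t \<and> (g has_derivative A (of_real t)) (at (of_real t))"
    by eventually_elim simp
  then obtain e where e: "e > 0" and ev: "\<And>t. 0 < t \<Longrightarrow> t < e \<Longrightarrow> \<delta> < A (of_real t) 1 /\<^sub>R t \<and> (g has_derivative A (of_real t)) (at (of_real t))"
    unfolding eventually_at_right_field by auto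
  have der: "\<exists>y. ((\<lambda>t. g (of_real t) - \<delta> * t\<^sup>2 / 2) has_real_derivative y) (at t) \<and> y \<ge> 0" if t: "0 \<le> t" "t < e" for t :: real
  proof -
    have "(g has_derivative A (of_real t)) (at (of_real t))"
      using ev[of t] t \<open>(g has_derivative (\<lambda>h. 0)) (at 0)\<close> A0 by (cases "t = 0") (auto, metis (no_types, lifting) ext)
    then have D: "((\<lambda>t. g (of_real t)) has_derivative (\<lambda>s. A (of_real t) (of_real s))) (at t)" and lin: "linear (A (of_real t))"
      using has_derivative_compose[OF has_derivative_of_real[OF has_derivative_ident], of g _ t UNIV]
      by (auto dest: has_derivative_linear)
    have "A (of_real t) (of_real s) = A (of_real t) 1 * s" for s
      using linear_scale[OF lin, of s 1] by (simp add: scaleR_conv_of_real mult.commute)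
    with D have D: "((\<lambda>t. g (of_real t)) has_real_derivative A (of_real t) 1) (at t)"
      by (simp add: has_field_derivative_def)
    have "((\<lambda>t. g (of_real t) - \<delta> * t\<^sup>2 / 2) has_real_derivative (A (of_real t) 1 - \<delta> * t)) (at t)"
      by (auto intro!: derivative_eq_intros D)
    moreover have "A (of_real t) 1 - \<delta> * t \<ge> 0"
    proof (cases "t = 0")
      case False
      then show ?thesis using ev[of t] t by (simp add: field_simps)
    qed (simp add: A0)
    ultimately show ?thesis by blast
  qed
  have "\<delta> / 2 \<le> (g (of_real t * 1) - g 0) / t\<^sup>2" if t: "0 < t" "t < e" for t :: real
  proof -
    have "g (of_real 0) - \<delta> * 0\<^sup>2 / 2 \<le> g (of_real t) - \<delta> * t\<^sup>2 / 2"
      by (rule DERIV_nonneg_imp_nondecreasing) (use t der in auto)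
    then show ?thesis using t by (simp add: field_simps)
  qed
  then have "\<forall>\<^sub>F t in at_right 0. \<delta> / 2 \<le> (g (of_real t * 1) - g 0) / t\<^sup>2"
    unfolding eventually_at_right_field using e by blast
  from tendsto_lowerbound[OF lim this] \<delta> show "b > 0" by auto
qed

lemma has_derivative_inverse_germ:
  assumes "\<forall>\<^sub>F z in nhds z0. g (f z) = z" "(f has_derivative A) (at z0)" "(g has_derivative B) (at (f z0))"
  shows "B (A h) = h"
proof -
  have "((\<lambda>z. g (f z)) has_derivative (\<lambda>h. B (A h))) (at z0)"
    by (rule has_derivative_compose[OF assms(2,3)])
  from has_derivative_unique[OF has_derivative_eventually_eq[OF assms(1) this] has_derivative_ident]
  show ?thesis by metis
qed

lemma ranalytic_eventually_differentiable:
  assumes "ranalytic f" shows "\<forall>\<^sub>F z in nhds 0. \<exists>A. (f has_derivative A) (at z)"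
  by (rule ranalytic_derivative[OF assms]) (auto elim: eventually_mono)

lemma symplectic_germ_inverse:
  assumes \<psi>: "symplectic_germ \<psi>" and \<phi>: "ranalytic \<phi>" "\<phi> 0 = 0"
    and inv: "\<forall>\<^sub>F z in nhds 0. \<psi> (\<phi> z) = z"
  shows "symplectic_germ \<phi>"
proof -
  have "\<forall>\<^sub>F z in nhds 0. symplectic_at \<psi> (\<phi> z)"
    by (rule eventually_nhds_continuous[OF ranalytic_isCont[OF \<phi>(1)]])
      (use \<psi> \<phi>(2) in \<open>simp add: symplectic_germ_def\<close>)
  with ranalytic_eventually_differentiable[OF \<phi>(1)] eventually_eventually[THEN iffD2, OF inv]
  show ?thesis unfolding symplectic_germ_def
  proof eventually_elim
    case (elim z)
    obtain A where A: "(\<phi> has_derivative A) (at z)" using elim(1) by blast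
    obtain B where B: "(\<psi> has_derivative B) (at (\<phi> z))" "\<And>u v. area_form (B u) (B v) = area_form u v"
      using elim(3) unfolding symplectic_at_def by blast
    have "area_form (A u) (A v) = area_form u v" for u v
      using B(2)[of "A u" "A v"] has_derivative_inverse_germ[OF elim(2) A B(1)] by simp
    with A show ?case unfolding symplectic_at_def by blast
  qed
qed

text \<open>The Morse chart \<open>M\<close> makes the levels of \<open>H\<close> circles but
  distorts area: its inverse \<open>N\<close> has Jacobian \<rho>. The radial normal form \<Psi> has
  the same Jacobian \<rho>, so \<Psi> after \<open>M\<close> is symplectic, and being radial it
  still sends levels to circles. The last conclusion concerns pairs of nearby points, to be applied
  to a point and its image under the map.\<close>

lemma symplectic_circle_coordinates:
  fixes H B :: "complex \<Rightarrow> real"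
  assumes A: "ranalytic A" "A 0 = 0" and B: "ranalytic (\<lambda>z. of_real (B z))" "B 0 > 0"
    and H: "\<forall>\<^sub>F z in nhds 0. H z = H 0 + (norm z)\<^sup>2 * B z + Re (z\<^sup>2 * A z)"
  obtains \<psi> \<phi> and c :: real where "c > 0" "ranalytic \<psi>" "\<psi> 0 = 0" "ranalytic \<phi>" "\<phi> 0 = 0"
    "\<forall>\<^sub>F z in nhds 0. \<psi> (\<phi> z) = z" "\<forall>\<^sub>F z in nhds 0. \<phi> (\<psi> z) = z"
    "(\<psi> has_derivative (\<lambda>h. of_real c * h)) (at 0)" "symplectic_germ \<psi>"
    "\<forall>\<^sub>F p in nhds 0 \<times>\<^sub>F nhds 0. H (fst p) = H (snd p) \<longrightarrow> norm (\<psi> (fst p)) = norm (\<psi> (snd p))"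
proof -
  obtain M and m :: real where M: "m > 0" "ranalytic M" "M 0 = 0" "(M has_derivative (\<lambda>h. of_real m * h)) (at 0)"
    and HM: "\<forall>\<^sub>F z in nhds 0. H z = H 0 + (norm (M z))\<^sup>2"
    by (rule ranalytic_Morse[OF A B H])
  obtain N where N: "ranalytic N" "N 0 = 0" "\<forall>\<^sub>F z in nhds 0. M (N z) = z" "\<forall>\<^sub>F z in nhds 0. N (M z) = z"
    using ranalytic_inverse[OF M(2-4)] M(1) by auto
  obtain u v where uv: "ranalytic u" "ranalytic v" "\<forall>\<^sub>F z in nhds 0. (N has_derivative (\<lambda>h. u z * h + v z * cnj h)) (at z)"
    by (rule ranalytic_derivative[OF N(1)])
  \<comment> \<open>The Jacobian determinant of \<open>N\<close> in terms of its Wirtinger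
    derivatives.\<close>
  define \<rho> where "\<rho> z = (norm (u z))\<^sup>2 - (norm (v z))\<^sup>2" for z
  have area_uv: "area_form (u z * x + v z * cnj x) (u z * y + v z * cnj y) = \<rho> z * area_form x y" for z x y
    unfolding \<rho>_def area_form_def cmod_power2 by (simp add: algebra_simps power2_eq_square)
  have "u 0 * (of_real m * h) + v 0 * cnj (of_real m * h) = h" for h
    using has_derivative_inverse_germ[OF N(4) M(4), of "\<lambda>h. u 0 * h + v 0 * cnj h"]
      eventually_nhds_x_imp_x[OF uv(3)] M(3) by simp
  then have *: "u 0 * of_real m * h + v 0 * of_real m * cnj h = h" for h
    by (simp add: algebra_simps)
  have "X = 1 \<and> Y = 0" if "\<And>h. X * h + Y * cnj h = h" for X Y :: complex
    using that[of 1] that[of \<i>] by (auto simp: complex_eq_iff)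
  from this[OF *] have "u 0 * of_real m = 1" "v 0 * of_real m = 0" by simp_all
  then have \<rho>0: "\<rho> 0 > 0" using M(1) by (auto simp: \<rho>_def)
  have "ranalytic (\<lambda>z. u z * cnj (u z) - v z * cnj (v z))"
    using uv by (intro ranalytic_diff ranalytic_mult ranalytic_cnj)
  then have \<rho>_an: "ranalytic (\<lambda>z. of_real (\<rho> z))"
    by (simp only: \<rho>_def of_real_diff complex_norm_square)
  obtain \<Psi> and k :: real where \<Psi>: "k > 0" "ranalytic \<Psi>" "\<Psi> 0 = 0" "(\<Psi> has_derivative (\<lambda>h. of_real k * h)) (at 0)"
    and radial: "\<forall>z z'. norm z = norm z' \<longrightarrow> norm (\<Psi> z) = norm (\<Psi> z')"
    and area: "\<forall>\<^sub>F z in nhds 0. \<exists>A. (\<Psi> has_derivative A) (at z) \<and>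
       (\<forall>u v. area_form (A u) (A v) = \<rho> z * area_form u v)"
    by (rule ranalytic_density_normal_form[OF \<rho>_an \<rho>0])
  define \<psi> where "\<psi> z = \<Psi> (M z)" for z
  have \<psi>: "ranalytic \<psi>" "\<psi> 0 = 0"
    unfolding \<psi>_def using ranalytic_compose[OF \<Psi>(2) M(2,3)] M(3) \<Psi>(3) by auto
  have d\<psi>: "(\<psi> has_derivative (\<lambda>h. of_real (k * m) * h)) (at 0)"
    using has_derivative_compose[OF M(4), of \<Psi> "\<lambda>h. of_real k * h"] \<Psi>(4) M(3)
    unfolding \<psi>_def[abs_def] by (simp add: mult.assoc)
  obtain \<phi> where \<phi>: "ranalytic \<phi>" "\<phi> 0 = 0" "\<forall>\<^sub>F z in nhds 0. \<psi> (\<phi> z) = z" "\<forall>\<^sub>F z in nhds 0. \<phi> (\<psi> z) = z"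
    using ranalytic_inverse[OF \<psi> d\<psi>] M(1) \<Psi>(1) by auto
  have M_ev: "\<forall>\<^sub>F z in nhds 0. P (M z)" if "\<forall>\<^sub>F z in nhds 0. P z" for P
    by (rule eventually_nhds_continuous[OF ranalytic_isCont[OF M(2)]]) (use that M(3) in simp)
  have "symplectic_germ \<psi>" unfolding symplectic_germ_def
    using ranalytic_eventually_differentiable[OF M(2)] M_ev[OF uv(3)] M_ev[OF area]
      eventually_eventually[THEN iffD2, OF N(4)]
  proof eventually_elim
    case (elim z)
    obtain D where D: "(M has_derivative D) (at z)" using elim(1) by blast
    obtain E where E: "(\<Psi> has_derivative E) (at (M z))" "\<And>x y. area_form (E x) (E y) = \<rho> (M z) * area_form x y"
      using elim(3) by blast
    have "(\<psi> has_derivative (\<lambda>h. E (D h))) (at z)"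
      unfolding \<psi>_def[abs_def] by (rule has_derivative_compose[OF D E(1)])
    moreover have "area_form (E (D x)) (E (D y)) = area_form x y" for x y
      using area_uv[of "M z" "D x" "D y"] has_derivative_inverse_germ[OF elim(4) D elim(2)] E(2) by simp
    ultimately show ?case unfolding symplectic_at_def by blast
  qed
  moreover have "\<forall>\<^sub>F p in nhds 0 \<times>\<^sub>F nhds 0. H (fst p) = H (snd p) \<longrightarrow> norm (\<psi> (fst p)) = norm (\<psi> (snd p))"
    unfolding eventually_prod_filter
  proof (intro exI conjI allI impI)
    show "\<forall>\<^sub>F z in nhds 0. H z = H 0 + (norm (M z))\<^sup>2" "\<forall>\<^sub>F z in nhds 0. H z = H 0 + (norm (M z))\<^sup>2" by fact+
    fix z z' assume *: "H z = H 0 + (norm (M z))\<^sup>2" "H z' = H 0 + (norm (M z'))\<^sup>2" "H (fst (z, z')) = H (snd (z, z'))"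
    then have "norm (M z) = norm (M z')" by simp
    with radial show "norm (\<psi> (fst (z, z'))) = norm (\<psi> (snd (z, z')))"
      unfolding fst_conv snd_conv \<psi>_def by blast
  qed
  ultimately show thesis
    using that[of "k * m" \<psi> \<phi>] M(1) \<Psi>(1) \<psi> d\<psi> \<phi> by simp
qed

section \<open>Symplectic maps preserving circles\<close>

text \<open>A symplectic map that preserves every circle about the origin commutes with rotations: its
  angular derivative is forced by the area, since the radial one is.\<close>

lemma symplectic_circle_map_equivariant:
  assumes F: "symplectic_germ F" "\<forall>\<^sub>F w in nhds 0. norm (F w) = norm w"
  obtains e where "e > 0" "\<And>r \<theta>. 0 < r \<Longrightarrow> r < e \<Longrightarrow> F (of_real r * cis \<theta>) = cis \<theta> * F (of_real r)"
proof -
  have "\<forall>\<^sub>F w in nhds 0. symplectic_at F w \<and> (\<forall>\<^sub>F w in nhds w. norm (F w) = norm w)"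
    using F(1) eventually_eventually[THEN iffD2, OF F(2)] unfolding symplectic_germ_def
    by eventually_elim simp
  then obtain e where e: "e > 0" and Fe: "\<And>w. norm w < e \<Longrightarrow> symplectic_at F w \<and> (\<forall>\<^sub>F w in nhds w. norm (F w) = norm w)"
    unfolding eventually_nhds_metric by auto
  have der: "\<exists>A. (F has_derivative A) (at w) \<and> A (\<i> * w) = \<i> * F w" if w: "norm w < e" "w \<noteq> 0" for w
  proof -
    obtain A where A: "(F has_derivative A) (at w)" "\<And>u v. area_form (A u) (A v) = area_form u v"
      using Fe[OF w(1)] unfolding symplectic_at_def by blast
    let ?p = "F w"
    have norm_eq: "\<forall>\<^sub>F w in nhds w. norm (F w) = norm w" using Fe[OF w(1)] by blast
    have p: "norm ?p = norm w" using eventually_nhds_x_imp_x[OF norm_eq] .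
    have "((\<lambda>w. F w \<bullet> F w) has_derivative (\<lambda>h. 2 * (F w \<bullet> A h))) (at w)"
      by (rule has_derivative_eq_rhs[OF has_derivative_inner[OF A(1) A(1)]]) (auto simp: inner_commute)
    moreover have "\<forall>\<^sub>F w in nhds w. F w \<bullet> F w = w \<bullet> w"
      using norm_eq by eventually_elim (simp add: dot_square_norm)
    ultimately have "((\<lambda>w. w \<bullet> w) has_derivative (\<lambda>h. 2 * (F w \<bullet> A h))) (at w)"
      by (rule has_derivative_eventually_eq[rotated])
    moreover have "((\<lambda>w. w \<bullet> w) has_derivative (\<lambda>h. 2 * (w \<bullet> h))) (at w)"
      by (rule has_derivative_eq_rhs[OF has_derivative_inner[OF has_derivative_ident has_derivative_ident]]) (auto simp: inner_commute)
    ultimately have inner: "F w \<bullet> A h = w \<bullet> h" for h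
      using has_derivative_unique by (metis (no_types, lifting) mult_cancel_left zero_neq_numeral)
    \<comment> \<open>Multiplying by the conjugate of \<open>F w\<close> turns inner products with
      \<open>F w\<close> into real parts. Preservation of the norm then fixes Re x and Re y, and
      preservation of area fixes Im y.\<close>
    define x y where "x = cnj ?p * A w" and "y = cnj ?p * A (\<i> * w)"
    have Re_eq: "Re (cnj a * b) = a \<bullet> b" for a b :: complex by (simp add: inner_complex_def)
    have x: "Re x = (norm w)\<^sup>2" unfolding x_def Re_eq inner by (simp add: power2_norm_eq_inner)
    have y: "Re y = 0" unfolding y_def Re_eq inner by (simp add: inner_complex_def)
    have "area_form x y = (norm w)\<^sup>2 * area_form w (\<i> * w)"
      unfolding x_def y_def area_form_mult A(2) by (simp add: p)
    also have "area_form w (\<i> * w) = (norm w)\<^sup>2"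
      unfolding area_form_def cmod_power2 by (simp add: power2_eq_square)
    finally have "(norm w)\<^sup>2 * Im y = (norm w)\<^sup>2 * (norm w)\<^sup>2"
      by (simp add: area_form_def x y)
    then have "Im y = (norm w)\<^sup>2" unfolding mult_cancel_left using w by simp
    then have "y = \<i> * of_real ((norm ?p)\<^sup>2)" using y by (simp add: complex_eq_iff p)
    also have "\<dots> = cnj ?p * (\<i> * ?p)" unfolding complex_norm_square by simp
    finally have "A (\<i> * w) = \<i> * ?p" using w p by (auto simp: y_def)
    with A(1) show ?thesis by blast
  qed
  show thesis
  proof (rule that[OF e])
    fix r \<theta> :: real assume r: "0 < r" "r < e"
    \<comment> \<open>Undoing the rotation gives a curve whose derivative vanishes, because the
      derivative of \<open>F\<close> sends the angular vector at w to the angular vector at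
      \<open>F w\<close>.\<close>
    define g where "g s = F (of_real r * cis s) * cis (- s)" for s
    have "(g has_vector_derivative 0) (at s)" for s
    proof -
      let ?w = "of_real r * cis s"
      obtain A where A: "(F has_derivative A) (at ?w)" "A (\<i> * ?w) = \<i> * F ?w"
        using der[of ?w] r by (auto simp: norm_mult)
      have "((\<lambda>s. of_real r * cis s) has_derivative (\<lambda>h. h *\<^sub>R (\<i> * ?w))) (at s)"
        by (rule has_derivative_eq_rhs[OF has_derivative_mult_right[OF has_derivative_cis[OF has_derivative_ident]]])
          (simp add: scaleR_conv_of_real mult_ac)
      from has_derivative_compose[OF this A(1)]
      have 1: "((\<lambda>s. F (of_real r * cis s)) has_derivative (\<lambda>h. h *\<^sub>R (\<i> * F ?w))) (at s)"
        using A(2) linear_scale[OF has_derivative_linear[OF A(1)]] by simp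
      have 2: "((\<lambda>s. cis (- s)) has_derivative (\<lambda>h. h *\<^sub>R (- \<i> * cis (- s)))) (at s)"
        by (rule has_derivative_eq_rhs[OF has_derivative_cis[OF has_derivative_minus[OF has_derivative_ident]]])
          simp
      show ?thesis
        unfolding g_def[abs_def] has_vector_derivative_def
        by (rule has_derivative_eq_rhs[OF has_derivative_mult[OF 1 2]]) (auto simp: algebra_simps)
    qed
    then have "g \<theta> = g 0"
      using has_vector_derivative_zero_constant[of UNIV g] by (metis UNIV_I convex_UNIV)
    then have "F (of_real r * cis \<theta>) * cis (- \<theta>) * cis \<theta> = F (of_real r) * cis \<theta>" by (simp add: g_def)
    then show "F (of_real r * cis \<theta>) = cis \<theta> * F (of_real r)"
      unfolding mult.assoc cis_mult by (simp add: mult.commute)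
  qed
qed


text \<open>\<open>J\<close> is constant along the orbit of \<open>w\<close>, and by Kronecker's
  theorem the fractional parts of k \<theta> come arbitrarily close to the angle \<alpha> from
  \<open>w\<close> to \<open>w'\<close>. Continuity of \<open>J\<close> at \<open>w'\<close> then
  forces equality.\<close>

lemma irrational_rotation_invariant_const:
  fixes J :: "complex \<Rightarrow> real"
  assumes \<kappa>: "norm \<kappa> = 1" "\<And>n. n > 0 \<Longrightarrow> \<kappa> ^ n \<noteq> 1"
    and cont: "\<And>w. norm w = r \<Longrightarrow> isCont J w" and inv: "\<And>w. norm w = r \<Longrightarrow> J (\<kappa> * w) = J w"
    and w: "norm w = r" and w': "norm w' = r"
  shows "J w' = J w"
proof (cases "r = 0")
  case True
  then show ?thesis using w w' by simp
next
  case False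
  have cis_frac: "cis (2 * pi * frac x) = cis (2 * pi * x)" for x
  proof -
    have "cis (2 * pi * x) = cis (2 * pi * frac x + 2 * pi * of_int \<lfloor>x\<rfloor>)"
      by (simp add: frac_def algebra_simps)
    then show ?thesis by (simp add: cis_mult[symmetric] cis_multiple_2pi)
  qed
  define \<theta> where "\<theta> = Arg \<kappa> / (2 * pi)"
  have \<kappa>_pow: "\<kappa> ^ k = cis (2 * pi * (real k * \<theta>))" for k
  proof -
    have "\<kappa> = cis (Arg \<kappa>)" using rcis_cmod_Arg[of \<kappa>] \<kappa>(1) by (simp add: rcis_def)
    from arg_cong[OF this, of "\<lambda>x. x ^ k"] have "\<kappa> ^ k = cis (real k * Arg \<kappa>)"
      by (simp only: Complex.DeMoivre)
    then show ?thesis by (simp add: \<theta>_def)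
  qed
  have irr: "\<theta> \<notin> \<rat>"
  proof
    assume "\<theta> \<in> \<rat>"
    then obtain a b where ab: "b > 0" "\<theta> = of_int a / of_int b" by (meson Rats_cases')
    then have "real (nat b) * \<theta> = of_int a" by simp
    then have "\<kappa> ^ nat b = 1" unfolding \<kappa>_pow by (simp add: cis_multiple_2pi)
    with \<kappa>(2)[of "nat b"] ab show False by simp
  qed
  have w0: "w \<noteq> 0" using w False by auto
  define \<alpha> where "\<alpha> = frac (Arg (w' / w) / (2 * pi))"
  have w'_eq: "w' = cis (2 * pi * \<alpha>) * w"
  proof -
    have "norm (w' / w) = 1" using w w' False by (simp add: norm_divide)
    then have "w' / w = cis (Arg (w' / w))" using rcis_cmod_Arg[of "w' / w"] by (simp add: rcis_def)
    also have "\<dots> = cis (2 * pi * \<alpha>)" unfolding \<alpha>_def cis_frac by simp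
    finally show ?thesis using w0 by (simp add: field_simps)
  qed
  have orbit: "J (\<kappa> ^ k * w) = J w" for k
  proof (induction k)
    case (Suc k)
    have "norm (\<kappa> ^ k * w) = r" using \<kappa>(1) w by (simp add: norm_mult norm_power)
    from inv[OF this] Suc show ?case by (simp add: mult.assoc)
  qed simp
  have "isCont (\<lambda>t. J (cis (2 * pi * t) * w)) \<alpha>"
  proof (rule isCont_o2[of _ _ J])
    show "isCont (\<lambda>t. cis (2 * pi * t) * w) \<alpha>"
      by (rule has_derivative_continuous[OF has_derivative_mult_left[OF
            has_derivative_cis[OF has_derivative_mult_right[OF has_derivative_ident]]]])
    show "isCont J (cis (2 * pi * \<alpha>) * w)" using cont w by (simp add: norm_mult)
  qed
  show ?thesis
  proof (rule ccontr)
    assume "J w' \<noteq> J w"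
    then have "\<bar>J w' - J w\<bar> > 0" by simp
    with \<open>isCont (\<lambda>t. J (cis (2 * pi * t) * w)) \<alpha>\<close> obtain d where d: "d > 0"
      "\<And>t. dist t \<alpha> < d \<Longrightarrow> dist (J (cis (2 * pi * t) * w)) (J w') < \<bar>J w' - J w\<bar>"
      unfolding continuous_at_eps_delta w'_eq[symmetric] by blast
    have "0 \<le> \<alpha>" "\<alpha> \<le> 1" unfolding \<alpha>_def using frac_ge_0 frac_lt_1 less_imp_le by blast+
    then obtain k where "\<bar>frac (real k * \<theta>) - \<alpha>\<bar> < d"
      using Kronecker_approx_1_explicit[OF irr _ _ d(1)] by blast
    from d(2)[of "frac (real k * \<theta>)"] this show False
      using orbit[of k] unfolding cis_frac \<kappa>_pow[symmetric] by (simp add: dist_real_def abs_minus_commute)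
  qed
qed

text \<open>Functionals that kill \<open>v\<close> are determined by their value at
  \<open>\<i> * v\<close>. Cross-multiplying these values gives the relation; if
  \<open>A1 (\<i> * v) = 0\<close>, then \<open>A1\<close> itself is zero and the coefficients 1, 0
  do.\<close>

lemma linear_functionals_dependent:
  fixes A1 A2 :: "complex \<Rightarrow> real"
  assumes lin: "linear A1" "linear A2" and v: "v \<noteq> 0" "A1 v = 0" "A2 v = 0"
  shows "\<exists>a b. (a \<noteq> 0 \<or> b \<noteq> 0) \<and> (\<forall>h. a * A1 h + b * A2 h = 0)"
proof -
  have *: "A h = Im (h / v) * A (\<i> * v)" if "linear A" "A v = 0" for A :: "complex \<Rightarrow> real" and h
  proof -
    have "h / v = of_real (Re (h / v)) + \<i> * of_real (Im (h / v))" by (simp add: complex_eq_iff)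
    then have "h = Re (h / v) *\<^sub>R v + Im (h / v) *\<^sub>R (\<i> * v)"
      using v(1) by (simp add: scaleR_conv_of_real field_simps)
    then have "A h = A (Re (h / v) *\<^sub>R v + Im (h / v) *\<^sub>R (\<i> * v))" by simp
    then show ?thesis unfolding linear_add[OF that(1)] linear_scale[OF that(1)] that(2) by simp
  qed
  have "A2 (\<i> * v) * A1 h + (- A1 (\<i> * v)) * A2 h = 0" "A1 (\<i> * v) = 0 \<Longrightarrow> 1 * A1 h + 0 * A2 h = 0" for h
    using *[OF lin(1) v(2), of h] *[OF lin(2) v(3), of h] by auto
  then show ?thesis by (metis neg_equal_0_iff_equal zero_neq_one)
qed

text \<open>On the real axis z = cnj z, so restricting the two-variable extension to the diagonal
  yields a one-variable holomorphic function.\<close>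

lemma ranalytic_real_axis:
  assumes "ranalytic g"
  obtains e h where "e > 0" "h holomorphic_on ball 0 e" "\<forall>x::real. \<bar>x\<bar> < e \<longrightarrow> g (of_real x) = h (of_real x)"
proof -
  obtain G where G: "holomorphic2 G" "\<forall>\<^sub>F z in nhds 0. g z = G (z, cnj z)"
    by (rule ranalyticE[OF assms])
  have D: "((\<lambda>x. (x, x)) has_derivative (\<lambda>h. (h, h))) (at x)" for x :: complex
    by (auto intro!: derivative_eq_intros)
  have "\<forall>\<^sub>F x in nhds 0. \<exists>u v. (G has_derivative (\<lambda>h. u * fst h + v * snd h)) (at (x, x))"
    by (rule eventually_nhds_continuous[OF has_derivative_continuous[OF D]])
      (use G(1) in \<open>simp add: holomorphic2_def zero_prod_def\<close>)
  with G(2) have "\<forall>\<^sub>F x in nhds 0. g x = G (x, cnj x) \<and>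
      (\<exists>u v. (G has_derivative (\<lambda>h. u * fst h + v * snd h)) (at (x, x)))"
    by eventually_elim blast
  then obtain e where e: "e > 0" and ev: "\<And>x. dist x 0 < e \<Longrightarrow> g x = G (x, cnj x) \<and>
      (\<exists>u v. (G has_derivative (\<lambda>h. u * fst h + v * snd h)) (at (x, x)))"
    unfolding eventually_nhds_metric by blast
  show thesis
  proof (rule that[OF e])
    have "\<exists>d. ((\<lambda>x. G (x, x)) has_field_derivative d) (at x)" if x: "x \<in> ball 0 e" for x
    proof -
      have "dist x 0 < e" using x by (simp add: dist_commute)
      then obtain u v where "(G has_derivative (\<lambda>h. u * fst h + v * snd h)) (at (x, x))"
        using ev by blast
      from has_derivative_compose[OF D this]
      have "((\<lambda>x. G (x, x)) has_derivative (\<lambda>h. (u + v) * h)) (at x)" by (simp add: algebra_simps)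
      then show ?thesis unfolding has_field_derivative_def by blast
    qed
    then show "(\<lambda>x. G (x, x)) holomorphic_on ball 0 e" by (simp add: holomorphic_on_open)
    show "\<forall>x::real. \<bar>x\<bar> < e \<longrightarrow> g (of_real x) = G (of_real x, of_real x)"
    proof (intro allI impI)
      fix x :: real assume "\<bar>x\<bar> < e"
      then show "g (of_real x) = G (of_real x, of_real x)" using ev[of "of_real x"] by simp
    qed
  qed
qed

text \<open>The rotation number is an analytic function of the radius, so being rational on an interval
  of radii makes it constant.\<close>

lemma circle_map_eq_rotation:
  assumes F: "ranalytic F" "F 0 = 0" "symplectic_germ F" "\<forall>\<^sub>F w in nhds 0. norm (F w) = norm w"
    and roots: "\<And>e. e > 0 \<Longrightarrow> \<exists>a b. 0 < a \<and> a < b \<and> b < e \<and>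
      (\<forall>r. a < r \<longrightarrow> r < b \<longrightarrow> (\<exists>n>0. (F (of_real r) / of_real r) ^ n = 1))"
  obtains \<kappa> where "\<forall>\<^sub>F w in nhds 0. F w = \<kappa> * w"
proof -
  \<comment> \<open>Where z is real, F z = z (g z + k z), so the quotient F r / r extends
    analytically through r = 0.\<close>
  obtain g k where gk: "ranalytic g" "ranalytic k" "\<forall>\<^sub>F z in nhds 0. F z = F 0 + z * g z + cnj z * k z"
    by (rule ranalytic_Hadamard[OF F(1)])
  obtain e1 where e1: "e1 > 0" "\<And>z. dist z 0 < e1 \<Longrightarrow> F z = F 0 + z * g z + cnj z * k z"
    using gk(3) unfolding eventually_nhds_metric by blast
  obtain e2 h where h: "e2 > 0" "h holomorphic_on ball 0 e2"
    "\<forall>x::real. \<bar>x\<bar> < e2 \<longrightarrow> g (of_real x) + k (of_real x) = h (of_real x)"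
    by (rule ranalytic_real_axis[OF ranalytic_add[OF gk(1,2)]])
  obtain e3 where e3: "e3 > 0" "\<And>r \<theta>. 0 < r \<Longrightarrow> r < e3 \<Longrightarrow> F (of_real r * cis \<theta>) = cis \<theta> * F (of_real r)"
    using symplectic_circle_map_equivariant[OF F(3,4)] by blast
  define e where "e = Min {e1, e2, e3}"
  have e: "e > 0" "e \<le> e1" "e \<le> e2" "e \<le> e3" using e1 h e3 by (auto simp: e_def)
  have Fh: "F (of_real r) = of_real r * h (of_real r)" if "0 < r" "r < e" for r
  proof -
    have "F (of_real r) = of_real r * (g (of_real r) + k (of_real r))"
      using e1(2)[of "of_real r"] that e F(2) by (simp add: algebra_simps)
    then show ?thesis using h(3) that e by simp
  qed
  obtain a b where ab: "0 < a" "a < b" "b < e"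
    "\<And>r. a < r \<Longrightarrow> r < b \<Longrightarrow> \<exists>n>0. (F (of_real r) / of_real r) ^ n = 1"
    using roots[OF e(1)] by blast
  let ?I = "(of_real :: real \<Rightarrow> complex) ` {a<..<b}"
  have I_sub: "?I \<subseteq> ball 0 e2" using ab e by auto
  have "h ` ?I \<subseteq> (\<Union>n\<in>{0<..}. {z. z ^ n = 1})"
  proof
    fix z assume "z \<in> h ` ?I"
    then obtain r where r: "a < r" "r < b" "z = h (of_real r)" by auto
    then have "F (of_real r) / of_real r = z" using Fh[of r] ab by simp
    with ab(4)[OF r(1,2)] show "z \<in> (\<Union>n\<in>{0<..}. {z. z ^ n = 1})" by auto
  qed
  moreover have "countable (\<Union>n\<in>{0::nat<..}. {z :: complex. z ^ n = 1})"
    by (intro countable_UN countableI_type countable_finite finite_roots_unity) auto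
  ultimately have "countable (h ` ?I)" by (rule countable_subset)
  moreover have conn: "connected (h ` ?I)"
    by (intro connected_continuous_image continuous_on_subset[OF holomorphic_on_imp_continuous_on[OF h(2)] I_sub]
        continuous_on_of_real continuous_on_id) auto
  \<comment> \<open>A connected set with two distinct points is uncountable.\<close>
  ultimately have const: "x = y" if "x \<in> h ` ?I" "y \<in> h ` ?I" for x y
    using connected_uncountable[OF conn that] by blast
  define m where "m = (a + b) / 2"
  have m: "a < m" "m < b" using ab by (auto simp: m_def)
  define \<kappa> where "\<kappa> = h (of_real m)"
  have h\<kappa>: "h x = \<kappa>" if x: "x \<in> ball 0 e2" for x
  proof -
    have "h x - \<kappa> = 0"
    proof (rule analytic_continuation[of "\<lambda>x. h x - \<kappa>" "ball 0 e2" ?I "of_real m"])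
      show "(\<lambda>x. h x - \<kappa>) holomorphic_on ball 0 e2" by (intro holomorphic_intros h)
      show "of_real m islimpt ?I"
        unfolding islimpt_approachable
      proof (intro allI impI)
        fix \<epsilon> :: real assume \<epsilon>: "\<epsilon> > 0"
        define d where "d = min \<epsilon> (b - m)"
        have d: "0 < d" "d \<le> \<epsilon>" "d \<le> b - m" using m \<epsilon> by (auto simp: d_def)
        define s where "s = m + d / 2"
        have "a < s" "s < b" "s \<noteq> m" "\<bar>s - m\<bar> < \<epsilon>" using m d by (simp_all add: s_def)
        then show "\<exists>x'\<in>?I. x' \<noteq> of_real m \<and> dist x' (of_real m) < \<epsilon>"
          by (intro bexI[of _ "of_real s"]) (auto simp: dist_norm simp flip: of_real_diff)
      qed
      show "h z - \<kappa> = 0" if "z \<in> ?I" for z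
        using const[of "h z" \<kappa>] that m by (auto simp: \<kappa>_def)
      have "of_real m \<in> ?I" using m by simp
      with I_sub show "of_real m \<in> ball (0::complex) e2" by blast
    qed (use x I_sub in auto)
    then show ?thesis by simp
  qed
  have "F w = \<kappa> * w" if w: "dist w 0 < e" for w
  proof (cases "w = 0")
    case False
    define r where "r = norm w"
    have r: "0 < r" "r < e" "w = of_real r * cis (Arg w)"
      using False w rcis_cmod_Arg[of w] by (auto simp: r_def rcis_def)
    have "F w = cis (Arg w) * F (of_real r)" using e3(2)[of r "Arg w"] r e by simp
    also have "\<dots> = cis (Arg w) * (of_real r * \<kappa>)" using Fh[OF r(1,2)] h\<kappa>[of "of_real r"] r e by simp
    also have "\<dots> = \<kappa> * (of_real r * cis (Arg w))" by simp
    finally show ?thesis using r(3) by simp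
  qed (simp add: F)
  then show thesis using e(1) by (intro that[of \<kappa>]) (auto simp: eventually_nhds_metric)
qed

section \<open>Regularity of the integrals and assembly of the conjugation\<close>

lemma real_analytic_eventually_isCont:
  fixes g :: "complex \<Rightarrow> real"
  assumes "real_analytic_at g 0" shows "\<forall>\<^sub>F z in nhds 0. isCont g z"
  using ranalytic_eventually_isCont[OF real_analytic_at_imp_ranalytic[OF assms bounded_linear_of_real]]
  by eventually_elim (use continuous_Re in fastforce)

text \<open>All three kinds of second integral enter the argument through continuity near 0. In the
  meromorphic case \<open>g\<close> is prescribed only on \<open>D\<close>, which is why 0 must be
  interior to \<open>D\<close>.\<close>

lemma regular_eventually_isCont:
  assumes U: "open U" "0 \<in> U" and D: "0 \<in> interior D"
    and reg: "(D = U \<and> real_analytic_on g U) \<or> real_meromorphic_no_pole_at_origin U D g \<or> (D = U \<and> smooth_on g U)"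
  shows "\<forall>\<^sub>F z in nhds 0. isCont g z"
  using reg
proof (elim disjE conjE)
  assume "real_analytic_on g U"
  then show ?thesis using U by (simp add: real_analytic_on_def real_analytic_eventually_isCont)
next
  assume "smooth_on g U"
  then have "Ck_on 0 g U" unfolding smooth_on_def by blast
  then have "\<forall>z\<in>U. isCont g z" using U by (simp add: continuous_on_eq_continuous_at)
  then show ?thesis using eventually_nhds_in_open[OF U] by (auto elim: eventually_mono)
next
  assume "real_meromorphic_no_pole_at_origin U D g"
  then obtain P Q where PQ: "real_analytic_on P U" "real_analytic_on Q U" "Q 0 \<noteq> 0"
    and D_eq: "D = {z \<in> U. Q z \<noteq> 0}" and g: "\<forall>z\<in>D. g z = P z / Q z"
    unfolding real_meromorphic_no_pole_at_origin_def by blast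
  have "\<forall>\<^sub>F z in nhds 0. isCont P z" "\<forall>\<^sub>F z in nhds 0. isCont Q z"
    using PQ U by (auto simp: real_analytic_on_def intro: real_analytic_eventually_isCont)
  moreover have "\<forall>\<^sub>F z in nhds 0. z \<in> interior D" using D by (intro eventually_nhds_in_open) auto
  ultimately show ?thesis
  proof eventually_elim
    case (elim z)
    have "z \<in> D" using elim interior_subset by blast
    then have "isCont (\<lambda>z. P z / Q z) z" using elim D_eq by (intro continuous_intros) auto
    moreover have "\<forall>\<^sub>F y in nhds z. P y / Q y = g y"
      using eventually_nhds_in_open[OF open_interior elim(3)]
      by eventually_elim (metis g interior_subset subsetD)
    ultimately show ?case by (rule isCont_cong[THEN iffD1, rotated])
  qed
qed

lemma symplectic_germ_compose:
  assumes "symplectic_germ f" "symplectic_germ g" "isCont g 0" "g 0 = 0"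
  shows "symplectic_germ (\<lambda>z. f (g z))"
proof -
  have "\<forall>\<^sub>F z in nhds 0. symplectic_at f (g z)"
    by (rule eventually_nhds_continuous[OF assms(3)]) (use assms in \<open>simp add: symplectic_germ_def\<close>)
  with assms(2) show ?thesis unfolding symplectic_germ_def
  proof eventually_elim
    case (elim z)
    then obtain A B where "(g has_derivative A) (at z)" "\<And>u v. area_form (A u) (A v) = area_form u v"
      "(f has_derivative B) (at (g z))" "\<And>u v. area_form (B u) (B v) = area_form u v"
      unfolding symplectic_at_def by blast
    then show ?case unfolding symplectic_at_def
      by (intro exI[of _ "\<lambda>h. B (A h)"]) (auto intro: has_derivative_compose)
  qed
qed

lemma first_integral_eventually:
  assumes "first_integral f D g" "isCont f 0" "f 0 = 0"
  shows "\<forall>\<^sub>F z in nhds 0. g (f z) = g z"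
proof -
  have D: "0 \<in> interior D" and ev: "\<forall>\<^sub>F z in nhds 0. z \<in> D \<longrightarrow> f z \<in> D \<longrightarrow> g (f z) = g z"
    using assms(1) unfolding first_integral_def by auto
  have 1: "\<forall>\<^sub>F z in nhds 0. z \<in> interior D" using D by (intro eventually_nhds_in_open) auto
  have 2: "\<forall>\<^sub>F z in nhds 0. f z \<in> interior D"
    by (rule eventually_nhds_continuous[OF assms(2)]) (use 1 assms(3) in simp)
  from ev 1 2 show ?thesis by eventually_elim (use interior_subset in blast)
qed


text \<open>On a circle with irrational rotation number both integrals are constant, so that their
  differentials are dependent along the circle.\<close>

lemma independent_integrals_imp_root_of_unity:
  fixes I1 I2 :: "complex \<Rightarrow> real"
  assumes \<phi>: "\<And>w. norm w = r \<Longrightarrow> isCont \<phi> w" "symplectic_at \<phi> w0" and w0: "norm w0 = r" "w0 \<noteq> 0"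
    and cont: "\<And>w. norm w = r \<Longrightarrow> isCont I1 (\<phi> w)" "\<And>w. norm w = r \<Longrightarrow> isCont I2 (\<phi> w)"
    and inv: "\<And>w. norm w = r \<Longrightarrow> I1 (\<phi> (\<kappa> * w)) = I1 (\<phi> w)" "\<And>w. norm w = r \<Longrightarrow> I2 (\<phi> (\<kappa> * w)) = I2 (\<phi> w)"
    and \<kappa>: "norm \<kappa> = 1" and indep: "functionally_independent_on V I1 I2" "\<phi> w0 \<in> V"
  shows "\<exists>n>0. \<kappa> ^ n = 1"
proof (rule ccontr)
  assume "\<not> ?thesis"
  then have \<kappa>_irr: "\<kappa> ^ n \<noteq> 1" if "n > 0" for n using that by blast
  obtain A1 A2 where A: "(I1 has_derivative A1) (at (\<phi> w0))" "(I2 has_derivative A2) (at (\<phi> w0))"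
    "\<forall>a b :: real. (\<forall>h. a * A1 h + b * A2 h = 0) \<longrightarrow> a = 0 \<and> b = 0"
    using indep unfolding functionally_independent_on_def by blast
  obtain D where D: "(\<phi> has_derivative D) (at w0)" "\<And>u v. area_form (D u) (D v) = area_form u v"
    using \<phi>(2) unfolding symplectic_at_def by blast
  have zero: "A (D (\<i> * w0)) = 0"
    if I: "(I has_derivative A) (at (\<phi> w0))" "\<And>w. norm w = r \<Longrightarrow> isCont I (\<phi> w)"
      "\<And>w. norm w = r \<Longrightarrow> I (\<phi> (\<kappa> * w)) = I (\<phi> w)" for I :: "complex \<Rightarrow> real" and A
  proof -
    have const: "I (\<phi> (cis t * w0)) = I (\<phi> w0)" for t
      by (rule irrational_rotation_invariant_const[OF \<kappa> \<kappa>_irr, of r "\<lambda>w. I (\<phi> w)" w0])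
        (use I(3) w0 in \<open>auto simp: norm_mult intro: isCont_o2[OF \<phi>(1) I(2)]\<close>)
    have "((\<lambda>t. cis t * w0) has_derivative (\<lambda>h. h *\<^sub>R (\<i> * w0))) (at 0)"
      by (rule has_derivative_eq_rhs[OF has_derivative_mult_left[OF has_derivative_cis[OF has_derivative_ident]]]) simp
    moreover have "((\<lambda>w. I (\<phi> w)) has_derivative (\<lambda>h. A (D h))) (at (cis 0 * w0))"
      using has_derivative_compose[OF D(1) I(1)] by simp
    ultimately have "((\<lambda>t. I (\<phi> (cis t * w0))) has_derivative (\<lambda>h. A (D (h *\<^sub>R (\<i> * w0))))) (at 0)"
      by (rule has_derivative_compose)
    then have "((\<lambda>t :: real. I (\<phi> w0)) has_derivative (\<lambda>h. A (D (h *\<^sub>R (\<i> * w0))))) (at 0)"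
      unfolding const .
    from has_derivative_unique[OF this has_derivative_const] show ?thesis by (metis scaleR_one)
  qed
  \<comment> \<open>An area-preserving linear map is injective; otherwise the area spanned by
    \<open>w0\<close> and \<open>\<i> * w0\<close> would vanish.\<close>
  have "D (\<i> * w0) \<noteq> 0"
  proof
    assume "D (\<i> * w0) = 0"
    then have "area_form w0 (\<i> * w0) = 0" using D(2)[of w0 "\<i> * w0"] by (simp add: area_form_def)
    then show False using w0(2) by (simp add: area_form_def complex_eq_iff)
  qed
  from linear_functionals_dependent[OF has_derivative_linear[OF A(1)] has_derivative_linear[OF A(2)] this
      zero[OF A(1) cont(1) inv(1)] zero[OF A(2) cont(2) inv(2)]] A(3)
  show False by blast
qed

theorem corollary4p6:
  fixes f :: "complex \<Rightarrow> complex"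
    and p q :: nat
    and I1 I2 :: "complex \<Rightarrow> real"
    and U V D :: "complex set"
  assumes f_analytic: "real_analytic_at f 0"
    and f_symplectic: "symplectic_germ f"
    and f_elliptic: "elliptic_fixed_point_at_origin f (real p / real q)"
    and f_coordinate: "linear_part f = (\<lambda>z. cis (2 * pi * (real p / real q)) * z)"
    and pq: "coprime p q" "q \<ge> 3"
    and U: "open U" "0 \<in> U"
    and I1_analytic: "real_analytic_on I1 U"
    and I1_integral: "first_integral f U I1"
    and I1_min: "nondegenerate_local_min_at_origin I1"
    and I2_regular:
      "(D = U \<and> real_analytic_on I2 U) \<or>
       real_meromorphic_no_pole_at_origin U D I2 \<or>
       (D = U \<and> smooth_on I2 U)"
    and I2_integral: "first_integral f D I2"
    and V: "open V" "V \<subseteq> D" "U \<subseteq> closure V"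
    and independent: "functionally_independent_on V I1 I2"
  shows "analytically_symplectically_conjugate f (linear_part f)"
proof -
  define \<omega> where "\<omega> = real p / real q"
  define \<mu> where "\<mu> = cis (2 * pi * \<omega>)"
  have \<omega>: "0 < \<omega>" "\<omega> < 1/2" and f0: "f 0 = 0"
    using f_elliptic unfolding elliptic_fixed_point_at_origin_def \<omega>_def by auto
  have \<mu>: "norm \<mu> = 1" "\<mu>\<^sup>2 \<noteq> 1"
  proof -
    show "norm \<mu> = 1" by (simp add: \<mu>_def)
    \<comment> \<open>The bounds 0 < \<omega> < 1/2 put \<mu> in the open upper half plane, so it is
      neither 1 nor -1.\<close>
    have "Im \<mu> > 0" using \<omega> by (auto simp: \<mu>_def intro!: sin_gt_zero)
    then show "\<mu>\<^sup>2 \<noteq> 1" by (auto simp: power2_eq_1_iff)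
  qed
  have f_an: "ranalytic f"
    using real_analytic_at_imp_ranalytic[OF f_analytic bounded_linear_ident] .
  have f_cont: "isCont f 0" by (rule ranalytic_isCont[OF f_an])
  have df: "(f has_derivative (\<lambda>h. \<mu> * h)) (at 0)"
  proof -
    have "f differentiable (at 0)"
      using eventually_nhds_x_imp_x[OF ranalytic_eventually_differentiable[OF f_an]] differentiable_def by blast
    then have "(f has_derivative linear_part f) (at 0)"
      unfolding linear_part_def by (simp add: frechet_derivative_works)
    then show ?thesis unfolding f_coordinate \<mu>_def \<omega>_def .
  qed
  have I1_an: "real_analytic_at I1 0" using I1_analytic U by (simp add: real_analytic_on_def)
  obtain a A and B :: "complex \<Rightarrow> real" where AB: "ranalytic A" "ranalytic (\<lambda>z. of_real (B z))"
    and I1_exp: "\<forall>\<^sub>F z in nhds 0. I1 z = I1 0 + Re (a * z) + (norm z)\<^sup>2 * B z + Re (z\<^sup>2 * A z)"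
    by (rule ranalytic_real_expand2[OF real_analytic_at_imp_ranalytic[OF I1_an bounded_linear_of_real]])
  have I1_inv: "\<forall>\<^sub>F z in nhds 0. I1 (f z) = I1 z"
    by (rule first_integral_eventually[OF I1_integral f_cont f0])
  have I2_inv: "\<forall>\<^sub>F z in nhds 0. I2 (f z) = I2 z"
    by (rule first_integral_eventually[OF I2_integral f_cont f0])
  note expansion = invariant_expansion[OF AB I1_exp nondegenerate_local_min_quadratic(1)[OF I1_min]
      f0 df f_cont I1_inv \<mu>]
  have B0: "B 0 > 0"
    using nondegenerate_local_min_quadratic(2)[OF I1_min, of "B 0"] expansion(3)[of 1] by simp
  have "\<forall>\<^sub>F z in nhds 0. I1 z = I1 0 + (norm z)\<^sup>2 * B z + Re (z\<^sup>2 * A z)"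
    using I1_exp unfolding expansion(1) by simp
  then obtain \<psi> \<phi> and c :: real where c: "c > 0" and \<psi>: "ranalytic \<psi>" "\<psi> 0 = 0" and \<phi>: "ranalytic \<phi>" "\<phi> 0 = 0"
    and inv: "\<forall>\<^sub>F z in nhds 0. \<psi> (\<phi> z) = z" "\<forall>\<^sub>F z in nhds 0. \<phi> (\<psi> z) = z"
    and d\<psi>: "(\<psi> has_derivative (\<lambda>h. of_real c * h)) (at 0)" and \<psi>_symp: "symplectic_germ \<psi>"
    and circles: "\<forall>\<^sub>F p in nhds 0 \<times>\<^sub>F nhds 0. I1 (fst p) = I1 (snd p) \<longrightarrow> norm (\<psi> (fst p)) = norm (\<psi> (snd p))"
    by (rule symplectic_circle_coordinates[OF AB(1) expansion(2) AB(2) B0])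
  have \<phi>_symp: "symplectic_germ \<phi>" by (rule symplectic_germ_inverse[OF \<psi>_symp \<phi> inv(1)])
  have \<phi>_ev: "\<forall>\<^sub>F w in nhds 0. P (\<phi> w)" if "\<forall>\<^sub>F z in nhds 0. P z" for P
    by (rule eventually_nhds_continuous[OF ranalytic_isCont[OF \<phi>(1)]]) (use that \<phi>(2) in simp)
  have f\<phi>: "ranalytic (\<lambda>w. f (\<phi> w))" "f (\<phi> 0) = 0"
    using ranalytic_compose[OF f_an \<phi>] \<phi>(2) f0 by auto
  have f\<phi>_ev: "\<forall>\<^sub>F w in nhds 0. P (f (\<phi> w))" if "\<forall>\<^sub>F z in nhds 0. P z" for P
    by (rule eventually_nhds_continuous[OF ranalytic_isCont[OF f\<phi>(1)]]) (use that f\<phi>(2) in simp)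
  define F where "F w = \<psi> (f (\<phi> w))" for w
  have F: "ranalytic F" "F 0 = 0"
    unfolding F_def using ranalytic_compose[OF \<psi>(1) f\<phi>] f\<phi>(2) \<psi>(2) by auto
  have F_symp: "symplectic_germ F"
    unfolding F_def using symplectic_germ_compose[OF \<psi>_symp symplectic_germ_compose[OF f_symplectic \<phi>_symp]]
      ranalytic_isCont \<phi> f\<phi> by simp
  have F_norm: "\<forall>\<^sub>F w in nhds 0. norm (F w) = norm w"
  proof -
    have "((\<lambda>w. f (\<phi> w)) \<longlongrightarrow> 0) (nhds 0)" "(\<phi> \<longlongrightarrow> 0) (nhds 0)"
      using f\<phi>_ev \<phi>_ev by (simp_all add: filterlim_iff)
    from eventually_compose_filterlim[OF circles filterlim_Pair[OF this]] \<phi>_ev[OF I1_inv] inv(1)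
    show ?thesis by eventually_elim (simp add: F_def)
  qed
  have roots: "\<exists>a b. 0 < a \<and> a < b \<and> b < e \<and>
      (\<forall>r. a < r \<longrightarrow> r < b \<longrightarrow> (\<exists>n>0. (F (of_real r) / of_real r) ^ n = 1))" if e: "e > 0" for e :: real
  proof -
    obtain e1 where e1: "e1 > 0" "\<And>r \<theta>. 0 < r \<Longrightarrow> r < e1 \<Longrightarrow> F (of_real r * cis \<theta>) = cis \<theta> * F (of_real r)"
      using symplectic_circle_map_equivariant[OF F_symp F_norm] by blast
    have I2_cont: "\<forall>\<^sub>F z in nhds 0. isCont I2 z"
      using I2_integral by (intro regular_eventually_isCont[OF U _ I2_regular]) (simp add: first_integral_def)
    have \<phi>F: "\<forall>\<^sub>F w in nhds 0. \<phi> (F w) = f (\<phi> w)"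
      using f\<phi>_ev[OF inv(2)] by eventually_elim (simp add: F_def)
    have "\<forall>\<^sub>F w in nhds 0. isCont \<phi> w \<and> symplectic_at \<phi> w \<and> isCont I1 (\<phi> w) \<and> isCont I2 (\<phi> w) \<and>
        I1 (\<phi> (F w)) = I1 (\<phi> w) \<and> I2 (\<phi> (F w)) = I2 (\<phi> w) \<and> norm (F w) = norm w"
      using ranalytic_eventually_isCont[OF \<phi>(1)] \<phi>_symp[unfolded symplectic_germ_def]
        \<phi>_ev[OF real_analytic_eventually_isCont[OF I1_an]] \<phi>_ev[OF I2_cont] \<phi>F \<phi>_ev[OF I1_inv] \<phi>_ev[OF I2_inv] F_norm
      by eventually_elim simp
    then obtain e2 where e2: "e2 > 0" and good: "\<And>w. dist w 0 < e2 \<Longrightarrow> isCont \<phi> w \<and> symplectic_at \<phi> w \<and>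
        isCont I1 (\<phi> w) \<and> isCont I2 (\<phi> w) \<and>
        I1 (\<phi> (F w)) = I1 (\<phi> w) \<and> I2 (\<phi> (F w)) = I2 (\<phi> w) \<and> norm (F w) = norm w"
      unfolding eventually_nhds_metric by blast
    define d where "d = Min {e, e1, e2}"
    have d: "d > 0" "d \<le> e" "d \<le> e1" "d \<le> e2" using e e1 e2 by (auto simp: d_def)
    have "\<forall>\<^sub>F z in nhds 0. norm (\<psi> z) < d \<and> \<phi> (\<psi> z) = z"
    proof (rule eventually_conj[OF _ inv(2)])
      have "\<forall>\<^sub>F w :: complex in nhds (\<psi> 0). norm w < d"
        unfolding eventually_nhds_metric using d \<psi>(2) by (intro exI[of _ d]) auto
      then show "\<forall>\<^sub>F z in nhds 0. norm (\<psi> z) < d"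
        by (rule eventually_nhds_continuous[OF ranalytic_isCont[OF \<psi>(1)]])
    qed
    then obtain W where W: "open W" "0 \<in> W" "\<And>z. z \<in> W \<Longrightarrow> norm (\<psi> z) < d \<and> \<phi> (\<psi> z) = z"
      unfolding eventually_nhds by blast
    have "W \<inter> V \<noteq> {}"
      using W(1,2) U(2) V(3) open_Int_closure_eq_empty[of W V] by blast
    \<comment> \<open>A nonempty open set is not a single point, so a point of independence other
      than the origin exists; its circle has positive radius.\<close>
    then have "\<not> W \<inter> V \<subseteq> {0}"
      using open_Int[OF W(1) V(1)] not_open_singleton[of "0::complex"] by (metis subset_singletonD)
    then obtain z0 where z0: "z0 \<in> W" "z0 \<in> V" "z0 \<noteq> 0" by blast
    define w0 where "w0 = \<psi> z0"
    have w0: "norm w0 < d" "\<phi> w0 = z0" "w0 \<noteq> 0"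
      using W(3)[OF z0(1)] z0(3) \<phi>(2) by (auto simp: w0_def)
    have "\<forall>\<^sub>F w in nhds w0. \<phi> w \<in> V"
    proof (rule eventually_nhds_continuous[where g = \<phi>])
      show "isCont \<phi> w0" using good[of w0] w0 d by simp
      show "\<forall>\<^sub>F z in nhds (\<phi> w0). z \<in> V" using V(1) z0 w0 by (simp add: eventually_nhds_in_open)
    qed
    then obtain s where s: "s > 0" "\<And>w. dist w w0 < s \<Longrightarrow> \<phi> w \<in> V"
      unfolding eventually_nhds_metric by blast
    define b where "b = min (norm w0 + s) d"
    have b: "norm w0 < b" "b \<le> d" "b \<le> norm w0 + s" using s w0 by (auto simp: b_def)
    \<comment> \<open>The midpoint lies strictly below \<open>b\<close>, and \<open>b\<close> may
      equal \<open>e\<close>, while the upper end of the interval must be less than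
      \<open>e\<close>.\<close>
    define b' where "b' = (norm w0 + b) / 2"
    have b': "norm w0 < b'" "b' < b" using b by (auto simp: b'_def)
    have "\<exists>n>0. (F (of_real r) / of_real r) ^ n = 1" if r: "norm w0 < r" "r < b'" for r
    proof -
      have r_pos: "0 < r" "r < d" using r w0 b b' norm_ge_zero[of w0] by linarith+
      \<comment> \<open>The point of radius r on the ray through \<open>w0\<close>; it is within s
        of \<open>w0\<close>, so its image under \<phi> stays in \<open>V\<close>.\<close>
      define w where "w = of_real (r / norm w0) * w0"
      define \<kappa> where "\<kappa> = F (of_real r) / of_real r"
      have w: "norm w = r" "w \<noteq> 0" using w0 r_pos by (auto simp: w_def norm_mult norm_divide)
      have "w - w0 = of_real (r / norm w0 - 1) * w0" by (simp add: w_def algebra_simps)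
      then have "dist w w0 = \<bar>r / norm w0 - 1\<bar> * norm w0"
        by (simp only: dist_norm norm_mult norm_of_real)
      also have "\<dots> = \<bar>(r / norm w0 - 1) * norm w0\<bar>" by (simp add: abs_mult)
      also have "\<dots> = r - norm w0" using w0 r by (simp add: algebra_simps)
      finally have wV: "\<phi> w \<in> V" using r b b' by (intro s(2)) simp
      \<comment> \<open>Equivariance extends the value at the real point of the circle to the whole
        circle, so \<open>F\<close> acts on it as multiplication by \<kappa>.\<close>
      have F\<kappa>: "F v = \<kappa> * v" if v: "norm v = r" for v
      proof -
        have v_eq: "v = of_real r * cis (Arg v)" using rcis_cmod_Arg[of v] v by (simp add: rcis_def)
        then have "F v = cis (Arg v) * F (of_real r)" using e1(2)[of r "Arg v"] r_pos d by simp
        also have "\<dots> = \<kappa> * (of_real r * cis (Arg v))" using r_pos by (simp add: \<kappa>_def)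
        finally show ?thesis using v_eq by simp
      qed
      have good_r: "dist v 0 < e2" if "norm v = r" for v :: complex using that r_pos d by simp
      have "norm (F (of_real r)) = r" using good[OF good_r, of "of_real r"] r_pos by simp
      then have \<kappa>: "norm \<kappa> = 1" using r_pos by (simp add: \<kappa>_def norm_divide)
      have "\<exists>n>0. \<kappa> ^ n = 1"
        by (rule independent_integrals_imp_root_of_unity[where \<phi> = \<phi>, OF _ _ w _ _ _ _ \<kappa> independent wV])
          (use good[OF good_r] F\<kappa> w in auto)
      then show ?thesis unfolding \<kappa>_def .
    qed
    then show ?thesis
      using w0 b b' d by (intro exI[of _ "norm w0"] exI[of _ b']) auto
  qed
  obtain \<kappa> where \<kappa>: "\<forall>\<^sub>F w in nhds 0. F w = \<kappa> * w"
    using circle_map_eq_rotation[OF F F_symp F_norm roots] by blast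
  \<comment> \<open>Comparison of derivatives at 0: that of \<psi> is the scalar c, which cancels
    against the derivative of \<phi> on the other side of \<mu>.\<close>
  have "\<kappa> = \<mu>"
  proof -
    obtain E where E: "(\<phi> has_derivative E) (at 0)"
      using eventually_nhds_x_imp_x[OF ranalytic_eventually_differentiable[OF \<phi>(1)]] by blast
    have cE: "of_real c * E h = h" for h
      using has_derivative_inverse_germ[OF inv(1) E] d\<psi> \<phi>(2) by simp
    have "((\<lambda>w. f (\<phi> w)) has_derivative (\<lambda>h. \<mu> * E h)) (at 0)"
      using has_derivative_compose[OF E, of f "\<lambda>h. \<mu> * h"] df \<phi>(2) by simp
    from has_derivative_compose[OF this, of \<psi> "\<lambda>h. of_real c * h"]
    have "(F has_derivative (\<lambda>h. of_real c * (\<mu> * E h))) (at 0)"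
      using d\<psi> f\<phi>(2) by (simp add: F_def[abs_def])
    moreover have "of_real c * (\<mu> * E h) = \<mu> * h" for h
      using cE[of h] by (metis mult.left_commute)
    ultimately have 1: "(F has_derivative (\<lambda>h. \<mu> * h)) (at 0)" by simp
    have "\<forall>\<^sub>F w in nhds 0. \<kappa> * w = F w" using \<kappa> by eventually_elim simp
    then have "(F has_derivative (\<lambda>h. \<kappa> * h)) (at 0)"
      by (rule has_derivative_eventually_eq) (auto intro!: derivative_eq_intros)
    from has_derivative_unique[OF this 1] show ?thesis by (metis mult.right_neutral)
  qed
  then have "\<forall>\<^sub>F w in nhds 0. \<psi> (f (\<phi> w)) = linear_part f w"
    using \<kappa> unfolding F_def f_coordinate \<mu>_def \<omega>_def by simp
  then show ?thesis
    unfolding analytically_symplectically_conjugate_def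
    using ranalytic_imp_real_analytic_at \<phi> \<psi> inv \<phi>_symp by blast
qed

end
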